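(* Let $\mathcal{M}$ be a connected Riemannian manifold, $R:T\mathcal{M}\to\mathcal{M}$ a retraction, $F:\mathcal{M}\to\mathbb{R}$ a $C^1$ function, $K$ a compact subset of $\mathcal{M}$, and $A>0$ a constant such that $\nabla F$ is $R$-Lipschitz on $K$ up to radius $A$. Let $\{(\Omega_t,\mathcal{F}_t,\mu_t)\}_{t=0}^\infty$ be a sequence of probability spaces and $\{H_t:\mathcal{M}\times\Omega_t\to T\mathcal{M}\}_{t=0}^\infty$ a sequence of functions such that: (a) for all $t\ge 0$ and $\omega\in\Omega_t$, $H_t(\bullet,\omega)$ is a tangent vector field on $\mathcal{M}$; (b) either, for every $t\ge 0$, $\Omega_t$ is a finite set and $\mathcal{F}_t$ consists of all subsets of $\Omega_t$; or, for every $t\ge 0$, $H_t:(\mathcal{M}\times\Omega_t,\mathcal{B}_{\mathcal{M}}\otimes\mathcal{F}_t)\to(T\mathcal{M},\mathcal{B}_{T\mathcal{M}})$ is measurable; (c) $\int_{\Omega_t}H_t(x,\omega)\,d\mu_t=\nabla F(x)$ for all $t\ge 0$ and $x\in\mathcal{M}$; (d) $\|H_t(x,\omega)\|_x\le A$ for all $t\ge 0$, $x\in K$ and $\omega\in\Omega_t$. Let $\{\omega_t\}_{t=0}^\infty$ be a sequence of independent random variables such that $\omega_t$ takes values in $\Omega_t$ with probability distribution $\mu_t$. Let $x_0$ be a fixed point in $K$, and let $\alpha,\beta,\varepsilon$ be fixed positive numbers with $0<\varepsilon\le\frac12$ and $0<\alpha\le\beta^{\frac12+\varepsilon}$. Let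 $\{x_t\}_{t=0}^\infty\subset\mathcal{M}$ and $\{\eta_t\}_{t=0}^\infty$ be generated by $$x_{t+1}=R_{x_t}\left(-\eta_tH_t(x_t,\omega_t)\right),\qquad \eta_t=\frac{\alpha}{\left(\beta+\sum_{k=0}^{t-1}\|H_k(x_k,\omega_k)\|_{x_k}^2\right)^{\frac12+\varepsilon}}\quad\text{for } t\ge 0.$$ Assume that $\{x_t\}_{t=0}^\infty\subset K$. Then $F(x_t)$ converges almost surely and $\|\nabla F(x_t)\|_{x_t}\to 0$ almost surely.
   Context: Retraction: a $C^2$ map $R:T\mathcal{M}\to\mathcal{M}$ such that for every $x\in\mathcal{M}$ the restriction $R_x=R|_{T_x\mathcal{M}}$ satisfies $R_x(\mathbf{0}_x)=x$ and $dR_x(\mathbf{0}_x)=\mathrm{id}_{T_x\mathcal{M}}$ (under the standard identification $T_{\mathbf{0}_x}T_x\mathcal{M}\cong T_x\mathcal{M}$). $\langle\cdot,\cdot\rangle_x$ and $\|\cdot\|_x$ are the Riemannian inner product and norm on $T_x\mathcal{M}$; $\nabla F$ is the Riemannian gradient. For $x\in\mathcal{M}$, $\mathbf{u}\in T_x\mathcal{M}$, identify $T_{\mathbf{u}}(T_x\mathcal{M})$ with $T_x\mathcal{M}$, so that $dR_x|_{\mathbf{u}}:T_x\mathcal{M}\to T_{R_x(\mathbf{u})}\mathcal{M}$ is linear, and let $\mathrm{adj}(dR_x|_{\mathbf{u}}):T_{R_x(\mathbf{u})}\mathcal{M}\to T_x\mathcal{M}$ be its adjoint: $\langle\mathbf{v},\mathrm{adj}(dR_x|_{\mathbf{u}})(\mathbf{w})\rangle_x=\langle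 dR_x|_{\mathbf{u}}(\mathbf{v}),\mathbf{w}\rangle_{R_x(\mathbf{u})}$ for all $\mathbf{v},\mathbf{w}$. $R$-Lipschitz: for a subset $K\subset\mathcal{M}$ and $r>0$, a vector field $\mathbf{v}$ on $\mathcal{M}$ is $R$-Lipschitz on $K$ up to radius $r$ if there is a constant $C>0$ (depending on $K$ and $r$) such that $\|\mathrm{adj}(dR_x|_{\mathbf{u}})(\mathbf{v}(R_x(\mathbf{u})))-\mathbf{v}(x)\|_x\le C\|\mathbf{u}\|_x$ for all $x\in K$ and $\mathbf{u}\in T_x\mathcal{M}$ with $\|\mathbf{u}\|_x\le r$. $\mathcal{B}_{\mathcal{M}}$ and $\mathcal{B}_{T\mathcal{M}}$ are the Borel $\sigma$-algebras of $\mathcal{M}$ and $T\mathcal{M}$; $\otimes$ denotes the product $\sigma$-algebra. An empty sum is $0$. *)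

theory Defs
  imports "HOL-Probability.Probability"
begin

text \<open>
  Manifolds are modelled on a type \<open>'e\<close> of class \<open>euclidean_space\<close>; the underlying space is a whole
  type \<open>'m\<close>, Hausdorff and second countable by its sort. The smooth structure is given by an atlas,
  which need not be maximal.

  Tangent vectors: at every point \<open>x\<close> one preferred chart \<open>chart_at \<A> x\<close> is fixed, and \<open>T\<^sub>xM\<close> is
  identified with \<open>'e\<close> by taking coordinates in that chart. Points of the tangent bundle are pairs
  \<open>(x, v) :: 'm \<times> 'e\<close>. As the preferred chart may jump from point to point, the product topology of
  \<open>'m \<times> 'e\<close> is not the topology of \<open>TM\<close>: the smooth structure, the topology and the Borel sets of
  \<open>TM\<close> are those induced by \<open>tangent_atlas\<close>.
\<close>

section \<open>Differentiability classes\<close>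

text \<open>Only used on open sets \<open>S\<close> of finite-dimensional spaces, where asking all iterated directional
  derivatives to exist, to be differentiable up to order \<open>k - 1\<close> and to be continuous at order \<open>k\<close>
  is the usual notion of a \<open>C\<^sup>k\<close> map.\<close>

primrec Ck_on :: "nat \<Rightarrow> ('a::real_normed_vector \<Rightarrow> 'b::real_normed_vector) \<Rightarrow> 'a set \<Rightarrow> bool" where
  "Ck_on 0 f S \<longleftrightarrow> continuous_on S f"
| "Ck_on (Suc k) f S \<longleftrightarrow>
     (\<forall>x\<in>S. f differentiable (at x)) \<and> (\<forall>v. Ck_on k (\<lambda>x. frechet_derivative f (at x) v) S)"

definition smooth_on :: "('a::real_normed_vector \<Rightarrow> 'b::real_normed_vector) \<Rightarrow> 'a set \<Rightarrow> bool" where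
  "smooth_on f S \<longleftrightarrow> (\<forall>k. Ck_on k f S)"

section \<open>Charts and atlases\<close>

type_synonym ('m, 'e) chart = "'m set \<times> ('m \<Rightarrow> 'e)"

definition chart_inv :: "('m, 'e) chart \<Rightarrow> 'e \<Rightarrow> 'm" where
  "chart_inv c = inv_into (fst c) (snd c)"

definition smooth_atlas ::
  "('m::{t2_space, second_countable_topology}, 'e::euclidean_space) chart set \<Rightarrow> bool" where
  "smooth_atlas \<A> \<longleftrightarrow>
     (\<Union>c\<in>\<A>. fst c) = UNIV \<and>
     (\<forall>c\<in>\<A>. open (fst c) \<and> open (snd c ` fst c) \<and>
        homeomorphism (fst c) (snd c ` fst c) (snd c) (chart_inv c)) \<and>
     (\<forall>c\<in>\<A>. \<forall>d\<in>\<A>. smooth_on (snd d \<circ> chart_inv c) (snd c ` (fst c \<inter> fst d)))"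

definition chart_at :: "('m, 'e) chart set \<Rightarrow> 'm \<Rightarrow> ('m, 'e) chart" where
  "chart_at \<A> x = (SOME c. c \<in> \<A> \<and> x \<in> fst c)"

text \<open>The standard atlas of a vector space; for it tangent vectors are just vectors.\<close>

definition std_atlas :: "('e, 'e) chart set" where
  "std_atlas = {(UNIV, id)}"

text \<open>The open sets and the Borel sigma-algebra of the topology induced by an atlas.\<close>

definition atlas_open :: "('p, 'e::topological_space) chart set \<Rightarrow> 'p set \<Rightarrow> bool" where
  "atlas_open \<A> W \<longleftrightarrow> (\<forall>c\<in>\<A>. open (snd c ` (W \<inter> fst c)))"

definition atlas_borel :: "('p, 'e::topological_space) chart set \<Rightarrow> 'p measure" where
  "atlas_borel \<A> = sigma UNIV {W. atlas_open \<A> W}"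

text \<open>The requirement that the domains of the local representatives are open amounts to continuity
  of \<open>f\<close> for the topologies induced by the atlases.\<close>

definition Ck_map :: "nat \<Rightarrow> ('p, 'a::real_normed_vector) chart set \<Rightarrow>
    ('q, 'b::real_normed_vector) chart set \<Rightarrow> ('p \<Rightarrow> 'q) \<Rightarrow> bool" where
  "Ck_map k \<A> \<B> f \<longleftrightarrow>
     (\<forall>c\<in>\<A>. \<forall>d\<in>\<B>.
        open (snd c ` (fst c \<inter> f -` fst d)) \<and>
        Ck_on k (snd d \<circ> f \<circ> chart_inv c) (snd c ` (fst c \<inter> f -` fst d)))"

section \<open>Tangent vectors and differentials\<close>

text \<open>The linear map taking the coordinates of a tangent vector at \<open>x\<close> in chart \<open>c\<close> to those in
  chart \<open>d\<close>.\<close>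

definition coord_change :: "('m, 'e::real_normed_vector) chart \<Rightarrow> ('m, 'e) chart \<Rightarrow> 'm \<Rightarrow> 'e \<Rightarrow> 'e" where
  "coord_change c d x = frechet_derivative (snd d \<circ> chart_inv c) (at (snd c x))"

definition tangent_chart :: "('m, 'e::real_normed_vector) chart set \<Rightarrow> ('m, 'e) chart \<Rightarrow>
    ('m \<times> 'e, 'e \<times> 'e) chart" where
  "tangent_chart \<A> c = (fst c \<times> UNIV, \<lambda>(x, v). (snd c x, coord_change (chart_at \<A> x) c x v))"

definition tangent_atlas :: "('m, 'e::real_normed_vector) chart set \<Rightarrow> ('m \<times> 'e, 'e \<times> 'e) chart set" where
  "tangent_atlas \<A> = tangent_chart \<A> ` \<A>"

text \<open>The differential \<open>T\<^sub>xM \<rightarrow> T\<^bsub>f x\<^esub>N\<close>, in the preferred charts at \<open>x\<close> and \<open>f x\<close>.\<close>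

definition mdiff :: "('m, 'a::real_normed_vector) chart set \<Rightarrow> ('n, 'b::real_normed_vector) chart set \<Rightarrow>
    ('m \<Rightarrow> 'n) \<Rightarrow> 'm \<Rightarrow> 'a \<Rightarrow> 'b" where
  "mdiff \<A> \<B> f x =
     frechet_derivative (snd (chart_at \<B> (f x)) \<circ> f \<circ> chart_inv (chart_at \<A> x))
       (at (snd (chart_at \<A> x) x))"

definition vector_field :: "('m \<Rightarrow> 'm \<times> 'e) \<Rightarrow> bool" where
  "vector_field X \<longleftrightarrow> (\<forall>x. fst (X x) = x)"

section \<open>Riemannian metrics\<close>

text \<open>\<open>g x\<close> is the inner product on \<open>T\<^sub>xM\<close>. Smoothness is smoothness of the components of the metric
  in every chart \<open>c\<close>: \<open>v\<close> and \<open>w\<close> below are vectors with constant coordinates in \<open>c\<close>.\<close>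

definition riemannian_metric :: "('m, 'e::real_normed_vector) chart set \<Rightarrow> ('m \<Rightarrow> 'e \<Rightarrow> 'e \<Rightarrow> real) \<Rightarrow> bool" where
  "riemannian_metric \<A> g \<longleftrightarrow>
     (\<forall>x. bilinear (g x)) \<and> (\<forall>x v w. g x v w = g x w v) \<and> (\<forall>x v. v \<noteq> 0 \<longrightarrow> g x v v > 0) \<and>
     (\<forall>c\<in>\<A>. \<forall>v w. smooth_on
        (\<lambda>y. let x = chart_inv c y; \<tau> = coord_change c (chart_at \<A> x) x in g x (\<tau> v) (\<tau> w))
        (snd c ` fst c))"

definition riemannian_manifold ::
  "('m::{t2_space, second_countable_topology}, 'e::euclidean_space) chart set \<Rightarrow>
    ('m \<Rightarrow> 'e \<Rightarrow> 'e \<Rightarrow> real) \<Rightarrow> bool" where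
  "riemannian_manifold \<A> g \<longleftrightarrow> smooth_atlas \<A> \<and> riemannian_metric \<A> g"

definition rnorm :: "('m \<Rightarrow> 'e \<Rightarrow> 'e \<Rightarrow> real) \<Rightarrow> 'm \<Rightarrow> 'e \<Rightarrow> real" where
  "rnorm g x v = sqrt (g x v v)"

definition rgrad :: "('m, 'e::real_normed_vector) chart set \<Rightarrow> ('m \<Rightarrow> 'e \<Rightarrow> 'e \<Rightarrow> real) \<Rightarrow>
    ('m \<Rightarrow> real) \<Rightarrow> 'm \<Rightarrow> 'e" where
  "rgrad \<A> g F x = (THE z. \<forall>v. g x z v = mdiff \<A> std_atlas F x v)"

text \<open>The adjoint of \<open>L : T\<^sub>xM \<rightarrow> T\<^sub>yM\<close>.\<close>

definition radjoint :: "('m \<Rightarrow> 'e \<Rightarrow> 'e \<Rightarrow> real) \<Rightarrow> 'm \<Rightarrow> 'm \<Rightarrow> ('e \<Rightarrow> 'e) \<Rightarrow> 'e \<Rightarrow> 'e" where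
  "radjoint g x y L = (THE L'. \<forall>v w. g x v (L' w) = g y (L v) w)"

section \<open>Retractions\<close>

text \<open>The differential of \<open>R\<^sub>x : T\<^sub>xM \<rightarrow> M\<close> at \<open>u\<close>, where \<open>T\<^sub>u(T\<^sub>xM)\<close> is identified with \<open>T\<^sub>xM\<close>.\<close>

definition dretr :: "('m, 'e::real_normed_vector) chart set \<Rightarrow> ('m \<times> 'e \<Rightarrow> 'm) \<Rightarrow> 'm \<Rightarrow> 'e \<Rightarrow> 'e \<Rightarrow> 'e" where
  "dretr \<A> R x u = mdiff std_atlas \<A> (\<lambda>v. R (x, v)) u"

definition manifold_retraction :: "('m, 'e::real_normed_vector) chart set \<Rightarrow> ('m \<times> 'e \<Rightarrow> 'm) \<Rightarrow> bool" where
  "manifold_retraction \<A> R \<longleftrightarrow>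
     Ck_map 2 (tangent_atlas \<A>) \<A> R \<and> (\<forall>x. R (x, 0) = x) \<and> (\<forall>x. dretr \<A> R x 0 = id)"

text \<open>Here a vector field is given by its values \<open>V x\<close> in \<open>T\<^sub>xM\<close>.\<close>

definition R_Lipschitz :: "('m, 'e::real_normed_vector) chart set \<Rightarrow> ('m \<Rightarrow> 'e \<Rightarrow> 'e \<Rightarrow> real) \<Rightarrow>
    ('m \<times> 'e \<Rightarrow> 'm) \<Rightarrow> ('m \<Rightarrow> 'e) \<Rightarrow> 'm set \<Rightarrow> real \<Rightarrow> bool" where
  "R_Lipschitz \<A> g R V K r \<longleftrightarrow>
     (\<exists>C>0. \<forall>x\<in>K. \<forall>u. rnorm g x u \<le> r \<longrightarrow>
        rnorm g x (radjoint g x (R (x, u)) (dretr \<A> R x u) (V (R (x, u))) - V x) \<le> C * rnorm g x u)"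

end

theory Submission
  imports Defs
begin

text \<open>
  Write \<open>h\<close> for the sampled gradient at time \<open>t\<close> and \<open>b\<close> for the norm of the true gradient. The mean value
  theorem along the retraction curve and the \<open>R\<close>-Lipschitz condition give a descent estimate
  \<open>F (x (Suc t)) = F (x t) - \<eta> dF(h) + \<rho>\<close> with \<open>\<bar>\<rho>\<bar> \<le> C \<eta>\<^sup>2 |h|\<^sup>2\<close> (\<open>retraction_descent\<close>). Since
  \<open>\<eta>\<^sup>2\<close> is the power of exponent \<open>- (1 + 2 \<epsilon>)\<close> of \<open>\<beta>\<close> plus
  the accumulated \<open>|h|\<^sup>2\<close>, up to a constant factor, the sum of \<open>\<eta>\<^sup>2 |h|\<^sup>2\<close> is bounded by a constant on every path (\<open>sum_increments_over_powr_le\<close>).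

  The step size \<open>\<eta>\<close> depends on the past only, so the noise \<open>\<xi> = \<eta> (b\<^sup>2 - dF(h))\<close> is a martingale
  difference. Its second moment is at most that of \<open>\<eta> dF(h)\<close>, hence the second moments are summable and the
  series of the noise converges almost surely, by a maximal inequality for stopped sums
  (\<open>martingale_differences_summable\<close>). On each path on which it converges,
  \<open>F (x (Suc t)) = F (x t) - \<eta> b\<^sup>2 + \<xi> + \<rho>\<close> and the boundedness of \<open>F\<close> on \<open>K\<close> show that the sum of
  \<open>\<eta> b\<^sup>2\<close> is finite and that \<open>F (x t)\<close> converges.

  The step sizes themselves are not summable, because \<open>1/2 + \<epsilon> \<le> 1\<close> and the accumulated \<open>|h|\<^sup>2\<close> grows at most
  linearly; so \<open>b\<close> is small infinitely often. To conclude that it tends to zero one bounds its growth in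
  one step by a multiple of \<open>\<eta> |h|\<close> (\<open>gradient_growth\<close>). The Lipschitz condition compares the old gradient
  with the pull-back of the new one, and the pull-back controls the new gradient itself because \<open>dR\<^sub>x\<close> is the
  identity at the origin, and \<open>R\<close> is of class \<open>C\<^sup>2\<close>: near the zero section over a compact set it is an
  isometry up to a relative error of order \<open>|u|\<close> (\<open>rnorm_le_radjoint_compact\<close>). Then the cubes \<open>b\<^sup>3\<close> have
  summable positive increments and converge (\<open>tendsto_zero_of_weighted_squares\<close>).

  Measurability of the process is treated separately in the two cases of the hypothesis. For finite sample
  spaces all variables are simple functions of the past. In the other case the Borel structure of the
  tangent bundle is reduced to that of \<open>'m \<times> 'e\<close> by a trivialization over a countable family of charts that
  is Borel, although not continuous.
\<close>

section \<open>Maps of class C1 and C2\<close>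

lemma Ck_on_Suc_imp_Ck_on: "Ck_on (Suc k) f S \<Longrightarrow> Ck_on k f S"
proof (induction k arbitrary: f)
  case 0
  then show ?case
    by (auto intro!: differentiable_imp_continuous_on simp: differentiable_on_def
        differentiable_at_withinI)
next
  case (Suc k)
  then show ?case by auto
qed

lemma Ck_on_imp_continuous_on: "Ck_on k f S \<Longrightarrow> continuous_on S f"
proof (induction k)
  case (Suc k)
  then show ?case using Ck_on_Suc_imp_Ck_on by blast
qed auto

lemma frechet_derivative_Basis_sum:
  fixes f :: "'a::euclidean_space \<Rightarrow> 'b::real_normed_vector"
  assumes "f differentiable (at z)"
  shows "frechet_derivative f (at z) v = (\<Sum>b\<in>Basis. (v \<bullet> b) *\<^sub>R frechet_derivative f (at z) b)"
proof -
  have l: "linear (frechet_derivative f (at z))"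
    using assms by (rule linear_frechet_derivative)
  have "frechet_derivative f (at z) v = frechet_derivative f (at z) (\<Sum>b\<in>Basis. (v \<bullet> b) *\<^sub>R b)"
    by (simp add: euclidean_representation)
  then show ?thesis
    by (simp add: linear_sum[OF l] linear_scale[OF l])
qed

text \<open>Continuity of the derivative jointly in the point and the direction: the tangent map of \<open>f\<close> is
  continuous. The definition of \<open>C\<^sup>1\<close> only speaks of one direction at a time.\<close>

lemma continuous_on_frechet_derivative_pair:
  fixes f :: "'a::euclidean_space \<Rightarrow> 'b::real_normed_vector"
  assumes "Ck_on (Suc 0) f S"
  shows "continuous_on (S \<times> UNIV) (\<lambda>z. frechet_derivative f (at (fst z)) (snd z))"
proof -
  have d: "\<And>x. x \<in> S \<Longrightarrow> f differentiable (at x)"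
    and c: "\<And>v. continuous_on S (\<lambda>x. frechet_derivative f (at x) v)"
    using assms by auto
  have "continuous_on (S \<times> (UNIV :: 'a set)) (\<lambda>z. frechet_derivative f (at (fst z)) b)" for b
    by (rule continuous_on_compose2[OF c[of b]]) (auto intro!: continuous_intros)
  then have "continuous_on (S \<times> (UNIV :: 'a set))
      (\<lambda>z. \<Sum>b\<in>Basis. (snd z \<bullet> b) *\<^sub>R frechet_derivative f (at (fst z)) b)"
    by (intro continuous_intros)
  then show ?thesis
    by (rule continuous_on_eq) (auto intro!: d frechet_derivative_Basis_sum[symmetric])
qed

text \<open>The finitely many partial derivatives are bounded on a closed ball by compactness, and they bound the
  operator norm of the whole derivative.\<close>

lemma Ck_on_imp_locally_Lipschitz:
  fixes f :: "'a::euclidean_space \<Rightarrow> 'b::real_normed_vector"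
  assumes "Ck_on (Suc 0) f S" "open S" "a \<in> S"
  shows "\<exists>r>0. \<exists>L\<ge>0. cball a r \<subseteq> S \<and>
    (\<forall>y\<in>cball a r. \<forall>z\<in>cball a r. norm (f y - f z) \<le> L * norm (y - z))"
proof -
  obtain r where r: "r > 0" "cball a r \<subseteq> S"
    using assms(2,3) by (metis open_contains_cball)
  have d: "\<And>x. x \<in> S \<Longrightarrow> f differentiable (at x)"
    and c: "\<And>v. continuous_on S (\<lambda>x. frechet_derivative f (at x) v)"
    using assms(1) by auto
  have "\<exists>B\<ge>0. \<forall>x\<in>cball a r. norm (frechet_derivative f (at x) v) \<le> B" for v
  proof -
    have "compact ((\<lambda>x. frechet_derivative f (at x) v) ` cball a r)"
      using continuous_on_subset[OF c r(2)] by (intro compact_continuous_image) auto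
    then have "bounded ((\<lambda>x. frechet_derivative f (at x) v) ` cball a r)"
      by (rule compact_imp_bounded)
    then show ?thesis
      by (auto simp: bounded_pos intro: less_imp_le)
  qed
  then obtain B where B: "\<And>v. B v \<ge> 0"
      "\<And>v x. x \<in> cball a r \<Longrightarrow> norm (frechet_derivative f (at x) v) \<le> B v"
    by metis
  define L where "L = (\<Sum>b\<in>Basis. B b)"
  have on: "onorm (frechet_derivative f (at x)) \<le> L" if x: "x \<in> cball a r" for x
  proof (rule onorm_bound)
    show "0 \<le> L" using B(1) by (simp add: L_def sum_nonneg)
    fix v
    have "norm (frechet_derivative f (at x) v) \<le>
        (\<Sum>b\<in>Basis. norm ((v \<bullet> b) *\<^sub>R frechet_derivative f (at x) b))"
      using frechet_derivative_Basis_sum[OF d, of x v] x r(2) norm_sum by (metis subsetD)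
    also have "\<dots> \<le> (\<Sum>b\<in>Basis. norm v * B b)"
      using B(2)[OF x] by (intro sum_mono) (auto intro!: mult_mono Basis_le_norm)
    finally show "norm (frechet_derivative f (at x) v) \<le> L * norm v"
      by (simp add: L_def sum_distrib_left mult.commute)
  qed
  have "norm (f y - f z) \<le> L * norm (y - z)" if "y \<in> cball a r" "z \<in> cball a r" for y z
  proof (rule differentiable_bound[of "cball a r" f "\<lambda>x. frechet_derivative f (at x)"])
    fix x assume "x \<in> cball a r"
    then have "f differentiable (at x)" using d r by blast
    then show "(f has_derivative frechet_derivative f (at x)) (at x within cball a r)"
      using frechet_derivative_works has_derivative_at_withinI by blast
  qed (use that on in auto)
  moreover have "L \<ge> 0" using B(1) by (simp add: L_def sum_nonneg)
  ultimately show ?thesis using r by blast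
qed


section \<open>Charts, coordinate changes and the tangent bundle\<close>

lemma std_chart: "chart_at std_atlas y = (UNIV, id)"
  unfolding chart_at_def std_atlas_def by (rule some_equality) auto

lemma std_chart_inv: "chart_inv (UNIV, id) = id"
  by (auto simp: chart_inv_def fun_eq_iff)

locale smooth_manifold =
  fixes \<A> :: "('m::{t2_space, second_countable_topology}, 'e::euclidean_space) chart set"
  assumes atlas: "smooth_atlas \<A>"
begin

abbreviation chart_tc :: "('m, 'e) chart \<Rightarrow> ('m \<times> 'e, 'e \<times> 'e) chart" where
  "chart_tc c \<equiv> tangent_chart \<A> c"

text \<open>Coordinates in \<open>c\<close> of the tangent vector that the preferred chart represents by \<open>v\<close>, and back.\<close>

abbreviation to_chart :: "('m, 'e) chart \<Rightarrow> 'm \<Rightarrow> 'e \<Rightarrow> 'e" where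
  "to_chart c x \<equiv> coord_change (chart_at \<A> x) c x"

abbreviation from_chart :: "('m, 'e) chart \<Rightarrow> 'm \<Rightarrow> 'e \<Rightarrow> 'e" where
  "from_chart c x \<equiv> coord_change c (chart_at \<A> x) x"

lemma chart_homeomorphism:
  "c \<in> \<A> \<Longrightarrow> homeomorphism (fst c) (snd c ` fst c) (snd c) (chart_inv c)"
  using atlas by (auto simp: smooth_atlas_def)

lemma chart_open: "c \<in> \<A> \<Longrightarrow> open (fst c)" "c \<in> \<A> \<Longrightarrow> open (snd c ` fst c)"
  using atlas by (auto simp: smooth_atlas_def)

lemma chart_at: "chart_at \<A> x \<in> \<A>" "x \<in> fst (chart_at \<A> x)"
proof -
  have "\<exists>c. c \<in> \<A> \<and> x \<in> fst c"
    using atlas unfolding smooth_atlas_def by blast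
  then have "chart_at \<A> x \<in> \<A> \<and> x \<in> fst (chart_at \<A> x)"
    unfolding chart_at_def by (rule someI_ex)
  then show "chart_at \<A> x \<in> \<A>" "x \<in> fst (chart_at \<A> x)" by auto
qed

lemma chart_inv_chart: "c \<in> \<A> \<Longrightarrow> x \<in> fst c \<Longrightarrow> chart_inv c (snd c x) = x"
  using chart_homeomorphism by (auto simp: homeomorphism_def)

lemma chart_inv_in: "c \<in> \<A> \<Longrightarrow> y \<in> snd c ` fst c \<Longrightarrow> chart_inv c y \<in> fst c"
  by (metis chart_inv_chart imageE)

lemma chart_continuous: "c \<in> \<A> \<Longrightarrow> continuous_on (fst c) (snd c)"
  "c \<in> \<A> \<Longrightarrow> continuous_on (snd c ` fst c) (chart_inv c)"
  using chart_homeomorphism by (auto simp: homeomorphism_def)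

lemma chart_image_open:
  assumes "c \<in> \<A>" "open W"
  shows "open (snd c ` (fst c \<inter> W))"
proof -
  have "openin (top_of_set (snd c ` fst c)) (snd c ` (fst c \<inter> W))"
    using chart_homeomorphism[OF assms(1)] assms(2)
    by (intro homeomorphism_imp_open_map) (auto simp: openin_open)
  then show ?thesis
    using chart_open(2)[OF assms(1)] by (meson openin_open_trans openin_open_eq)
qed

lemma transition_smooth:
  assumes "c \<in> \<A>" "d \<in> \<A>"
  shows "Ck_on k (snd d \<circ> chart_inv c) (snd c ` (fst c \<inter> fst d))"
  using atlas assms by (auto simp: smooth_atlas_def smooth_on_def)

lemma transition_has_derivative:
  assumes "c \<in> \<A>" "d \<in> \<A>" "x \<in> fst c" "x \<in> fst d"
  shows "((snd d \<circ> chart_inv c) has_derivative coord_change c d x) (at (snd c x))"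
proof -
  have "(snd d \<circ> chart_inv c) differentiable (at (snd c x))"
    using transition_smooth[OF assms(1,2), of "Suc 0"] assms(3,4) by auto
  then show ?thesis
    by (simp add: coord_change_def frechet_derivative_works)
qed

lemma coord_change_linear:
  assumes "c \<in> \<A>" "d \<in> \<A>" "x \<in> fst c" "x \<in> fst d"
  shows "bounded_linear (coord_change c d x)" "linear (coord_change c d x)"
  using transition_has_derivative[OF assms] has_derivative_bounded_linear bounded_linear.linear by blast+

text \<open>The chain rule. Together with \<open>coord_change_self\<close> it makes the coordinate changes at a point mutually
  inverse, so that tangent vectors may be handled in any chart around the point.\<close>

lemma coord_change_trans:
  assumes "c \<in> \<A>" "d \<in> \<A>" "k \<in> \<A>" "x \<in> fst c" "x \<in> fst d" "x \<in> fst k"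
  shows "coord_change d k x (coord_change c d x v) = coord_change c k x v"
proof -
  have *: "((snd k \<circ> chart_inv d) \<circ> (snd d \<circ> chart_inv c) has_derivative
      coord_change d k x \<circ> coord_change c d x) (at (snd c x))"
    using transition_has_derivative[OF assms(1,2,4,5)] transition_has_derivative[OF assms(2,3,5,6)]
    by (intro diff_chain_at) (auto simp: chart_inv_chart assms)
  have o: "open (snd c ` (fst c \<inter> fst d))"
    using assms chart_image_open chart_open by blast
  have "((snd k \<circ> chart_inv c) has_derivative
      coord_change d k x \<circ> coord_change c d x) (at (snd c x))"
    by (rule has_derivative_transform_within_open[OF * o]) (use assms in \<open>auto simp: chart_inv_chart\<close>)
  from has_derivative_unique[OF this transition_has_derivative[OF assms(1,3,4,6)]]
  show ?thesis by (metis comp_apply)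
qed

lemma coord_change_self:
  assumes "c \<in> \<A>" "x \<in> fst c"
  shows "coord_change c c x v = v"
proof -
  have "((snd c \<circ> chart_inv c) has_derivative id) (at (snd c x))"
    by (rule has_derivative_transform_within_open[OF has_derivative_id chart_open(2)[OF assms(1)]])
      (use assms in \<open>auto simp: chart_inv_chart\<close>)
  from has_derivative_unique[OF this transition_has_derivative] assms
  show ?thesis by (metis id_apply)
qed

lemma from_to_chart:
  assumes "c \<in> \<A>" "x \<in> fst c"
  shows "from_chart c x (to_chart c x v) = v" "to_chart c x (from_chart c x v) = v"
  using assms by (simp_all add: coord_change_trans coord_change_self chart_at)

lemma chart_tc_simps: "fst (chart_tc c) = fst c \<times> UNIV"
    "snd (chart_tc c) (x, v) = (snd c x, to_chart c x v)"
  by (simp_all add: tangent_chart_def)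

text \<open>Turns the images under tangent charts, by which open sets of the tangent bundle and domains of local
  representatives are defined, into explicit sets of coordinates.\<close>

lemma chart_tc_image:
  assumes "c \<in> \<A>"
  shows "snd (chart_tc c) ` (fst (chart_tc c) \<inter> W) =
    {(y, v). y \<in> snd c ` fst c \<and> (chart_inv c y, from_chart c (chart_inv c y) v) \<in> W}"
proof (intro equalityI subsetI)
  fix z assume "z \<in> snd (chart_tc c) ` (fst (chart_tc c) \<inter> W)"
  then show "z \<in> {(y, v). y \<in> snd c ` fst c \<and> (chart_inv c y, from_chart c (chart_inv c y) v) \<in> W}"
    using assms by (auto simp: chart_tc_simps chart_inv_chart from_to_chart)
next
  fix z assume "z \<in> {(y, v). y \<in> snd c ` fst c \<and> (chart_inv c y, from_chart c (chart_inv c y) v) \<in> W}"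
  then obtain x v where "z = (snd c x, v)" "x \<in> fst c" "(x, from_chart c x v) \<in> W"
    using assms by (auto simp: chart_inv_chart)
  then show "z \<in> snd (chart_tc c) ` (fst (chart_tc c) \<inter> W)"
    using assms by (intro image_eqI[of _ _ "(x, from_chart c x v)"])
      (auto simp: chart_tc_simps from_to_chart)
qed

lemma chart_tc_inv:
  assumes "c \<in> \<A>" "x \<in> fst c"
  shows "chart_inv (chart_tc c) (snd c x, v) = (x, from_chart c x v)"
  unfolding chart_inv_def
proof (rule inv_into_f_eq)
  show "inj_on (snd (chart_tc c)) (fst (chart_tc c))"
  proof (rule inj_onI)
    fix p q assume pq: "p \<in> fst (chart_tc c)" "q \<in> fst (chart_tc c)"
      "snd (chart_tc c) p = snd (chart_tc c) q"
    then have "fst p = fst q"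
      using chart_inv_chart[OF assms(1)] by (cases p, cases q) (simp add: chart_tc_simps, metis)
    then show "p = q"
      using pq from_to_chart(1)[OF assms(1)]
      by (cases p, cases q) (simp add: chart_tc_simps, metis)
  qed
qed (use assms in \<open>auto simp: chart_tc_simps from_to_chart\<close>)

end

section \<open>Riemannian metrics, gradients and adjoints\<close>

locale riemannian = smooth_manifold \<A>
  for \<A> :: "('m::{t2_space, second_countable_topology}, 'e::euclidean_space) chart set" +
  fixes g :: "'m \<Rightarrow> 'e \<Rightarrow> 'e \<Rightarrow> real"
  assumes metric: "riemannian_metric \<A> g"
begin

lemma g_bilinear: "bilinear (g x)"
  and g_sym: "g x v w = g x w v"
  and g_pos: "v \<noteq> 0 \<Longrightarrow> g x v v > 0"
  using metric by (auto simp: riemannian_metric_def)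

lemmas g_bilinear_simps =
  bilinear_ladd[OF g_bilinear] bilinear_radd[OF g_bilinear]
  bilinear_lmul[OF g_bilinear] bilinear_rmul[OF g_bilinear]
  bilinear_lneg[OF g_bilinear] bilinear_rneg[OF g_bilinear]
  bilinear_lzero[OF g_bilinear] bilinear_rzero[OF g_bilinear]
  bilinear_lsub[OF g_bilinear] bilinear_rsub[OF g_bilinear]

lemma g_nonneg: "g x v v \<ge> 0"
  using g_pos[of v x] by (cases "v = 0") (auto simp: g_bilinear_simps)

lemma rnorm_nonneg: "rnorm g x v \<ge> 0"
  by (simp add: rnorm_def g_nonneg)

lemma rnorm_square: "(rnorm g x v)\<^sup>2 = g x v v"
  by (simp add: rnorm_def g_nonneg)

lemma rnorm_scaleR: "rnorm g x (c *\<^sub>R v) = \<bar>c\<bar> * rnorm g x v"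
  by (simp add: rnorm_def g_bilinear_simps real_sqrt_mult mult.assoc[symmetric])

lemma rnorm_minus: "rnorm g x (- v) = rnorm g x v"
  by (simp add: rnorm_def g_bilinear_simps)

lemma g_Cauchy_Schwarz: "\<bar>g x v w\<bar> \<le> rnorm g x v * rnorm g x w"
proof (cases "w = 0")
  case True
  then show ?thesis by (simp add: g_bilinear_simps rnorm_def)
next
  case False
  then have p: "g x w w > 0" by (rule g_pos)
  define t where "t = g x v w / g x w w"
  have "0 \<le> g x (v - t *\<^sub>R w) (v - t *\<^sub>R w)" by (rule g_nonneg)
  also have "\<dots> = g x v v - (g x v w)\<^sup>2 / g x w w"
    using p by (simp add: g_bilinear_simps g_sym[of x w v] t_def power2_eq_square field_simps)
  finally have "(g x v w)\<^sup>2 \<le> g x v v * g x w w"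
    using p by (simp add: field_simps)
  then have "sqrt ((g x v w)\<^sup>2) \<le> sqrt (g x v v * g x w w)"
    by (rule real_sqrt_le_mono)
  then show ?thesis by (simp add: rnorm_def real_sqrt_mult)
qed

lemma rnorm_triangle: "rnorm g x (v + w) \<le> rnorm g x v + rnorm g x w"
proof (rule power2_le_imp_le)
  show "(rnorm g x (v + w))\<^sup>2 \<le> (rnorm g x v + rnorm g x w)\<^sup>2"
    using g_Cauchy_Schwarz[of x v w]
    by (simp add: rnorm_square power2_sum g_bilinear_simps g_sym[of x w v])
qed (simp add: rnorm_nonneg)

lemma g_nondegenerate: "(\<And>v. g x z v = g x z' v) \<Longrightarrow> z = z'"
  using g_pos[of "z - z'" x] by (fastforce simp: g_bilinear_simps)

lemma g_Basis_sum: "g x z v = (\<Sum>b\<in>Basis. (v \<bullet> b) * g x z b)"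
proof -
  have l: "linear (g x z)"
    using g_bilinear[of x] by (auto simp: bilinear_def)
  have "g x z v = g x z (\<Sum>b\<in>Basis. (v \<bullet> b) *\<^sub>R b)"
    by (simp add: euclidean_representation)
  then show ?thesis
    by (simp add: linear_sum[OF l] linear_scale[OF l])
qed

text \<open>Nondegeneracy makes \<open>z \<mapsto> g\<^sub>x(z, -)\<close> injective, hence onto the dual space by dimension.\<close>

lemma g_represents:
  assumes "linear f"
  shows "\<exists>!z. \<forall>v. g x z v = f v"
proof -
  define T where "T z = (\<Sum>b\<in>Basis. g x z b *\<^sub>R b)" for z
  have T: "T z \<bullet> b = g x z b" if "b \<in> Basis" for z b
    using that by (simp add: T_def)
  have l: "linear T"
    by (rule linearI) (auto intro!: euclidean_eqI[where 'a='e] simp: T g_bilinear_simps inner_add_left)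
  have "inj T"
  proof (rule injI)
    fix y z assume "T y = T z"
    then have "g x y b = g x z b" if "b \<in> Basis" for b
      using T that by metis
    then have "g x y v = g x z v" for v
      by (subst g_Basis_sum[of x y v], subst g_Basis_sum[of x z v]) simp
    then show "y = z"
      by (rule g_nondegenerate)
  qed
  then obtain z where z: "T z = (\<Sum>b\<in>Basis. f b *\<^sub>R b)"
    using linear_injective_imp_surjective[OF l] by (metis surjD)
  have "g x z v = f v" for v
  proof -
    have "g x z b = f b" if "b \<in> Basis" for b
      using T[OF that, of z] that by (simp add: z)
    then have "g x z v = (\<Sum>b\<in>Basis. (v \<bullet> b) * f b)"
      by (subst g_Basis_sum) simp
    also have "\<dots> = f (\<Sum>b\<in>Basis. (v \<bullet> b) *\<^sub>R b)"
      by (simp add: linear_sum[OF assms] linear_scale[OF assms])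
    finally show ?thesis by (simp add: euclidean_representation)
  qed
  then show ?thesis
    using g_nondegenerate by (metis (no_types))
qed

lemma g_rgrad:
  assumes "linear (mdiff \<A> std_atlas F x)"
  shows "g x (rgrad \<A> g F x) v = mdiff \<A> std_atlas F x v"
  using theI'[OF g_represents[OF assms]] by (simp add: rgrad_def)

lemma g_radjoint:
  assumes "linear L"
  shows "g x v (radjoint g x y L w) = g y (L v) w"
proof -
  have "\<exists>!L'. \<forall>v w. g x v (L' w) = g y (L v) w"
  proof -
    have "linear (\<lambda>v. g y (L v) w)" for w
      by (rule linearI) (simp_all add: linear_add[OF assms] linear_scale[OF assms] g_bilinear_simps)
    then have "\<exists>!z. \<forall>v. g x z v = g y (L v) w" for w
      using g_represents by blast
    then obtain L' where L': "\<And>v w. g x (L' w) v = g y (L v) w"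
      by metis
    show ?thesis
    proof (rule ex1I[of _ L'])
      show "\<forall>v w. g x v (L' w) = g y (L v) w"
        using L' g_sym by metis
      fix L'' assume "\<forall>v w. g x v (L'' w) = g y (L v) w"
      then show "L'' = L'"
        using L' g_sym by (intro ext g_nondegenerate[of x]) metis
    qed
  qed
  from theI'[OF this] show ?thesis
    by (simp add: radjoint_def)
qed

end

section \<open>Differentiating along the retraction\<close>

locale C1_function = smooth_manifold \<A>
  for \<A> :: "('m::{t2_space, second_countable_topology}, 'e::euclidean_space) chart set" +
  fixes F :: "'m \<Rightarrow> real"
  assumes C1: "Ck_map 1 \<A> std_atlas F"
begin

lemma F_chart_C1: "c \<in> \<A> \<Longrightarrow> Ck_on (Suc 0) (F \<circ> chart_inv c) (snd c ` fst c)"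
  using C1 by (auto simp: Ck_map_def std_atlas_def)

text \<open>The differential is defined in the preferred chart at \<open>x\<close>; in every other chart around \<open>x\<close> the
  chain rule yields the derivative of the coordinate expression.\<close>

lemma F_chart_has_derivative:
  assumes "c \<in> \<A>" "x \<in> fst c"
  shows "((F \<circ> chart_inv c) has_derivative (\<lambda>v. mdiff \<A> std_atlas F x (from_chart c x v))) (at (snd c x))"
proof -
  let ?d = "chart_at \<A> x"
  have "(F \<circ> chart_inv ?d) differentiable (at (snd ?d x))"
    using F_chart_C1[OF chart_at(1)[of x]] chart_at(2)[of x] by auto
  then have d: "((F \<circ> chart_inv ?d) has_derivative mdiff \<A> std_atlas F x) (at (snd ?d x))"
    by (simp add: mdiff_def std_chart frechet_derivative_works)
  have "((F \<circ> chart_inv ?d) \<circ> (snd ?d \<circ> chart_inv c) has_derivative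
      mdiff \<A> std_atlas F x \<circ> from_chart c x) (at (snd c x))"
    using transition_has_derivative[OF assms(1) chart_at(1) assms(2) chart_at(2)] d
    by (intro diff_chain_at) (simp_all add: chart_inv_chart assms)
  then have *: "((F \<circ> chart_inv c) has_derivative mdiff \<A> std_atlas F x \<circ> from_chart c x) (at (snd c x))"
    by (rule has_derivative_transform_within_open[OF _ chart_image_open[OF assms(1) chart_open(1)[OF chart_at(1)[of x]]]])
      (use assms chart_at[of x] in \<open>auto simp: chart_inv_chart\<close>)
  then show ?thesis
    by (simp add: o_def)
qed

lemma mdiff_F_linear: "linear (mdiff \<A> std_atlas F x)"
proof -
  let ?d = "chart_at \<A> x"
  have "(F \<circ> chart_inv ?d) differentiable (at (snd ?d x))"
    using F_chart_C1[OF chart_at(1)[of x]] chart_at(2)[of x] by auto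
  then show ?thesis
    by (simp add: mdiff_def std_chart linear_frechet_derivative)
qed

lemma F_continuous: "continuous_on UNIV F"
proof -
  have "isCont F x" for x
  proof -
    let ?d = "chart_at \<A> x"
    have "continuous_on (fst ?d) (\<lambda>y. (F \<circ> chart_inv ?d) (snd ?d y))"
      by (rule continuous_on_compose2[OF Ck_on_imp_continuous_on[OF F_chart_C1] chart_continuous(1)])
        (use chart_at[of x] in auto)
    then have "continuous_on (fst ?d) F"
      by (rule continuous_on_eq) (use chart_at[of x] in \<open>auto simp: chart_inv_chart\<close>)
    then show ?thesis
      using chart_at[of x] chart_open continuous_on_eq_continuous_at by blast
  qed
  then show ?thesis
    by (simp add: continuous_on_eq_continuous_at)
qed

end

locale retraction = smooth_manifold \<A>
  for \<A> :: "('m::{t2_space, second_countable_topology}, 'e::euclidean_space) chart set" +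
  fixes R :: "'m \<times> 'e \<Rightarrow> 'm"
  assumes retraction: "manifold_retraction \<A> R"
begin

lemma R_zero: "R (x, 0) = x"
  and dretr_zero: "dretr \<A> R x 0 = id"
  using retraction by (auto simp: manifold_retraction_def)

text \<open>\<open>R_loc c d\<close> is the coordinate representative whose regularity the \<open>C\<^sup>2\<close> condition on \<open>R\<close> asserts;
  the tangent vector is given by its coordinates in \<open>c\<close>, not in the preferred chart.\<close>

definition R_dom :: "('m, 'e) chart \<Rightarrow> ('m, 'e) chart \<Rightarrow> ('e \<times> 'e) set" where
  "R_dom c d = {(y, v). y \<in> snd c ` fst c \<and> R (chart_inv c y, from_chart c (chart_inv c y) v) \<in> fst d}"

definition R_loc :: "('m, 'e) chart \<Rightarrow> ('m, 'e) chart \<Rightarrow> 'e \<times> 'e \<Rightarrow> 'e" where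
  "R_loc c d = snd d \<circ> R \<circ> chart_inv (chart_tc c)"

lemma R_dom_iff: "c \<in> \<A> \<Longrightarrow> x \<in> fst c \<Longrightarrow> (snd c x, v) \<in> R_dom c d \<longleftrightarrow> R (x, from_chart c x v) \<in> fst d"
  by (auto simp: R_dom_def chart_inv_chart)

lemma R_loc_eq: "c \<in> \<A> \<Longrightarrow> x \<in> fst c \<Longrightarrow> R_loc c d (snd c x, v) = snd d (R (x, from_chart c x v))"
  by (simp add: R_loc_def chart_tc_inv)

lemma R_loc_C2:
  assumes "c \<in> \<A>" "d \<in> \<A>"
  shows "open (R_dom c d)" "Ck_on (Suc (Suc 0)) (R_loc c d) (R_dom c d)"
proof -
  have e: "snd (chart_tc c) ` (fst (chart_tc c) \<inter> R -` fst d) = R_dom c d"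
    unfolding chart_tc_image[OF assms(1)] R_dom_def by auto
  have "Ck_map (Suc (Suc 0)) (tangent_atlas \<A>) \<A> R"
    using retraction by (simp add: manifold_retraction_def numeral_2_eq_2)
  then have "open (snd (chart_tc c) ` (fst (chart_tc c) \<inter> R -` fst d)) \<and>
    Ck_on (Suc (Suc 0)) (snd d \<circ> R \<circ> chart_inv (chart_tc c)) (snd (chart_tc c) ` (fst (chart_tc c) \<inter> R -` fst d))"
    using assms unfolding Ck_map_def tangent_atlas_def by blast
  then show "open (R_dom c d)" "Ck_on (Suc (Suc 0)) (R_loc c d) (R_dom c d)"
    unfolding e R_loc_def by blast+
qed

text \<open>Lets derivatives along a fibre be computed in one fixed chart of the target.\<close>

lemma open_R_fibre:
  assumes "d \<in> \<A>"
  shows "open {v. R (x, v) \<in> fst d}"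
proof -
  let ?c = "chart_at \<A> x"
  have "open ((\<lambda>v. (snd ?c x, v)) -` R_dom ?c d)"
    by (rule open_vimage[OF R_loc_C2(1)[OF chart_at(1) assms]]) (intro continuous_intros)
  then show ?thesis
    using chart_at[of x] by (simp add: vimage_def R_dom_iff coord_change_self)
qed

lemma R_fibre_differentiable:
  assumes "d \<in> \<A>" "R (x, u) \<in> fst d"
  shows "(\<lambda>v. snd d (R (x, v))) differentiable (at u)"
proof -
  let ?c = "chart_at \<A> x"
  have *: "(snd ?c x, u) \<in> R_dom ?c d"
    using assms chart_at[of x] by (simp add: R_dom_iff coord_change_self)
  then have "R_loc ?c d differentiable (at (snd ?c x, u))"
    using R_loc_C2(2)[OF chart_at(1)[of x] assms(1)] by auto
  moreover have "(\<lambda>v. (snd ?c x, v)) differentiable (at u)"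
    by (auto intro!: derivative_eq_intros simp: differentiable_def)
  ultimately have "(R_loc ?c d \<circ> (\<lambda>v. (snd ?c x, v))) differentiable (at u)"
    by (intro differentiable_chain_at) auto
  then show ?thesis
    using chart_at[of x] by (simp add: o_def R_loc_eq coord_change_self)
qed

text \<open>\<open>dretr\<close> uses the preferred chart at the image point; the chain rule transfers it to any chart \<open>d\<close>
  that contains this point.\<close>

lemma R_fibre_has_derivative:
  assumes "d \<in> \<A>" "R (x, u) \<in> fst d"
  shows "((\<lambda>v. snd d (R (x, v))) has_derivative (\<lambda>v. to_chart d (R (x, u)) (dretr \<A> R x u v))) (at u)"
proof -
  let ?y = "R (x, u)"
  let ?k = "chart_at \<A> ?y"
  have k: "?k \<in> \<A>" "?y \<in> fst ?k" by (rule chart_at)+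
  have d: "((\<lambda>v. snd ?k (R (x, v))) has_derivative dretr \<A> R x u) (at u)"
    using R_fibre_differentiable[OF k(1), of x u] k(2)
    by (simp add: dretr_def mdiff_def std_chart std_chart_inv o_def frechet_derivative_works)
  have "((snd d \<circ> chart_inv ?k) \<circ> (\<lambda>v. snd ?k (R (x, v))) has_derivative
      to_chart d ?y \<circ> dretr \<A> R x u) (at u)"
    using transition_has_derivative[OF k(1) assms(1) k(2) assms(2)] d by (intro diff_chain_at) auto
  then have "((\<lambda>v. snd d (R (x, v))) has_derivative to_chart d ?y \<circ> dretr \<A> R x u) (at u)"
    by (rule has_derivative_transform_within_open[OF _ open_R_fibre[OF k(1), of x]])
      (use k in \<open>auto simp: chart_inv_chart\<close>)
  then show ?thesis by (simp add: o_def)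
qed

lemma dretr_linear: "linear (dretr \<A> R x u)"
proof -
  let ?k = "chart_at \<A> (R (x, u))"
  have "(\<lambda>v. to_chart ?k (R (x, u)) (dretr \<A> R x u v)) = dretr \<A> R x u"
    by (simp add: fun_eq_iff coord_change_self chart_at)
  then show ?thesis
    using R_fibre_has_derivative[OF chart_at, of x u] has_derivative_linear by metis
qed

end

section \<open>The differential of the retraction is almost an isometry\<close>

text \<open>One ball and one constant for finitely many functions, such as the components of the metric or the
  partial derivatives of a map.\<close>

lemma Ck_on_imp_locally_Lipschitz_family:
  fixes f :: "'i \<Rightarrow> 'a::euclidean_space \<Rightarrow> 'b::real_normed_vector"
  assumes "finite I" "\<And>i. i \<in> I \<Longrightarrow> Ck_on (Suc 0) (f i) S" "open S" "a \<in> S"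
  shows "\<exists>r>0. \<exists>L\<ge>0. cball a r \<subseteq> S \<and>
    (\<forall>i\<in>I. \<forall>y\<in>cball a r. \<forall>z\<in>cball a r. norm (f i y - f i z) \<le> L * norm (y - z))"
  using assms(1,2)
proof (induction I)
  case empty
  then show ?case
    using assms(3,4) by (metis open_contains_cball empty_iff order_refl)
next
  case (insert i I)
  obtain r L where 1: "r > 0" "L \<ge> 0" "cball a r \<subseteq> S"
    "\<And>j y z. j \<in> I \<Longrightarrow> y \<in> cball a r \<Longrightarrow> z \<in> cball a r \<Longrightarrow> norm (f j y - f j z) \<le> L * norm (y - z)"
    using insert.IH insert.prems by (metis insertCI)
  obtain r' L' where 2: "r' > 0" "L' \<ge> 0"
    "\<And>y z. y \<in> cball a r' \<Longrightarrow> z \<in> cball a r' \<Longrightarrow> norm (f i y - f i z) \<le> L' * norm (y - z)"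
    using Ck_on_imp_locally_Lipschitz[OF insert.prems assms(3,4), of i] by auto
  have "norm (f j y - f j z) \<le> max L L' * norm (y - z)"
    if "j \<in> insert i I" "y \<in> cball a (min r r')" "z \<in> cball a (min r r')" for j y z
  proof -
    have "norm (f j y - f j z) \<le> L * norm (y - z) \<or> norm (f j y - f j z) \<le> L' * norm (y - z)"
      using 1(4)[of j y z] 2(3)[of y z] that by auto
    moreover have "L * norm (y - z) \<le> max L L' * norm (y - z)" "L' * norm (y - z) \<le> max L L' * norm (y - z)"
      by (auto intro!: mult_right_mono)
    ultimately show ?thesis by linarith
  qed
  then show ?case
    using 1(1-3) 2(1,2)
    by (intro exI[of _ "min r r'"] conjI exI[of _ "max L L'"]) (auto simp: subset_iff)
qed

lemma linear_norm_le_Basis_bound: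
  fixes f :: "'a::euclidean_space \<Rightarrow> 'b::real_normed_vector"
  assumes "linear f" "\<And>b. b \<in> Basis \<Longrightarrow> norm (f b) \<le> B"
  shows "norm (f v) \<le> real DIM('a) * B * norm v"
proof -
  have "f v = f (\<Sum>b\<in>Basis. (v \<bullet> b) *\<^sub>R b)"
    by (simp add: euclidean_representation)
  also have "\<dots> = (\<Sum>b\<in>Basis. (v \<bullet> b) *\<^sub>R f b)"
    by (simp add: linear_sum[OF assms(1)] linear_scale[OF assms(1)])
  also have "norm \<dots> \<le> (\<Sum>b\<in>(Basis::'a set). norm v * B)"
    using assms(2) by (intro sum_norm_le) (auto intro!: mult_mono Basis_le_norm)
  finally show ?thesis by (simp add: mult.commute mult.left_commute)
qed

lemma bilinear_diff:
  "bilinear f \<Longrightarrow> bilinear h \<Longrightarrow> bilinear (\<lambda>v w. f v w - h v w)"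
  for f h :: "'a::real_vector \<Rightarrow> 'b::real_vector \<Rightarrow> 'c::real_vector"
  by (auto simp: bilinear_def intro!: linear_compose_sub)

lemma bilinear_norm_le_Basis_bound:
  fixes f :: "'a::euclidean_space \<Rightarrow> 'b::euclidean_space \<Rightarrow> real"
  assumes "bilinear f" "\<And>b b'. b \<in> Basis \<Longrightarrow> b' \<in> Basis \<Longrightarrow> \<bar>f b b'\<bar> \<le> B"
  shows "\<bar>f v w\<bar> \<le> real DIM('b) * (real DIM('a) * B) * norm v * norm w"
proof -
  have "norm (f v b') \<le> real DIM('a) * B * norm v" if "b' \<in> Basis" for b'
    using assms that by (intro linear_norm_le_Basis_bound) (auto simp: bilinear_def)
  then have "norm (f v w) \<le> real DIM('b) * (real DIM('a) * B * norm v) * norm w"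
    using assms by (intro linear_norm_le_Basis_bound) (auto simp: bilinear_def)
  then show ?thesis by (simp add: mult.assoc)
qed

context riemannian
begin

definition gram :: "('m, 'e) chart \<Rightarrow> 'e \<Rightarrow> 'e \<Rightarrow> 'e \<Rightarrow> real" where
  "gram c y v w = g (chart_inv c y) (from_chart c (chart_inv c y) v) (from_chart c (chart_inv c y) w)"

lemma gram_smooth: "c \<in> \<A> \<Longrightarrow> Ck_on k (\<lambda>y. gram c y v w) (snd c ` fst c)"
  using metric unfolding riemannian_metric_def smooth_on_def gram_def Let_def by blast

lemma gram_bilinear:
  assumes "c \<in> \<A>" "y \<in> snd c ` fst c"
  shows "bilinear (gram c y)"
proof -
  have l: "linear (from_chart c (chart_inv c y))"
    using assms by (intro coord_change_linear) (auto simp: chart_inv_in chart_at)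
  show ?thesis
    unfolding bilinear_def gram_def
    by (auto intro!: linearI simp: g_bilinear_simps linear_add[OF l] linear_scale[OF l])
qed

lemma gram_pos:
  assumes "c \<in> \<A>" "y \<in> snd c ` fst c" "v \<noteq> 0"
  shows "gram c y v v > 0"
  unfolding gram_def
proof (rule g_pos)
  have x: "chart_inv c y \<in> fst c" using assms by (simp add: chart_inv_in)
  have l: "linear (to_chart c (chart_inv c y))"
    using assms x by (intro coord_change_linear) (auto simp: chart_at)
  show "from_chart c (chart_inv c y) v \<noteq> 0"
    using from_to_chart(2)[OF assms(1) x, of v] assms(3) linear_0[OF l] by metis
qed

text \<open>At the centre \<open>a\<close> the form is positive definite, hence bounded below on the unit sphere by some \<open>m\<^sub>0 > 0\<close>.
  The radius is chosen so small that the variation of the form, controlled by the Lipschitz constants of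
  its components, costs at most half of \<open>m\<^sub>0\<close>.\<close>

lemma gram_local_bounds:
  assumes c: "c \<in> \<A>" and a: "a \<in> snd c ` fst c"
  obtains r m L where "r > 0" "m > 0" "L \<ge> 0" "cball a r \<subseteq> snd c ` fst c"
    "\<And>y w. y \<in> cball a r \<Longrightarrow> m * (norm w)\<^sup>2 \<le> gram c y w w"
    "\<And>y v w. y \<in> cball a r \<Longrightarrow> \<bar>gram c y v w\<bar> \<le> L * norm v * norm w"
    "\<And>y z v w. y \<in> cball a r \<Longrightarrow> z \<in> cball a r \<Longrightarrow>
      \<bar>gram c y v w - gram c z v w\<bar> \<le> L * norm (y - z) * norm v * norm w"
proof -
  have "\<exists>r>0. \<exists>L\<ge>0. cball a r \<subseteq> snd c ` fst c \<and> (\<forall>i\<in>(Basis::'e set) \<times> (Basis::'e set).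
      \<forall>y\<in>cball a r. \<forall>z\<in>cball a r.
        norm (gram c y (fst i) (snd i) - gram c z (fst i) (snd i)) \<le> L * norm (y - z))"
    by (rule Ck_on_imp_locally_Lipschitz_family)
      (use gram_smooth[OF c] a chart_open(2)[OF c] in \<open>simp_all del: Ck_on.simps\<close>)
  then obtain r0 L0 where r0: "r0 > 0" "L0 \<ge> 0" "cball a r0 \<subseteq> snd c ` fst c"
    and L0: "\<And>y z b b'. y \<in> cball a r0 \<Longrightarrow> z \<in> cball a r0 \<Longrightarrow> b \<in> Basis \<Longrightarrow> b' \<in> Basis \<Longrightarrow>
       \<bar>gram c y b b' - gram c z b b'\<bar> \<le> L0 * norm (y - z)"
    by fastforce
  define L1 where "L1 = real DIM('e) * (real DIM('e) * L0)"
  have L1: "L1 \<ge> 0" using r0 by (simp add: L1_def)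
  have lip: "\<bar>gram c y v w - gram c z v w\<bar> \<le> L1 * norm (y - z) * norm v * norm w"
    if "y \<in> cball a r0" "z \<in> cball a r0" for y z v w
  proof -
    have "\<bar>gram c y v w - gram c z v w\<bar> \<le>
        real DIM('e) * (real DIM('e) * (L0 * norm (y - z))) * norm v * norm w"
      using L0[OF that] r0 that c
      by (intro bilinear_norm_le_Basis_bound bilinear_diff gram_bilinear) auto
    then show ?thesis by (simp add: L1_def mult.assoc)
  qed
  obtain B where B: "\<And>v w. norm (gram c a v w) \<le> B * norm v * norm w" "B > 0"
    using bilinear_bounded_pos[OF gram_bilinear[OF c a]] by blast
  have "continuous_on (sphere 0 1) (\<lambda>w. gram c a w w)"
  proof -
    have "bounded_bilinear (gram c a)"
      using gram_bilinear[OF c a] bilinear_conv_bounded_bilinear by blast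
    then show ?thesis
      by (intro bounded_bilinear.continuous_on[of "gram c a"] continuous_intros)
  qed
  moreover have "sphere (0::'e) 1 \<noteq> {}" by simp
  ultimately obtain w0 :: 'e where w0: "w0 \<in> sphere 0 1"
      "\<And>w. w \<in> sphere 0 1 \<Longrightarrow> gram c a w0 w0 \<le> gram c a w w"
    using continuous_attains_inf[OF compact_sphere, of 0 1 "\<lambda>w. gram c a w w"] by blast
  define m0 where "m0 = gram c a w0 w0"
  have "w0 \<noteq> 0" using w0(1) by auto
  then have m0: "m0 > 0" unfolding m0_def using gram_pos[OF c a] by blast
  have m0_le: "m0 * (norm w)\<^sup>2 \<le> gram c a w w" for w
  proof (cases "w = 0")
    case True
    then show ?thesis using bilinear_lzero[OF gram_bilinear[OF c a]] by simp
  next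
    case False
    then have "m0 \<le> gram c a (w /\<^sub>R norm w) (w /\<^sub>R norm w)"
      unfolding m0_def by (intro w0(2)) simp
    also have "\<dots> = gram c a w w / (norm w)\<^sup>2"
      using bilinear_lmul[OF gram_bilinear[OF c a]] bilinear_rmul[OF gram_bilinear[OF c a]]
      by (simp add: divide_simps power2_eq_square)
    finally show ?thesis using False by (simp add: field_simps)
  qed
  define r where "r = min r0 (m0 / (2 * (L1 + 1)))"
  have r: "r > 0" "r \<le> r0" using r0 m0 L1 by (auto simp: r_def)
  have "L1 * r \<le> L1 * (m0 / (2 * (L1 + 1)))"
    using L1 by (intro mult_left_mono) (auto simp: r_def)
  also have "\<dots> \<le> m0 / 2"
    using L1 m0 by (simp add: field_simps)
  finally have L1r: "L1 * r \<le> m0 / 2" .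
  have near: "\<bar>gram c y v w - gram c a v w\<bar> \<le> L1 * r * (norm v * norm w)" if "y \<in> cball a r" for y v w
  proof -
    have "\<bar>gram c y v w - gram c a v w\<bar> \<le> L1 * norm (y - a) * norm v * norm w"
      using that r by (intro lip) auto
    also have "\<dots> \<le> L1 * r * norm v * norm w"
      using that L1 by (intro mult_right_mono mult_left_mono) (auto simp: dist_norm norm_minus_commute)
    finally show ?thesis by (simp add: mult.assoc)
  qed
  show ?thesis
  proof (rule that[of r "m0 / 2" "L1 + B + L1 * r"])
    show "m0 / 2 * (norm w)\<^sup>2 \<le> gram c y w w" if "y \<in> cball a r" for y w
    proof -
      have "\<bar>gram c y w w - gram c a w w\<bar> \<le> L1 * r * (norm w)\<^sup>2"
        using near[OF that, of w w] by (simp add: power2_eq_square)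
      also have "\<dots> \<le> m0 / 2 * (norm w)\<^sup>2"
        using L1r by (intro mult_right_mono) auto
      finally show ?thesis using m0_le[of w] by linarith
    qed
    show "\<bar>gram c y v w\<bar> \<le> (L1 + B + L1 * r) * norm v * norm w" if "y \<in> cball a r" for y v w
    proof -
      have "\<bar>gram c y v w\<bar> \<le> L1 * r * (norm v * norm w) + B * norm v * norm w"
        using near[OF that, of v w] B(1)[of v w] by simp
      also have "\<dots> \<le> L1 * r * (norm v * norm w) + B * norm v * norm w + L1 * (norm v * norm w)"
        using L1 by simp
      finally show ?thesis by (simp add: algebra_simps)
    qed
    show "\<bar>gram c y v w - gram c z v w\<bar> \<le> (L1 + B + L1 * r) * norm (y - z) * norm v * norm w"
      if "y \<in> cball a r" "z \<in> cball a r" for y z v w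
    proof -
      have "\<bar>gram c y v w - gram c z v w\<bar> \<le> L1 * norm (y - z) * norm v * norm w"
        using that r by (intro lip) auto
      also have "\<dots> \<le> (L1 + B + L1 * r) * norm (y - z) * norm v * norm w"
        using B(2) L1 r by (intro mult_right_mono) auto
      finally show ?thesis .
    qed
    show "cball a r \<subseteq> snd c ` fst c" using r r0 by (auto simp: subset_iff)
  qed (use r m0 L1 B(2) in auto)
qed

end

locale riemannian_retraction = riemannian \<A> g + retraction \<A> R
  for \<A> :: "('m::{t2_space, second_countable_topology}, 'e::euclidean_space) chart set"
    and g :: "'m \<Rightarrow> 'e \<Rightarrow> 'e \<Rightarrow> real" and R :: "'m \<times> 'e \<Rightarrow> 'm"
begin

text \<open>Relates the derivatives that the \<open>C\<^sup>2\<close> condition controls to the differential \<open>dretr\<close>, which is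
  taken in preferred charts.\<close>

lemma R_loc_derivative:
  assumes "c \<in> \<A>" "x \<in> fst c" "(snd c x, u) \<in> R_dom c c"
  shows "frechet_derivative (R_loc c c) (at (snd c x, u)) (0, w) =
    to_chart c (R (x, from_chart c x u)) (dretr \<A> R x (from_chart c x u) (from_chart c x w))"
proof -
  let ?D = "frechet_derivative (R_loc c c) (at (snd c x, u))"
  have d: "(R_loc c c has_derivative ?D) (at (snd c x, u))"
    using R_loc_C2(2)[OF assms(1,1)] assms(3) by (auto simp: frechet_derivative_works)
  have "(Pair (snd c x) has_derivative (\<lambda>w. (0, w))) (at u)"
    by (auto intro!: derivative_eq_intros)
  then have "(R_loc c c \<circ> Pair (snd c x) has_derivative ?D \<circ> (\<lambda>w. (0, w))) (at u)"
    using d by (intro diff_chain_at)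
  moreover have "R_loc c c \<circ> Pair (snd c x) = (\<lambda>v. snd c (R (x, v))) \<circ> from_chart c x"
    using assms by (simp add: fun_eq_iff R_loc_eq)
  moreover have "((\<lambda>v. snd c (R (x, v))) \<circ> from_chart c x has_derivative
      (\<lambda>v. to_chart c (R (x, from_chart c x u)) (dretr \<A> R x (from_chart c x u) v)) \<circ> from_chart c x) (at u)"
  proof (rule diff_chain_at)
    show "(from_chart c x has_derivative from_chart c x) (at u)"
      using coord_change_linear(1)[OF assms(1) chart_at(1) assms(2) chart_at(2)]
      by (rule bounded_linear_imp_has_derivative)
    show "((\<lambda>v. snd c (R (x, v))) has_derivative
       (\<lambda>v. to_chart c (R (x, from_chart c x u)) (dretr \<A> R x (from_chart c x u) v))) (at (from_chart c x u))"
      using assms by (intro R_fibre_has_derivative) (simp_all add: R_dom_iff)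
  qed
  ultimately have "?D \<circ> (\<lambda>w. (0, w)) =
      (\<lambda>v. to_chart c (R (x, from_chart c x u)) (dretr \<A> R x (from_chart c x u) v)) \<circ> from_chart c x"
    using has_derivative_unique by metis
  then show ?thesis by (metis comp_apply)
qed

text \<open>At \<open>u = 0\<close> the representative is \<open>y\<close> and its fibre derivative is the identity. As \<open>R\<close> is of class \<open>C\<^sup>2\<close>,
  the representative and its fibre derivative are Lipschitz, so both deviate from these values by at most
  a multiple of the length of \<open>u\<close>.\<close>

lemma R_loc_local_bounds:
  assumes c: "c \<in> \<A>" and a: "a \<in> snd c ` fst c"
  obtains r L where "r > 0" "L \<ge> 0" "cball a r \<subseteq> snd c ` fst c"
    "\<And>y u. y \<in> cball a r \<Longrightarrow> norm u \<le> r \<Longrightarrow> (y, u) \<in> R_dom c c"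
    "\<And>y u. y \<in> cball a r \<Longrightarrow> norm u \<le> r \<Longrightarrow> norm (R_loc c c (y, u) - y) \<le> L * norm u"
    "\<And>y u w. y \<in> cball a r \<Longrightarrow> norm u \<le> r \<Longrightarrow>
      norm (frechet_derivative (R_loc c c) (at (y, u)) (0, w) - w) \<le> L * norm u * norm w"
proof -
  have zero: "(y, 0) \<in> R_dom c c" "R_loc c c (y, 0) = y"
      "frechet_derivative (R_loc c c) (at (y, 0)) (0, w) = w" if y: "y \<in> snd c ` fst c" for y w
  proof -
    obtain x where x: "x \<in> fst c" "y = snd c x" using y by blast
    have z: "from_chart c x 0 = 0"
      using coord_change_linear(2)[OF c chart_at(1) x(1) chart_at(2)] by (rule linear_0)
    show *: "(y, 0) \<in> R_dom c c" "R_loc c c (y, 0) = y"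
      using x c by (simp_all add: R_dom_iff R_loc_eq z R_zero)
    then show "frechet_derivative (R_loc c c) (at (y, 0)) (0, w) = w"
      using x c R_loc_derivative[OF c x(1), of 0 w] by (simp add: z R_zero dretr_zero from_to_chart)
  qed
  note C2 = R_loc_C2[OF c c]
  obtain r1 L1 where 1: "r1 > 0" "L1 \<ge> 0" "cball (a, 0) r1 \<subseteq> R_dom c c"
    "\<And>y z. y \<in> cball (a, 0) r1 \<Longrightarrow> z \<in> cball (a, 0) r1 \<Longrightarrow>
      norm (R_loc c c y - R_loc c c z) \<le> L1 * norm (y - z)"
    using Ck_on_imp_locally_Lipschitz[OF Ck_on_Suc_imp_Ck_on[OF C2(2)] C2(1) zero(1)[OF a]] by metis
  have "\<exists>r>0. \<exists>L\<ge>0. cball (a, 0) r \<subseteq> R_dom c c \<and> (\<forall>b\<in>Basis. \<forall>y\<in>cball (a, 0) r. \<forall>z\<in>cball (a, 0) r.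
    norm (frechet_derivative (R_loc c c) (at y) (0, b) - frechet_derivative (R_loc c c) (at z) (0, b)) \<le> L * norm (y - z))"
    by (rule Ck_on_imp_locally_Lipschitz_family) (use C2 zero(1)[OF a] in auto)
  then obtain r2 L2 where 2: "r2 > 0" "L2 \<ge> 0"
    "\<And>b y z. b \<in> Basis \<Longrightarrow> y \<in> cball (a, 0) r2 \<Longrightarrow> z \<in> cball (a, 0) r2 \<Longrightarrow>
     norm (frechet_derivative (R_loc c c) (at y) (0, b) - frechet_derivative (R_loc c c) (at z) (0, b)) \<le> L2 * norm (y - z)"
    by blast
  obtain r3 where 3: "r3 > 0" "cball a r3 \<subseteq> snd c ` fst c"
    using chart_open(2)[OF c] a open_contains_cball by metis
  define r where "r = min (min (r1 / 2) (r2 / 2)) r3"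
  define L where "L = L1 + real DIM('e) * L2"
  have r: "r > 0" "r + r \<le> r1" "r + r \<le> r2" "r \<le> r3"
    using 1 2 3 by (auto simp: r_def)
  have L: "L1 \<le> L" "real DIM('e) * L2 \<le> L" "L \<ge> 0" using 1 2 by (auto simp: L_def)
  have mem: "(y, u) \<in> cball (a, 0) s" if "y \<in> cball a r" "norm u \<le> r" "r + r \<le> s" for y and u :: 'e and s
  proof -
    have "dist (a, 0) (y, u) \<le> dist a y + norm u"
      using sqrt_sum_squares_le_sum[of "dist a y" "norm u"] by (simp add: dist_Pair_Pair)
    then show ?thesis using that by auto
  qed
  show ?thesis
  proof (rule that[of r L])
    fix y and u :: 'e assume yu: "y \<in> cball a r" "norm u \<le> r"
    have y: "y \<in> snd c ` fst c" using yu r 3 by (auto simp: subset_iff)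
    have y0: "(y, 0::'e) \<in> cball (a, 0) r1" "(y, 0::'e) \<in> cball (a, 0) r2"
      using mem[OF yu(1), of 0 r1] mem[OF yu(1), of 0 r2] r by simp_all
    have yu': "(y, u) \<in> cball (a, 0) r1" "(y, u) \<in> cball (a, 0) r2"
      using mem[OF yu, of r1] mem[OF yu, of r2] r by simp_all
    show dom: "(y, u) \<in> R_dom c c" using yu' 1 by blast
    have "norm (R_loc c c (y, u) - y) \<le> L1 * norm u"
      using 1(4)[OF yu'(1) y0(1)] zero(2)[OF y] by (simp add: norm_Pair)
    also have "\<dots> \<le> L * norm u" using L by (intro mult_right_mono) auto
    finally show "norm (R_loc c c (y, u) - y) \<le> L * norm u" .
    fix w :: 'e
    have "(R_loc c c has_derivative frechet_derivative (R_loc c c) (at (y, u))) (at (y, u))"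
      using C2(2) dom by (auto simp: frechet_derivative_works)
    then have l: "linear (frechet_derivative (R_loc c c) (at (y, u)))"
      by (rule has_derivative_linear)
    have "linear (\<lambda>w. frechet_derivative (R_loc c c) (at (y, u)) (0, w) - w)"
    proof (rule linearI)
      fix v w s
      show "frechet_derivative (R_loc c c) (at (y, u)) (0, v + w) - (v + w) =
        frechet_derivative (R_loc c c) (at (y, u)) (0, v) - v +
        (frechet_derivative (R_loc c c) (at (y, u)) (0, w) - w)"
        using linear_add[OF l, of "(0, v)" "(0, w)"] by simp
      show "frechet_derivative (R_loc c c) (at (y, u)) (0, s *\<^sub>R v) - s *\<^sub>R v =
        s *\<^sub>R (frechet_derivative (R_loc c c) (at (y, u)) (0, v) - v)"
        using linear_scale[OF l, of s "(0, v)"] by (simp add: scaleR_diff_right)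
    qed
    moreover have "norm (frechet_derivative (R_loc c c) (at (y, u)) (0, b) - b) \<le> L2 * norm u"
      if "b \<in> Basis" for b
      using 2(3)[OF that yu'(2) y0(2)] zero(3)[OF y] by (simp add: norm_Pair)
    ultimately have "norm (frechet_derivative (R_loc c c) (at (y, u)) (0, w) - w) \<le>
        real DIM('e) * (L2 * norm u) * norm w"
      by (rule linear_norm_le_Basis_bound)
    also have "\<dots> \<le> L * norm u * norm w"
      using L by (simp add: mult.assoc[symmetric] mult_right_mono)
    finally show "norm (frechet_derivative (R_loc c c) (at (y, u)) (0, w) - w) \<le> L * norm u * norm w" .
  qed (use r L 3 in \<open>auto simp: subset_iff\<close>)
qed

text \<open>Let \<open>b\<close> be the vector at \<open>x\<close> with the coordinates of \<open>w\<close>. Up to a relative error of order \<open>|u|\<close>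
  it has the length of \<open>w\<close> and its image under the differential is \<open>w\<close>. Pairing \<open>b\<close> with the adjoint
  applied to \<open>w\<close> therefore bounds \<open>w\<close> by its pull-back, without inverting the differential.\<close>

lemma rnorm_le_radjoint_local:
  obtains U \<delta> C where "open U" "x0 \<in> U" "\<delta> > 0" "C \<ge> 0"
    "\<And>x u w. x \<in> U \<Longrightarrow> rnorm g x u \<le> \<delta> \<Longrightarrow>
      rnorm g (R (x, u)) w \<le> (1 + C * rnorm g x u) * rnorm g x (radjoint g x (R (x, u)) (dretr \<A> R x u) w)"
proof -
  define c where "c = chart_at \<A> x0"
  define a where "a = snd c x0"
  have c: "c \<in> \<A>" "x0 \<in> fst c" unfolding c_def by (rule chart_at)+
  have a: "a \<in> snd c ` fst c" using c by (auto simp: a_def)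
  obtain r1 m L1 where G: "r1 > 0" "m > 0" "L1 \<ge> 0" "cball a r1 \<subseteq> snd c ` fst c"
    "\<And>y w. y \<in> cball a r1 \<Longrightarrow> m * (norm w)\<^sup>2 \<le> gram c y w w"
    "\<And>y v w. y \<in> cball a r1 \<Longrightarrow> \<bar>gram c y v w\<bar> \<le> L1 * norm v * norm w"
    "\<And>y z v w. y \<in> cball a r1 \<Longrightarrow> z \<in> cball a r1 \<Longrightarrow>
      \<bar>gram c y v w - gram c z v w\<bar> \<le> L1 * norm (y - z) * norm v * norm w"
    using gram_local_bounds[OF c(1) a] by metis
  obtain r2 L2 where B: "r2 > 0" "L2 \<ge> 0" "cball a r2 \<subseteq> snd c ` fst c"
    "\<And>y u. y \<in> cball a r2 \<Longrightarrow> norm u \<le> r2 \<Longrightarrow> (y, u) \<in> R_dom c c"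
    "\<And>y u. y \<in> cball a r2 \<Longrightarrow> norm u \<le> r2 \<Longrightarrow> norm (R_loc c c (y, u) - y) \<le> L2 * norm u"
    "\<And>y u w. y \<in> cball a r2 \<Longrightarrow> norm u \<le> r2 \<Longrightarrow>
      norm (frechet_derivative (R_loc c c) (at (y, u)) (0, w) - w) \<le> L2 * norm u * norm w"
    using R_loc_local_bounds[OF c(1) a] by metis
  define k where "k = L1 * L2 / m"
  have k: "k \<ge> 0" using G B by (simp add: k_def)
  (* The three bounds on sigma keep the coordinates of u in range, keep R (x, u) in the ball on which the
     metric is controlled, and make the relative error k |u| at most 1/2. *)
  define \<rho> where "\<rho> = min (r1 / 2) r2"
  define \<sigma> where "\<sigma> = min r2 (min (r1 / (2 * (L2 + 1))) (1 / (2 * (k + 1))))"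
  have \<rho>: "\<rho> > 0" "\<rho> \<le> r1 / 2" "\<rho> \<le> r2" using G B by (auto simp: \<rho>_def)
  have \<sigma>: "\<sigma> > 0" "\<sigma> \<le> r2" using G B k by (auto simp: \<sigma>_def)
  have "L2 * \<sigma> \<le> L2 * (r1 / (2 * (L2 + 1)))"
    using B by (intro mult_left_mono) (auto simp: \<sigma>_def)
  also have "\<dots> \<le> r1 / 2" using B G by (simp add: field_simps)
  finally have \<sigma>1: "L2 * \<sigma> \<le> r1 / 2" .
  have "k * \<sigma> \<le> k * (1 / (2 * (k + 1)))"
    using k by (intro mult_left_mono) (auto simp: \<sigma>_def)
  also have "\<dots> \<le> 1 / 2" using k by (simp add: field_simps)
  finally have \<sigma>2: "k * \<sigma> \<le> 1 / 2" .
  define U where "U = {x \<in> fst c. snd c x \<in> ball a \<rho>}"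
  have U: "open U" "x0 \<in> U"
    using continuous_open_preimage[OF chart_continuous(1)[OF c(1)] chart_open(1)[OF c(1)] open_ball[of a \<rho>]] c \<rho>
    by (auto simp: U_def a_def vimage_def Int_def)
  show ?thesis
  proof (rule that[of U "sqrt m * \<sigma>" "4 * k / sqrt m"])
    fix x u w assume x: "x \<in> U" and u: "rnorm g x u \<le> sqrt m * \<sigma>"
    let ?z = "R (x, u)"
    define y where "y = snd c x"
    define u' where "u' = to_chart c x u"
    define s where "s = norm u'"
    have xc: "x \<in> fst c" "y \<in> cball a \<rho>" using x by (auto simp: U_def y_def)
    have y: "y \<in> cball a r1" "y \<in> cball a r2" using xc \<rho> G(1) by auto
    have inv_y: "chart_inv c y = x" using xc c by (simp add: y_def chart_inv_chart)
    have u_eq: "u = from_chart c x u'" using c xc by (simp add: u'_def from_to_chart)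
    have "m * s\<^sup>2 \<le> (rnorm g x u)\<^sup>2"
      using G(5)[OF y(1), of u'] by (simp add: s_def rnorm_square u_eq gram_def inv_y)
    then have "(sqrt m * s)\<^sup>2 \<le> (rnorm g x u)\<^sup>2"
      using G(2) by (simp add: power_mult_distrib)
    then have su: "sqrt m * s \<le> rnorm g x u"
      by (rule power2_le_imp_le) (rule rnorm_nonneg)
    then have "sqrt m * s \<le> sqrt m * \<sigma>" using u by simp
    then have s: "s \<le> \<sigma>" "s \<ge> 0" using G(2) by (auto simp: s_def)
    then have s2: "norm u' \<le> r2" using \<sigma> by (simp add: s_def)
    have dom: "(snd c x, u') \<in> R_dom c c" using B(4)[OF y(2) s2] by (simp add: y_def)
    then have z: "?z \<in> fst c" using c xc by (simp add: R_dom_iff u_eq)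
    define z' where "z' = snd c ?z"
    have z'_eq: "R_loc c c (y, u') = z'" using c xc by (simp add: R_loc_eq y_def u_eq z'_def)
    have inv_z: "chart_inv c z' = ?z" using z c by (simp add: z'_def chart_inv_chart)
    have zy: "norm (z' - y) \<le> L2 * s"
      using B(5)[OF y(2) s2] by (simp add: z'_eq s_def)
    have "dist a z' \<le> dist a y + dist z' y" by (metis dist_commute dist_triangle)
    also have "\<dots> \<le> r1 / 2 + L2 * \<sigma>"
      using xc(2) \<rho> zy s mult_left_mono[OF s(1) B(2)] by (auto simp: dist_norm)
    also have "\<dots> \<le> r1" using \<sigma>1 by simp
    finally have z1: "z' \<in> cball a r1" by simp
    define w' where "w' = to_chart c ?z w"
    have w_eq: "w = from_chart c ?z w'" using c z by (simp add: w'_def from_to_chart)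
    define b where "b = from_chart c x w'"
    define N where "N = rnorm g ?z w"
    define T where "T = rnorm g x (radjoint g x ?z (dretr \<A> R x u) w)"
    have N: "N \<ge> 0" "gram c z' w' w' = N\<^sup>2"
      by (simp_all add: N_def rnorm_nonneg rnorm_square gram_def inv_z w_eq)
    have T: "T \<ge> 0" by (simp add: T_def rnorm_nonneg)
    have ww: "L1 * L2 * s * (norm w')\<^sup>2 \<le> k * s * N\<^sup>2"
    proof -
      have "(norm w')\<^sup>2 \<le> N\<^sup>2 / m"
        using G(5)[OF z1, of w'] G(2) N by (simp add: field_simps)
      then have "L1 * L2 * s * (norm w')\<^sup>2 \<le> L1 * L2 * s * (N\<^sup>2 / m)"
        using G(3) B(2) s(2) by (intro mult_left_mono) auto
      then show ?thesis by (simp add: k_def)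
    qed
    have "gram c y w' w' \<le> N\<^sup>2 + k * s * N\<^sup>2"
    proof -
      have "\<bar>gram c y w' w' - gram c z' w' w'\<bar> \<le> L1 * norm (y - z') * norm w' * norm w'"
        by (rule G(7)[OF y(1) z1])
      also have "\<dots> \<le> L1 * (L2 * s) * norm w' * norm w'"
        using zy G(3) by (intro mult_right_mono mult_left_mono) (auto simp: norm_minus_commute)
      also have "\<dots> = L1 * L2 * s * (norm w')\<^sup>2" by (simp add: power2_eq_square)
      finally show ?thesis using N ww by linarith
    qed
    also have "\<dots> \<le> ((1 + k * s) * N)\<^sup>2"
    proof -
      have "1 + k * s \<le> (1 + k * s)\<^sup>2" using k s by (intro self_le_power) auto
      then have "(1 + k * s) * N\<^sup>2 \<le> (1 + k * s)\<^sup>2 * N\<^sup>2"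
        by (rule mult_right_mono) simp
      then show ?thesis by (simp only: power_mult_distrib) (simp add: distrib_right)
    qed
    finally have "(rnorm g x b)\<^sup>2 \<le> ((1 + k * s) * N)\<^sup>2"
      by (simp add: rnorm_square b_def gram_def inv_y)
    then have b: "rnorm g x b \<le> (1 + k * s) * N"
      by (rule power2_le_imp_le) (use k s N in simp)
    define Bw where "Bw = frechet_derivative (R_loc c c) (at (y, u')) (0, w')"
    have Bw: "from_chart c ?z Bw = dretr \<A> R x u b"
      using R_loc_derivative[OF c(1) xc(1) dom] c z
      by (simp add: Bw_def y_def u_eq b_def from_to_chart)
    have gz: "bilinear (gram c z')"
      using z1 G(4) c by (intro gram_bilinear) auto
    have "g ?z (dretr \<A> R x u b) w = gram c z' Bw w'"
      by (simp add: gram_def inv_z Bw[symmetric] w_eq[symmetric])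
    also have "\<dots> = gram c z' w' w' + gram c z' (Bw - w') w'"
      by (simp add: bilinear_lsub[OF gz])
    finally have "g ?z (dretr \<A> R x u b) w \<ge> N\<^sup>2 - \<bar>gram c z' (Bw - w') w'\<bar>"
      using N by linarith
    moreover have "\<bar>gram c z' (Bw - w') w'\<bar> \<le> k * s * N\<^sup>2"
    proof -
      have "\<bar>gram c z' (Bw - w') w'\<bar> \<le> L1 * norm (Bw - w') * norm w'"
        by (rule G(6)[OF z1])
      also have "\<dots> \<le> L1 * (L2 * s * norm w') * norm w'"
        using B(6)[OF y(2) s2, of w'] G(3) by (intro mult_right_mono mult_left_mono) (auto simp: Bw_def s_def)
      also have "\<dots> = L1 * L2 * s * (norm w')\<^sup>2" by (simp add: power2_eq_square)
      finally show ?thesis using ww by linarith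
    qed
    moreover have "g ?z (dretr \<A> R x u b) w \<le> (1 + k * s) * N * T"
    proof -
      have "g ?z (dretr \<A> R x u b) w \<le> rnorm g x b * T"
        using g_Cauchy_Schwarz[of x b "radjoint g x ?z (dretr \<A> R x u) w"]
        by (simp add: g_radjoint[OF dretr_linear] T_def)
      also have "\<dots> \<le> (1 + k * s) * N * T"
        using b T by (intro mult_right_mono)
      finally show ?thesis .
    qed
    ultimately have main: "N * ((1 - k * s) * N) \<le> N * ((1 + k * s) * T)"
      by (simp add: power2_eq_square algebra_simps)
    have ks: "k * s \<le> 1 / 2" "k * s \<ge> 0"
      using \<sigma>2 mult_left_mono[OF s(1) k] k s by auto
    have "N \<le> (1 + 4 * (k * s)) * T"
    proof (cases "N = 0")
      case True
      then show ?thesis using T ks by simp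
    next
      case False
      then have 1: "(1 - k * s) * N \<le> (1 + k * s) * T"
        using main N by simp
      have "N \<le> (1 + 2 * (k * s)) * ((1 - k * s) * N)"
      proof -
        have "1 \<le> (1 + 2 * (k * s)) * (1 - k * s)"
          using mult_left_mono[OF ks] by (simp add: algebra_simps)
        then show ?thesis using mult_right_mono[OF _ N(1)] by (fastforce simp: mult.assoc)
      qed
      also have "\<dots> \<le> (1 + 2 * (k * s)) * ((1 + k * s) * T)"
        using 1 ks by (intro mult_left_mono) auto
      also have "\<dots> \<le> (1 + 4 * (k * s)) * T"
      proof -
        have "(1 + 2 * (k * s)) * (1 + k * s) \<le> 1 + 4 * (k * s)"
          using mult_left_mono[OF ks] by (simp add: algebra_simps)
        then show ?thesis using mult_right_mono[OF _ T] by (fastforce simp: mult.assoc)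
      qed
      finally show ?thesis .
    qed
    also have "\<dots> \<le> (1 + 4 * k / sqrt m * rnorm g x u) * T"
    proof (intro mult_right_mono T add_left_mono)
      have "s \<le> rnorm g x u / sqrt m" using su G(2) by (simp add: field_simps)
      then have "4 * k * s \<le> 4 * k * (rnorm g x u / sqrt m)"
        using k by (intro mult_left_mono) auto
      then show "4 * (k * s) \<le> 4 * k / sqrt m * rnorm g x u" by simp
    qed
    finally show "rnorm g ?z w \<le> (1 + 4 * k / sqrt m * rnorm g x u) *
        rnorm g x (radjoint g x ?z (dretr \<A> R x u) w)"
      by (simp add: N_def T_def)
  qed (use U G \<sigma> k in auto)
qed

text \<open>A finite subcover of \<open>K\<close> makes the constants uniform.\<close>

lemma rnorm_le_radjoint_compact:
  assumes "compact K"
  obtains \<delta> C where "\<delta> > 0" "C \<ge> 0"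
    "\<And>x u w. x \<in> K \<Longrightarrow> rnorm g x u \<le> \<delta> \<Longrightarrow>
      rnorm g (R (x, u)) w \<le> (1 + C * rnorm g x u) * rnorm g x (radjoint g x (R (x, u)) (dretr \<A> R x u) w)"
proof -
  define good where "good U \<delta> C \<longleftrightarrow> \<delta> > 0 \<and> C \<ge> 0 \<and> (\<forall>x u w. x \<in> U \<longrightarrow> rnorm g x u \<le> \<delta> \<longrightarrow>
      rnorm g (R (x, u)) w \<le> (1 + C * rnorm g x u) * rnorm g x (radjoint g x (R (x, u)) (dretr \<A> R x u) w))"
    for U and \<delta> C :: real
  have "\<exists>U. open U \<and> x0 \<in> U \<and> (\<exists>\<delta> C. good U \<delta> C)" for x0
    using rnorm_le_radjoint_local[of x0] unfolding good_def by metis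
  then obtain U where U: "\<And>x. open (U x)" "\<And>x. x \<in> U x" "\<And>x. \<exists>\<delta> C. good (U x) \<delta> C"
    by metis
  obtain D where D: "D \<subseteq> K" "finite D" "K \<subseteq> (\<Union>x\<in>D. U x)"
    by (rule compactE_image[OF assms, of K U]) (use U in auto)
  have "\<exists>\<delta> C. good (\<Union>x\<in>D. U x) \<delta> C"
    using D(2)
  proof (induction D)
    case empty
    show ?case by (auto simp: good_def intro!: exI[of _ 1])
  next
    case (insert x D)
    then obtain \<delta> C \<delta>' C' where *: "good (\<Union>x\<in>D. U x) \<delta> C" "good (U x) \<delta>' C'"
      using U by metis
    have mono: "good V (min \<delta> \<delta>') (max C C')" if "good V \<delta>1 C1" "min \<delta> \<delta>' \<le> \<delta>1" "C1 \<le> max C C'" "\<delta> > 0" "\<delta>' > 0" for V \<delta>1 C1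
      unfolding good_def
    proof (intro conjI allI impI)
      fix x u w assume "x \<in> V" "rnorm g x u \<le> min \<delta> \<delta>'"
      then have "rnorm g (R (x, u)) w \<le> (1 + C1 * rnorm g x u) * rnorm g x (radjoint g x (R (x, u)) (dretr \<A> R x u) w)"
        using that unfolding good_def by (meson order_trans)
      also have "\<dots> \<le> (1 + max C C' * rnorm g x u) * rnorm g x (radjoint g x (R (x, u)) (dretr \<A> R x u) w)"
        using that rnorm_nonneg by (intro mult_right_mono add_left_mono) auto
      finally show "rnorm g (R (x, u)) w \<le> (1 + max C C' * rnorm g x u) * rnorm g x (radjoint g x (R (x, u)) (dretr \<A> R x u) w)" .
    qed (use that in \<open>auto simp: good_def\<close>)
    have "good (\<Union>x\<in>D. U x) (min \<delta> \<delta>') (max C C')" "good (U x) (min \<delta> \<delta>') (max C C')"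
      using mono[OF *(1)] mono[OF *(2)] * by (auto simp: good_def)
    then have "good (\<Union>x\<in>insert x D. U x) (min \<delta> \<delta>') (max C C')"
      unfolding good_def by auto
    then show ?case by blast
  qed
  then show ?thesis
    using that D(3) unfolding good_def by (meson subsetD)
qed

end

locale C1_function_with_retraction = riemannian_retraction \<A> g R + C1_function \<A> F
  for \<A> :: "('m::{t2_space, second_countable_topology}, 'e::euclidean_space) chart set"
    and g :: "'m \<Rightarrow> 'e \<Rightarrow> 'e \<Rightarrow> real" and F :: "'m \<Rightarrow> real" and R :: "'m \<times> 'e \<Rightarrow> 'm"
begin

abbreviation grad :: "'m \<Rightarrow> 'e" where
  "grad \<equiv> rgrad \<A> g F"

lemma g_grad: "g x (grad x) v = mdiff \<A> std_atlas F x v"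
  by (rule g_rgrad[OF mdiff_F_linear])

lemma F_R_has_derivative:
  "((\<lambda>v. F (R (x, v))) has_derivative (\<lambda>v. mdiff \<A> std_atlas F (R (x, u)) (dretr \<A> R x u v))) (at u)"
proof -
  let ?y = "R (x, u)"
  let ?k = "chart_at \<A> ?y"
  have k: "?k \<in> \<A>" "?y \<in> fst ?k" by (rule chart_at)+
  have "((F \<circ> chart_inv ?k) \<circ> (\<lambda>v. snd ?k (R (x, v))) has_derivative
      (\<lambda>v. mdiff \<A> std_atlas F ?y (from_chart ?k ?y v)) \<circ> (\<lambda>v. to_chart ?k ?y (dretr \<A> R x u v))) (at u)"
    using F_chart_has_derivative[OF k] R_fibre_has_derivative[OF k] by (intro diff_chain_at) auto
  then have "((\<lambda>v. F (R (x, v))) has_derivative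
      (\<lambda>v. mdiff \<A> std_atlas F ?y (from_chart ?k ?y v)) \<circ> (\<lambda>v. to_chart ?k ?y (dretr \<A> R x u v))) (at u)"
    by (rule has_derivative_transform_within_open[OF _ open_R_fibre[OF k(1), of x]])
      (use k in \<open>auto simp: chart_inv_chart\<close>)
  then show ?thesis
    using k by (simp add: o_def coord_change_self)
qed

text \<open>The adjoint of the differential of the retraction turns the derivative of \<open>F\<close> along a retraction curve
  into an inner product at the base point, where it can be compared with the gradient there.\<close>

lemma F_R_line_has_derivative:
  "((\<lambda>s. F (R (x, s *\<^sub>R u))) has_real_derivative
     g x (radjoint g x (R (x, s *\<^sub>R u)) (dretr \<A> R x (s *\<^sub>R u)) (grad (R (x, s *\<^sub>R u)))) u) (at s)"
proof -
  let ?y = "R (x, s *\<^sub>R u)"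
  have "((\<lambda>s. s *\<^sub>R u) has_derivative (\<lambda>s. s *\<^sub>R u)) (at s)"
    by (auto intro!: derivative_eq_intros)
  then have "((\<lambda>v. F (R (x, v))) \<circ> (\<lambda>s. s *\<^sub>R u) has_derivative
      (\<lambda>v. mdiff \<A> std_atlas F ?y (dretr \<A> R x (s *\<^sub>R u) v)) \<circ> (\<lambda>s. s *\<^sub>R u)) (at s)"
    using F_R_has_derivative by (rule diff_chain_at)
  moreover have "mdiff \<A> std_atlas F ?y (dretr \<A> R x (s *\<^sub>R u) (t *\<^sub>R u)) =
      t * g x (radjoint g x ?y (dretr \<A> R x (s *\<^sub>R u)) (grad ?y)) u" for t
  proof -
    have "mdiff \<A> std_atlas F ?y (dretr \<A> R x (s *\<^sub>R u) (t *\<^sub>R u)) = g ?y (grad ?y) (dretr \<A> R x (s *\<^sub>R u) (t *\<^sub>R u))"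
      by (simp add: g_grad)
    also have "\<dots> = g x (t *\<^sub>R u) (radjoint g x ?y (dretr \<A> R x (s *\<^sub>R u)) (grad ?y))"
      by (simp add: g_radjoint[OF dretr_linear] g_sym[of ?y "grad ?y"])
    finally show ?thesis
      by (simp add: g_bilinear_simps g_sym[of x u])
  qed
  ultimately show ?thesis
    by (simp add: o_def has_field_derivative_def mult_commute_abs)
qed

text \<open>The derivative of \<open>s \<mapsto> F (R\<^sub>x(s u))\<close> is the inner product of \<open>u\<close> with the pulled back gradient,
  so the Lipschitz condition bounds its variation and the mean value theorem gives the estimate.\<close>

lemma retraction_descent:
  assumes C: "\<And>u. rnorm g x u \<le> r \<Longrightarrow>
      rnorm g x (radjoint g x (R (x, u)) (dretr \<A> R x u) (grad (R (x, u))) - grad x) \<le> C * rnorm g x u"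
    and "C \<ge> 0" "rnorm g x u \<le> r"
  shows "\<bar>F (R (x, u)) - F x - g x (grad x) u\<bar> \<le> C * (rnorm g x u)\<^sup>2"
proof -
  let ?a = "\<lambda>s. radjoint g x (R (x, s *\<^sub>R u)) (dretr \<A> R x (s *\<^sub>R u)) (grad (R (x, s *\<^sub>R u)))"
  obtain s where s: "0 < s" "s < 1" "F (R (x, 1 *\<^sub>R u)) - F (R (x, 0 *\<^sub>R u)) = (1 - 0) * g x (?a s) u"
    using MVT2[of 0 1 "\<lambda>s. F (R (x, s *\<^sub>R u))", OF _ F_R_line_has_derivative] by auto
  then have "\<bar>F (R (x, u)) - F x - g x (grad x) u\<bar> = \<bar>g x (?a s - grad x) u\<bar>"
    by (simp add: R_zero g_bilinear_simps)
  also have "\<dots> \<le> rnorm g x (?a s - grad x) * rnorm g x u"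
    by (rule g_Cauchy_Schwarz)
  also have "\<dots> \<le> (C * rnorm g x u) * rnorm g x u"
  proof (intro mult_right_mono rnorm_nonneg)
    have le: "s * rnorm g x u \<le> rnorm g x u"
      using s rnorm_nonneg by (simp add: mult_left_le_one_le)
    then have "rnorm g x (?a s - grad x) \<le> C * rnorm g x (s *\<^sub>R u)"
      using assms(3) s by (intro C) (simp add: rnorm_scaleR)
    also have "\<dots> \<le> C * rnorm g x u"
      using le s assms(2) by (intro mult_left_mono) (simp_all add: rnorm_scaleR)
    finally show "rnorm g x (?a s - grad x) \<le> C * rnorm g x u" .
  qed
  finally show ?thesis by (simp add: power2_eq_square mult.assoc)
qed

text \<open>For short steps the gradient at the new point is bounded by its pull-back, which the Lipschitz
  condition compares with the gradient at the old point. For steps longer than \<open>\<delta>\<close> the global bound \<open>B\<close> on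
  the gradient is itself at most \<open>B / \<delta>\<close> times the length of the step.\<close>

lemma gradient_growth:
  assumes "compact K" "R_Lipschitz \<A> g R grad K r"
    and bound: "\<And>x. x \<in> K \<Longrightarrow> rnorm g x (grad x) \<le> B"
  obtains L where "L \<ge> 0"
    "\<And>x u. x \<in> K \<Longrightarrow> rnorm g x u \<le> r \<Longrightarrow> R (x, u) \<in> K \<Longrightarrow>
      rnorm g (R (x, u)) (grad (R (x, u))) \<le> rnorm g x (grad x) + L * rnorm g x u"
proof -
  obtain \<delta> C where iso: "\<delta> > 0" "C \<ge> 0"
    "\<And>x u w. x \<in> K \<Longrightarrow> rnorm g x u \<le> \<delta> \<Longrightarrow>
      rnorm g (R (x, u)) w \<le> (1 + C * rnorm g x u) * rnorm g x (radjoint g x (R (x, u)) (dretr \<A> R x u) w)"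
    using rnorm_le_radjoint_compact[OF assms(1)] by metis
  obtain D where D: "D > 0" "\<And>x u. x \<in> K \<Longrightarrow> rnorm g x u \<le> r \<Longrightarrow>
      rnorm g x (radjoint g x (R (x, u)) (dretr \<A> R x u) (grad (R (x, u))) - grad x) \<le> D * rnorm g x u"
    using assms(2) unfolding R_Lipschitz_def by blast
  define L where "L = (D + C * max B 0 + C * \<delta> * D) + max B 0 / \<delta>"
  have L: "D + C * max B 0 + C * \<delta> * D \<le> L" "max B 0 / \<delta> \<le> L" "L \<ge> 0"
    using iso D by (auto simp: L_def)
  show ?thesis
  proof (rule that[OF L(3)])
    fix x u assume xu: "x \<in> K" "rnorm g x u \<le> r" "R (x, u) \<in> K"
    let ?n = "rnorm g x u" and ?b = "rnorm g x (grad x)"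
    let ?a = "radjoint g x (R (x, u)) (dretr \<A> R x u) (grad (R (x, u)))"
    have n: "?n \<ge> 0" "?b \<ge> 0" by (rule rnorm_nonneg)+
    show "rnorm g (R (x, u)) (grad (R (x, u))) \<le> ?b + L * ?n"
    proof (cases "?n \<le> \<delta>")
      case True
      have "rnorm g x ?a \<le> rnorm g x (grad x) + rnorm g x (?a - grad x)"
        using rnorm_triangle[of x "grad x" "?a - grad x"] by simp
      also have "\<dots> \<le> ?b + D * ?n" using D(2)[OF xu(1,2)] by simp
      finally have a: "rnorm g x ?a \<le> ?b + D * ?n" .
      have "rnorm g (R (x, u)) (grad (R (x, u))) \<le> (1 + C * ?n) * rnorm g x ?a"
        by (rule iso(3)[OF xu(1) True])
      also have "\<dots> \<le> (1 + C * ?n) * (?b + D * ?n)"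
        using a iso n by (intro mult_left_mono) auto
      also have "\<dots> = ?b + (D * ?n + C * ?n * ?b + C * ?n * D * ?n)"
        by (simp add: algebra_simps)
      also have "\<dots> \<le> ?b + (D * ?n + C * ?n * max B 0 + C * \<delta> * D * ?n)"
        using bound[OF xu(1)] iso D n True by (intro add_mono mult_mono order_refl) auto
      also have "\<dots> = ?b + (D + C * max B 0 + C * \<delta> * D) * ?n"
        by (simp add: algebra_simps)
      also have "\<dots> \<le> ?b + L * ?n"
        using L n by (intro add_left_mono mult_right_mono)
      finally show ?thesis .
    next
      case False
      have "rnorm g (R (x, u)) (grad (R (x, u))) \<le> max B 0 * 1"
        using bound[OF xu(3)] by simp
      also have "\<dots> \<le> max B 0 * (?n / \<delta>)"
        using False iso by (intro mult_left_mono) (auto simp: field_simps)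
      also have "\<dots> = max B 0 / \<delta> * ?n" by simp
      also have "\<dots> \<le> L * ?n" using L n by (intro mult_right_mono)
      finally show ?thesis using n by simp
    qed
  qed
qed

end

section \<open>Borel functions on the tangent bundle\<close>

context smooth_manifold
begin

text \<open>Charts of a countable subcover, numbered so that the first one containing a point is a Borel
  choice of chart. The preferred charts may depend on the point in a non-measurable way.\<close>

definition cover :: "nat \<Rightarrow> ('m, 'e) chart" where
  "cover = (SOME c. range c \<subseteq> \<A> \<and> (\<Union>n::nat. fst (c n)) = UNIV)"

definition cover_index :: "'m \<Rightarrow> nat" where
  "cover_index x = (LEAST n. x \<in> fst (cover n))"

abbreviation cover_chart :: "'m \<Rightarrow> ('m, 'e) chart" where
  "cover_chart x \<equiv> cover (cover_index x)"

lemma cover: "cover n \<in> \<A>" "(\<Union>n. fst (cover n)) = UNIV"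
proof -
  have U: "(\<Union>c\<in>\<A>. fst c) = UNIV"
    using atlas by (simp add: smooth_atlas_def)
  obtain \<U> where \<U>: "\<U> \<subseteq> fst ` \<A>" "countable \<U>" "\<Union>\<U> = \<Union>(fst ` \<A>)"
    using Lindelof[of "fst ` \<A>"] chart_open by blast
  then have "\<U> \<noteq> {}" using U by auto
  define f where "f = from_nat_into \<U>"
  have f: "range f = \<U>"
    unfolding f_def using \<U> \<open>\<U> \<noteq> {}\<close> by (intro range_from_nat_into)
  then have "\<forall>n. \<exists>c\<in>\<A>. fst c = f n"
    using \<U>(1) by blast
  then obtain c where c: "\<And>n. c n \<in> \<A>" "\<And>n. fst (c n) = f n"
    by metis
  have "(\<Union>n. fst (c n)) = UNIV" using c f \<U> U by auto
  then have "\<exists>c. range c \<subseteq> \<A> \<and> (\<Union>n::nat. fst (c n)) = UNIV"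
    using c by (intro exI[of _ c]) auto
  then have "range cover \<subseteq> \<A> \<and> (\<Union>n. fst (cover n)) = UNIV"
    unfolding cover_def by (rule someI_ex)
  then show "cover n \<in> \<A>" "(\<Union>n. fst (cover n)) = UNIV" by auto
qed

lemma in_cover_chart: "x \<in> fst (cover_chart x)"
proof -
  have "\<exists>n. x \<in> fst (cover n)" using cover(2) by blast
  then show ?thesis unfolding cover_index_def by (rule LeastI_ex)
qed

lemma cover_index_sets: "{x. cover_index x = n} \<in> sets borel"
proof -
  have "{x. cover_index x = n} = fst (cover n) - (\<Union>i<n. fst (cover i))"
  proof (intro set_eqI iffI)
    fix x assume "x \<in> {x. cover_index x = n}"
    then have n: "cover_index x = n" by simp
    have "x \<notin> fst (cover i)" if "i < n" for i
      using not_less_Least[of i "\<lambda>n. x \<in> fst (cover n)"] that n unfolding cover_index_def by simp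
    then show "x \<in> fst (cover n) - (\<Union>i<n. fst (cover i))"
      using in_cover_chart[of x] n by simp
  next
    fix x assume "x \<in> fst (cover n) - (\<Union>i<n. fst (cover i))"
    then show "x \<in> {x. cover_index x = n}"
      unfolding cover_index_def mem_Collect_eq by (intro Least_equality) (auto simp: not_less[symmetric])
  qed
  then show ?thesis
    using chart_open(1)[OF cover(1)] by auto
qed

lemma sets_atlas_borel: "atlas_open \<B> W \<Longrightarrow> W \<in> sets (atlas_borel \<B>)"
  by (auto simp: atlas_borel_def)

lemma space_atlas_borel [simp]: "space (atlas_borel \<B>) = UNIV"
  by (simp add: atlas_borel_def space_measure_of_conv)

text \<open>In the coordinates of another chart \<open>d\<close> this set is the preimage of \<open>B\<close> under the transition map of the
  tangent bundle, which is continuous because the transition maps of the manifold are of class \<open>C\<^sup>1\<close>.\<close>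

lemma atlas_open_chart_coordinates:
  assumes c: "c \<in> \<A>" and B: "open B"
  shows "atlas_open (tangent_atlas \<A>) {z. fst z \<in> fst c \<and> (snd c (fst z), to_chart c (fst z) (snd z)) \<in> B}"
  unfolding atlas_open_def tangent_atlas_def
proof (intro ballI, elim imageE, simp only:)
  fix d assume d: "d \<in> \<A>"
  let ?W = "{z. fst z \<in> fst c \<and> (snd c (fst z), to_chart c (fst z) (snd z)) \<in> B}"
  let ?S = "(snd d ` (fst d \<inter> fst c)) \<times> (UNIV :: 'e set)"
  let ?f = "\<lambda>z. ((snd c \<circ> chart_inv d) (fst z), frechet_derivative (snd c \<circ> chart_inv d) (at (fst z)) (snd z))"
  have "continuous_on ?S ?f"
    by (intro continuous_intros continuous_on_frechet_derivative_pair transition_smooth c d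
        continuous_on_compose2[OF Ck_on_imp_continuous_on[OF transition_smooth[OF d c]]]) auto
  moreover have "open ?S"
    using chart_image_open[OF d chart_open(1)[OF c]] by (intro open_Times) auto
  ultimately have "open (?S \<inter> ?f -` B)"
    using B by (rule continuous_open_preimage)
  also have "?S \<inter> ?f -` B = snd (chart_tc d) ` (fst (chart_tc d) \<inter> ?W)"
  proof -
    have "frechet_derivative (snd c \<circ> chart_inv d) (at (snd d x)) v = to_chart c x (from_chart d x v)"
      if "x \<in> fst c" "x \<in> fst d" for x v
      using coord_change_trans[OF d chart_at(1) c that(2) chart_at(2) that(1)]
      by (simp add: coord_change_def[of d c])
    then show ?thesis
      unfolding chart_tc_image[OF d] by (auto simp: chart_inv_chart d)
  qed
  finally show "open (snd (chart_tc d) ` (?W \<inter> fst (chart_tc d)))"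
    by (simp only: Int_commute)
qed

lemma measurable_tangent_fst: "fst \<in> atlas_borel (tangent_atlas \<A>) \<rightarrow>\<^sub>M borel"
proof (rule borel_measurableI)
  fix W :: "'m set" assume "open W"
  have "atlas_open (tangent_atlas \<A>) (fst -` W)"
    unfolding atlas_open_def tangent_atlas_def
  proof (intro ballI, elim imageE, simp only:)
    fix d assume d: "d \<in> \<A>"
    have "snd (chart_tc d) ` (fst (chart_tc d) \<inter> fst -` W) = (snd d ` (fst d \<inter> W)) \<times> UNIV"
      unfolding chart_tc_image[OF d] using d by (auto simp: chart_inv_chart)
    then show "open (snd (chart_tc d) ` (fst -` W \<inter> fst (chart_tc d)))"
      using chart_image_open[OF d \<open>open W\<close>] by (simp add: Int_commute open_Times)
  qed
  then show "fst -` W \<inter> space (atlas_borel (tangent_atlas \<A>)) \<in> sets (atlas_borel (tangent_atlas \<A>))"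
    by (simp add: sets_atlas_borel)
qed

text \<open>In the coordinates of the first chart of the cover the tangent bundle becomes the measurable
  space \<open>'m \<times> 'e\<close>.\<close>

lemma measurable_trivialization:
  "(\<lambda>z. to_chart (cover_chart (fst z)) (fst z) (snd z)) \<in> borel_measurable (atlas_borel (tangent_atlas \<A>))"
  (is "?T \<in> _")
proof (rule borel_measurableI)
  let ?M = "atlas_borel (tangent_atlas \<A>)"
  fix B :: "'e set" assume B: "open B"
  let ?W = "\<lambda>n. {z. fst z \<in> fst (cover n) \<and> (snd (cover n) (fst z), to_chart (cover n) (fst z) (snd z)) \<in> UNIV \<times> B}"
  have "?T -` B = (\<Union>n. (fst -` {x. cover_index x = n} \<inter> space ?M) \<inter> ?W n)"
    using in_cover_chart by auto
  also have "\<dots> \<in> sets ?M"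
  proof (rule sets.countable_nat_UN, rule image_subsetI, rule sets.Int)
    show "fst -` {x. cover_index x = n} \<inter> space ?M \<in> sets ?M" for n
      by (rule measurable_sets[OF measurable_tangent_fst cover_index_sets])
    show "?W n \<in> sets ?M" for n
      using B by (intro sets_atlas_borel atlas_open_chart_coordinates cover(1) open_Times) auto
  qed
  finally show "?T -` B \<inter> space ?M \<in> sets ?M" by simp
qed

text \<open>The Borel sets on which the chosen chart is constant cut \<open>f\<close> into countably many restrictions of
  continuous functions.\<close>

lemma borel_measurable_chartwise:
  fixes f :: "'m \<times> 'e \<Rightarrow> 'b::topological_space"
  assumes "\<And>c. c \<in> \<A> \<Longrightarrow> continuous_on (fst c \<times> UNIV) (f' c)"
    and "\<And>z. f z = f' (cover_chart (fst z)) z"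
  shows "f \<in> borel_measurable borel"
proof (rule borel_measurableI)
  fix S :: "'b set" assume S: "open S"
  have "f -` S = (\<Union>n. (fst -` {x. cover_index x = n} \<inter> space borel) \<inter>
      (fst (cover n) \<times> UNIV \<inter> f' (cover n) -` S))"
    using in_cover_chart assms(2) by auto
  also have "\<dots> \<in> sets borel"
  proof (rule sets.countable_nat_UN, rule image_subsetI, rule sets.Int)
    show "(fst :: 'm \<times> 'e \<Rightarrow> 'm) -` {x. cover_index x = n} \<inter> space borel \<in> sets borel" for n
      by (rule measurable_sets[OF _ cover_index_sets]) (simp add: borel_measurable_continuous_onI continuous_on_fst)
    show "fst (cover n) \<times> UNIV \<inter> f' (cover n) -` S \<in> sets borel" for n
      using continuous_open_preimage[OF assms(1)[OF cover(1)] _ S] chart_open(1)[OF cover(1)]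
      by (simp add: open_Times)
  qed
  finally show "f -` S \<inter> space borel \<in> sets borel" by simp
qed

lemma measurable_tangent_compose:
  assumes H: "H \<in> N \<rightarrow>\<^sub>M atlas_borel (tangent_atlas \<A>)"
  shows "(\<lambda>z. (fst (H z), to_chart (cover_chart (fst (H z))) (fst (H z)) (snd (H z)))) \<in> borel_measurable N"
  using measurable_compose[OF H measurable_tangent_fst] measurable_compose[OF H measurable_trivialization]
  by (rule borel_measurable_Pair)

end

context riemannian
begin

text \<open>Through the trivialization, each function on the tangent bundle that the algorithm evaluates becomes a
  chartwise continuous function on \<open>'m \<times> 'e\<close>.\<close>

lemma measurable_rnorm_square:
  assumes H: "H \<in> N \<rightarrow>\<^sub>M atlas_borel (tangent_atlas \<A>)"
  shows "(\<lambda>z. (rnorm g (fst (H z)) (snd (H z)))\<^sup>2) \<in> borel_measurable N"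
proof -
  let ?f = "\<lambda>z. gram (cover_chart (fst z)) (snd (cover_chart (fst z)) (fst z)) (snd z) (snd z)"
  have "?f \<in> borel_measurable borel"
  proof (rule borel_measurable_chartwise)
    fix c assume c: "c \<in> \<A>"
    have "continuous_on (fst c \<times> (UNIV::'e set)) (\<lambda>z. snd c (fst z))"
      by (rule continuous_on_compose2[OF chart_continuous(1)[OF c]]) (auto intro: continuous_intros)
    then have "continuous_on (fst c \<times> (UNIV::'e set)) (\<lambda>z. gram c (snd c (fst z)) b b')" for b b'
      by (rule continuous_on_compose2[OF Ck_on_imp_continuous_on[OF gram_smooth[OF c, of 0]]]) auto
    then have "continuous_on (fst c \<times> (UNIV::'e set))
        (\<lambda>z. \<Sum>b\<in>Basis. (snd z \<bullet> b) * (\<Sum>b'\<in>Basis. (snd z \<bullet> b') * gram c (snd c (fst z)) b' b))"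
      by (intro continuous_intros)
    moreover have "(\<Sum>b\<in>Basis. (v \<bullet> b) * (\<Sum>b'\<in>Basis. (v \<bullet> b') * gram c (snd c x) b' b)) = gram c (snd c x) v v"
      if "x \<in> fst c" for x v
    proof -
      have bl: "bilinear (gram c (snd c x))"
        using c that by (intro gram_bilinear) auto
      then have l: "linear (gram c (snd c x) v)" "linear (\<lambda>v. gram c (snd c x) v b)" for b
        by (auto simp: bilinear_def)
      have "(\<Sum>b\<in>Basis. (w \<bullet> b) * gram c (snd c x) v b) = gram c (snd c x) v (\<Sum>b\<in>Basis. (w \<bullet> b) *\<^sub>R b)" for w
        by (simp add: linear_sum[OF l(1)] linear_scale[OF l(1)])
      moreover have "(\<Sum>b'\<in>Basis. (v \<bullet> b') * gram c (snd c x) b' b) = gram c (snd c x) (\<Sum>b'\<in>Basis. (v \<bullet> b') *\<^sub>R b') b" for b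
        by (simp add: linear_sum[OF l(2)] linear_scale[OF l(2)])
      ultimately show ?thesis by (simp add: euclidean_representation)
    qed
    ultimately show "continuous_on (fst c \<times> UNIV) (\<lambda>z. gram c (snd c (fst z)) (snd z) (snd z))"
      by (rule continuous_on_eq) auto
  qed simp
  from measurable_compose[OF measurable_tangent_compose[OF H] this] show ?thesis
    by (simp add: gram_def chart_inv_chart cover in_cover_chart from_to_chart rnorm_square)
qed

end

context C1_function
begin

lemma measurable_mdiff:
  assumes H: "H \<in> N \<rightarrow>\<^sub>M atlas_borel (tangent_atlas \<A>)"
  shows "(\<lambda>z. mdiff \<A> std_atlas F (fst (H z)) (snd (H z))) \<in> borel_measurable N"
proof -
  let ?f = "\<lambda>z. mdiff \<A> std_atlas F (fst z) (from_chart (cover_chart (fst z)) (fst z) (snd z))"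
  have "?f \<in> borel_measurable borel"
  proof (rule borel_measurable_chartwise)
    fix c assume c: "c \<in> \<A>"
    have "continuous_on ((snd c ` fst c) \<times> (UNIV::'e set))
        (\<lambda>z. frechet_derivative (F \<circ> chart_inv c) (at (fst z)) (snd z))"
      by (rule continuous_on_frechet_derivative_pair[OF F_chart_C1[OF c]])
    moreover have "continuous_on (fst c \<times> (UNIV::'e set)) (\<lambda>z. (snd c (fst z), snd z))"
      by (intro continuous_intros continuous_on_compose2[OF chart_continuous(1)[OF c]]) auto
    ultimately have "continuous_on (fst c \<times> (UNIV::'e set))
      (\<lambda>z. frechet_derivative (F \<circ> chart_inv c) (at (fst (snd c (fst z), snd z))) (snd (snd c (fst z), snd z)))"
      by (rule continuous_on_compose2) auto
    then show "continuous_on (fst c \<times> UNIV) (\<lambda>z. mdiff \<A> std_atlas F (fst z) (from_chart c (fst z) (snd z)))"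
      by (rule continuous_on_eq) (use frechet_derivative_at[OF F_chart_has_derivative[OF c]] in \<open>auto simp: fun_eq_iff\<close>)
  qed simp
  from measurable_compose[OF measurable_tangent_compose[OF H] this] show ?thesis
    by (simp add: cover in_cover_chart from_to_chart)
qed

end

context retraction
begin

text \<open>The local representatives \<open>R_loc c d\<close> are continuous on open sets, and the charts \<open>d\<close> are homeomorphisms
  whose domains cover the manifold.\<close>

lemma R_continuous_in_chart:
  assumes c: "c \<in> \<A>"
  shows "continuous_on (fst c \<times> UNIV) (\<lambda>z. R (fst z, from_chart c (fst z) (snd z)))"
proof -
  let ?S = "fst c \<times> (UNIV :: 'e set)" and ?f = "\<lambda>z. R (fst z, from_chart c (fst z) (snd z))"
  have S: "open ?S" using chart_open(1)[OF c] by (intro open_Times) auto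
  have cc: "continuous_on ?S (\<lambda>z. (snd c (fst z), snd z))"
    by (intro continuous_intros continuous_on_compose2[OF chart_continuous(1)[OF c]]) auto
  show ?thesis
    unfolding continuous_on_open_vimage[OF S]
  proof (intro allI impI)
    fix B :: "'m set" assume B: "open B"
    have "?f -` B \<inter> ?S = (\<Union>d\<in>\<A>. ?S \<inter> (\<lambda>z. (snd c (fst z), snd z)) -`
        (R_dom c d \<inter> R_loc c d -` (snd d ` (fst d \<inter> B))))"
    proof (intro equalityI subsetI)
      fix z assume "z \<in> ?f -` B \<inter> ?S"
      then show "z \<in> (\<Union>d\<in>\<A>. ?S \<inter> (\<lambda>z. (snd c (fst z), snd z)) -`
        (R_dom c d \<inter> R_loc c d -` (snd d ` (fst d \<inter> B))))"
        using c chart_at[of "?f z"] imageI[of "?f z" "fst (chart_at \<A> (?f z)) \<inter> B" "snd (chart_at \<A> (?f z))"]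
        by (intro UN_I[of "chart_at \<A> (?f z)"]) (simp_all add: R_dom_iff R_loc_eq mem_Times_iff)
    next
      fix z assume "z \<in> (\<Union>d\<in>\<A>. ?S \<inter> (\<lambda>z. (snd c (fst z), snd z)) -`
        (R_dom c d \<inter> R_loc c d -` (snd d ` (fst d \<inter> B))))"
      then obtain d where d: "d \<in> \<A>" "fst z \<in> fst c" "?f z \<in> fst d" "snd d (?f z) \<in> snd d ` (fst d \<inter> B)"
        using c by (auto simp: R_dom_iff R_loc_eq mem_Times_iff)
      from d(4) obtain p where "snd d (?f z) = snd d p" "p \<in> fst d \<inter> B" by (rule imageE)
      then have p: "p \<in> fst d" "p \<in> B" "snd d (?f z) = snd d p" by auto
      have "?f z = p"
        using chart_inv_chart[OF d(1) d(3)] chart_inv_chart[OF d(1) p(1)] p(3) by metis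
      then show "z \<in> ?f -` B \<inter> ?S" using d(2) p(2) by (simp add: mem_Times_iff)
    qed
    also have "open \<dots>"
    proof (intro open_UN ballI)
      fix d assume d: "d \<in> \<A>"
      have "open (R_dom c d \<inter> R_loc c d -` (snd d ` (fst d \<inter> B)))"
        by (intro continuous_open_preimage Ck_on_imp_continuous_on[OF R_loc_C2(2)] R_loc_C2(1) chart_image_open c d B)
      then show "open (?S \<inter> (\<lambda>z. (snd c (fst z), snd z)) -` (R_dom c d \<inter> R_loc c d -` (snd d ` (fst d \<inter> B))))"
        by (rule continuous_open_preimage[OF cc S])
    qed
    finally show "open (?f -` B \<inter> ?S)" .
  qed
qed

lemma measurable_retraction_step:
  assumes H: "H \<in> N \<rightarrow>\<^sub>M atlas_borel (tangent_atlas \<A>)" and s: "s \<in> borel_measurable N"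
  shows "(\<lambda>z. R (fst (H z), s z *\<^sub>R snd (H z))) \<in> borel_measurable N"
proof -
  let ?f = "\<lambda>z. R (fst z, from_chart (cover_chart (fst z)) (fst z) (snd z))"
  let ?T = "\<lambda>z. to_chart (cover_chart (fst (H z))) (fst (H z)) (snd (H z))"
  have f: "?f \<in> borel_measurable borel"
    by (rule borel_measurable_chartwise) (rule R_continuous_in_chart, simp_all)
  have "(\<lambda>z. (fst (H z), s z *\<^sub>R ?T z)) \<in> borel_measurable N"
    using measurable_compose[OF H measurable_tangent_fst] measurable_compose[OF H measurable_trivialization] s
    by (intro borel_measurable_Pair borel_measurable_scaleR)
  from measurable_compose[OF this f]
  have "(\<lambda>z. R (fst (H z), from_chart (cover_chart (fst (H z))) (fst (H z)) (s z *\<^sub>R ?T z))) \<in> borel_measurable N"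
    by simp
  moreover have "from_chart (cover_chart x) x (a *\<^sub>R to_chart (cover_chart x) x v) = a *\<^sub>R v" for x a v
  proof -
    have "linear (from_chart (cover_chart x) x)"
      by (intro coord_change_linear cover in_cover_chart chart_at)
    then show ?thesis
      by (simp add: linear_scale from_to_chart cover in_cover_chart)
  qed
  ultimately show ?thesis by simp
qed

end

section \<open>Convergence of sums of martingale differences\<close>

context prob_space
begin

text \<open>A bounded factor that is measurable for \<open>G\<close> can be taken out of the conditional expectation.\<close>

lemma integral_predictable_mult_martingale_difference:
  assumes sub: "subalgebra M G" and mart: "AE x in M. real_cond_exp M G \<xi> x = 0"
    and \<xi>: "\<xi> \<in> borel_measurable M" "\<And>x. x \<in> space M \<Longrightarrow> \<bar>\<xi> x\<bar> \<le> B"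
    and \<phi>: "\<phi> \<in> borel_measurable G" "\<And>x. x \<in> space M \<Longrightarrow> \<bar>\<phi> x\<bar> \<le> C"
  shows "expectation (\<lambda>x. \<phi> x * \<xi> x) = 0"
proof -
  interpret finite_measure_subalgebra M G
    by unfold_locales (rule sub)
  have \<phi>M: "\<phi> \<in> borel_measurable M" using measurable_from_subalg[OF sub \<phi>(1)] .
  have "integrable M (\<lambda>x. \<phi> x * \<xi> x)"
  proof (rule integrable_const_bound[of _ "C * B"])
    show "AE x in M. norm (\<phi> x * \<xi> x) \<le> C * B"
    proof (rule AE_I2)
      fix x assume x: "x \<in> space M"
      have "\<bar>\<phi> x\<bar> * \<bar>\<xi> x\<bar> \<le> C * B"
        using \<xi>(2)[OF x] \<phi>(2)[OF x] by (intro mult_mono) auto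
      then show "norm (\<phi> x * \<xi> x) \<le> C * B" by (simp add: abs_mult)
    qed
    show "(\<lambda>x. \<phi> x * \<xi> x) \<in> borel_measurable M"
      using \<phi>M \<xi>(1) by (rule borel_measurable_times)
  qed
  from real_cond_exp_intg(2)[OF this \<phi>(1) \<xi>(1)]
  have "expectation (\<lambda>x. \<phi> x * \<xi> x) = expectation (\<lambda>x. \<phi> x * real_cond_exp M G \<xi> x)" by simp
  also have "\<dots> = expectation (\<lambda>x. 0)"
  proof (rule integral_cong_AE)
    show "(\<lambda>x. \<phi> x * real_cond_exp M G \<xi> x) \<in> borel_measurable M"
      using \<phi>M by (intro borel_measurable_times) auto
    show "AE x in M. \<phi> x * real_cond_exp M G \<xi> x = 0"
      using mart by eventually_elim simp
  qed simp
  finally show ?thesis by simp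
qed

text \<open>The summands remain orthogonal after multiplication by predictable indicators, so the second moments add
  up.\<close>

lemma martingale_differences_stopped_second_moment:
  assumes sub: "\<And>t. subalgebra M (G t)" and mono: "\<And>s t. s \<le> t \<Longrightarrow> sets (G s) \<subseteq> sets (G t)"
    and adapted: "\<And>t. \<xi> t \<in> borel_measurable (G (Suc t))"
    and bounded: "\<And>t x. x \<in> space M \<Longrightarrow> \<bar>\<xi> t x\<bar> \<le> B"
    and mart: "\<And>t. AE x in M. real_cond_exp M (G t) (\<xi> t) x = 0"
    and \<theta>: "\<And>t. \<theta> t \<in> borel_measurable (G t)" "\<And>t x. \<theta> t x \<in> {0, 1}"
  shows "expectation (\<lambda>x. (\<Sum>t=n..<m. \<theta> t x * \<xi> t x)\<^sup>2) \<le> (\<Sum>t=n..<m. expectation (\<lambda>x. (\<xi> t x)\<^sup>2))"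
proof (induction m)
  case 0
  then show ?case by simp
next
  case (Suc m)
  show ?case
  proof (cases "n \<le> m")
    case False
    then show ?thesis by simp
  next
    case True
    define S where "S x = (\<Sum>t=n..<m. \<theta> t x * \<xi> t x)" for x
    have meas: "f \<in> borel_measurable (G t)" if "f \<in> borel_measurable (G s)" "s \<le> t" for f :: "'a \<Rightarrow> real" and s t
      using that mono[of s t] sub by (auto simp: measurable_def subalgebra_def)
    have S_G: "S \<in> borel_measurable (G m)"
      unfolding S_def
      by (intro borel_measurable_sum borel_measurable_times)
        (auto intro: meas[OF \<theta>(1)] meas[OF adapted])
    have S_M: "S \<in> borel_measurable M" using measurable_from_subalg[OF sub S_G] .
    have \<xi>_M: "\<xi> t \<in> borel_measurable M" and \<theta>_M: "\<theta> t \<in> borel_measurable M" for t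
      using measurable_from_subalg[OF sub adapted] measurable_from_subalg[OF sub \<theta>(1)] by auto
    have \<theta>_abs: "\<bar>\<theta> t x\<bar> \<le> 1" for t x using \<theta>(2)[of t x] by auto
    have \<theta>\<xi>: "\<bar>\<theta> t x * \<xi> t x\<bar> \<le> B" if "x \<in> space M" for t x
      using bounded[OF that, of t] \<theta>(2)[of t x] by auto
    have S_bound: "\<bar>S x\<bar> \<le> real (m - n) * B" if "x \<in> space M" for x
    proof -
      have "\<bar>S x\<bar> \<le> (\<Sum>t=n..<m. B)"
        unfolding S_def using sum_abs \<theta>\<xi>[OF that] by (rule order_trans[OF _ sum_mono])
      then show ?thesis by simp
    qed
    have int: "integrable M f" if "f \<in> borel_measurable M" "\<And>x. x \<in> space M \<Longrightarrow> \<bar>f x\<bar> \<le> C" for f and C :: real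
      using that by (intro integrable_const_bound[of _ C]) auto
    have i1: "integrable M (\<lambda>x. (S x)\<^sup>2)"
      using S_M power_mono[OF S_bound abs_ge_zero, of _ 2] by (intro int[of _ "(real (m - n) * B)\<^sup>2"]) auto
    have i2: "integrable M (\<lambda>x. (\<xi> m x)\<^sup>2)"
      using \<xi>_M power_mono[OF bounded abs_ge_zero, of _ m 2] by (intro int[of _ "B\<^sup>2"]) auto
    have i3: "integrable M (\<lambda>x. S x * \<theta> m x * \<xi> m x)"
    proof (rule int)
      show "(\<lambda>x. S x * \<theta> m x * \<xi> m x) \<in> borel_measurable M"
        using S_M \<xi>_M \<theta>_M by (intro borel_measurable_times) auto
      show "\<bar>S x * \<theta> m x * \<xi> m x\<bar> \<le> (real (m - n) * B) * B" if "x \<in> space M" for x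
        using mult_mono'[OF S_bound[OF that] \<theta>\<xi>[OF that, of m]] by (simp add: abs_mult mult.assoc)
    qed
    have "expectation (\<lambda>x. (\<Sum>t=n..<Suc m. \<theta> t x * \<xi> t x)\<^sup>2) \<le>
        expectation (\<lambda>x. (S x)\<^sup>2 + 2 * (S x * \<theta> m x * \<xi> m x) + (\<xi> m x)\<^sup>2)"
    proof (rule integral_mono)
      show "integrable M (\<lambda>x. (\<Sum>t=n..<Suc m. \<theta> t x * \<xi> t x)\<^sup>2)"
      proof (rule int)
        show "(\<lambda>x. (\<Sum>t=n..<Suc m. \<theta> t x * \<xi> t x)\<^sup>2) \<in> borel_measurable M"
          using \<xi>_M \<theta>_M by (intro borel_measurable_power borel_measurable_sum borel_measurable_times)
        show "\<bar>(\<Sum>t=n..<Suc m. \<theta> t x * \<xi> t x)\<^sup>2\<bar> \<le> (real (m - n) * B + B)\<^sup>2" if "x \<in> space M" for x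
        proof -
          have "\<bar>S x + \<theta> m x * \<xi> m x\<bar> \<le> real (m - n) * B + B"
            using S_bound[OF that] \<theta>\<xi>[OF that, of m] by linarith
          from power_mono[OF this abs_ge_zero, of 2] show ?thesis
            using True by (simp add: S_def)
        qed
      qed
      show "integrable M (\<lambda>x. (S x)\<^sup>2 + 2 * (S x * \<theta> m x * \<xi> m x) + (\<xi> m x)\<^sup>2)"
        using i1 i2 i3 by auto
      show "(\<Sum>t=n..<Suc m. \<theta> t x * \<xi> t x)\<^sup>2 \<le> (S x)\<^sup>2 + 2 * (S x * \<theta> m x * \<xi> m x) + (\<xi> m x)\<^sup>2" for x
        using True \<theta>(2)[of m x] by (auto simp: S_def power2_sum)
    qed
    also have "\<dots> = expectation (\<lambda>x. (S x)\<^sup>2) + 2 * expectation (\<lambda>x. S x * \<theta> m x * \<xi> m x) + expectation (\<lambda>x. (\<xi> m x)\<^sup>2)"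
      using i1 i2 i3 by simp
    also have "expectation (\<lambda>x. S x * \<theta> m x * \<xi> m x) = 0"
    proof (rule integral_predictable_mult_martingale_difference[OF sub mart \<xi>_M bounded])
      show "(\<lambda>x. S x * \<theta> m x) \<in> borel_measurable (G m)"
        using S_G \<theta>(1) by (rule borel_measurable_times)
      show "\<bar>S x * \<theta> m x\<bar> \<le> (real (m - n) * B) * 1" if "x \<in> space M" for x
        using mult_mono'[OF S_bound[OF that] \<theta>_abs[of m x]] by (simp add: abs_mult)
    qed
    finally show ?thesis
      using Suc True by (simp add: S_def)
  qed
qed

text \<open>Stopping the sum as soon as its modulus reaches \<open>c\<close> keeps the modulus at least \<open>c\<close>, so
  Chebyshev's inequality for the stopped sum controls the whole path.\<close>

lemma martingale_differences_maximal_inequality: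
  assumes sub: "\<And>t. subalgebra M (G t)" and mono: "\<And>s t. s \<le> t \<Longrightarrow> sets (G s) \<subseteq> sets (G t)"
    and adapted: "\<And>t. \<xi> t \<in> borel_measurable (G (Suc t))"
    and bounded: "\<And>t x. x \<in> space M \<Longrightarrow> \<bar>\<xi> t x\<bar> \<le> B"
    and mart: "\<And>t. AE x in M. real_cond_exp M (G t) (\<xi> t) x = 0"
    and "c > 0"
  shows "prob {x \<in> space M. \<exists>k\<in>{n..m}. c \<le> \<bar>\<Sum>t=n..<k. \<xi> t x\<bar>} \<le>
    (\<Sum>t=n..<m. expectation (\<lambda>x. (\<xi> t x)\<^sup>2)) / c\<^sup>2"
proof -
  define N where "N k x = (\<Sum>t=n..<k. \<xi> t x)" for k x
  define \<theta> where "\<theta> t x = (if \<forall>k\<in>{n..t}. \<bar>N k x\<bar> < c then 1 else 0 :: real)" for t x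
  define S where "S k x = (\<Sum>t=n..<k. \<theta> t x * \<xi> t x)" for k x
  have meas: "f \<in> borel_measurable (G t)" if "f \<in> borel_measurable (G s)" "s \<le> t" for f :: "'a \<Rightarrow> real" and s t
    using that mono[of s t] sub by (auto simp: measurable_def subalgebra_def)
  have N_G: "N k \<in> borel_measurable (G t)" if "k \<le> t" for k t
    unfolding N_def using that by (intro borel_measurable_sum meas[OF adapted]) auto
  have \<theta>: "\<theta> t \<in> borel_measurable (G t)" for t
  proof -
    have "Measurable.pred (G t) (\<lambda>x. \<forall>k\<in>{n..t}. \<bar>N k x\<bar> < c)"
      using N_G by (intro pred_intros_finite borel_measurable_pred_less) auto
    then show ?thesis unfolding \<theta>_def by measurable
  qed
  have \<xi>_M: "\<xi> t \<in> borel_measurable M" and \<theta>_M: "\<theta> t \<in> borel_measurable M" for t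
    using measurable_from_subalg[OF sub adapted] measurable_from_subalg[OF sub \<theta>] by auto
  have S_M: "S k \<in> borel_measurable M" for k
    unfolding S_def using \<xi>_M \<theta>_M by (intro borel_measurable_sum borel_measurable_times)
  have stop: "if \<forall>k\<in>{n..m}. \<bar>N k x\<bar> < c then S m x = N m x else c \<le> \<bar>S m x\<bar>" if "n \<le> m" for m x
    using that
  proof (induction m rule: dec_induct)
    case base
    then show ?case using \<open>c > 0\<close> by (simp add: S_def N_def)
  next
    case (step m)
    have S: "S (Suc m) x = S m x + \<theta> m x * \<xi> m x" "N (Suc m) x = N m x + \<xi> m x"
      using step by (simp_all add: S_def N_def)
    have "{n..Suc m} = insert (Suc m) {n..m}" using step by auto
    then show ?case
      using step S by (auto simp: \<theta>_def split: if_splits)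
  qed
  show ?thesis
  proof (cases "n \<le> m")
    case False
    then show ?thesis by simp
  next
    case True
    have int: "integrable M (\<lambda>x. (S m x)\<^sup>2)"
    proof (rule integrable_const_bound[of _ "(real (m - n) * B)\<^sup>2"])
      show "(\<lambda>x. (S m x)\<^sup>2) \<in> borel_measurable M" using S_M by auto
      show "AE x in M. norm ((S m x)\<^sup>2) \<le> (real (m - n) * B)\<^sup>2"
      proof (rule AE_I2)
        fix x assume x: "x \<in> space M"
        have "\<bar>S m x\<bar> \<le> (\<Sum>t=n..<m. \<bar>\<theta> t x * \<xi> t x\<bar>)"
          unfolding S_def by (rule sum_abs)
        also have "\<dots> \<le> (\<Sum>t=n..<m. B)"
          using bounded[OF x] order_trans[OF abs_ge_zero bounded[OF x]] by (intro sum_mono) (auto simp: \<theta>_def)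
        finally have "\<bar>S m x\<bar> \<le> real (m - n) * B" by simp
        from power_mono[OF this abs_ge_zero, of 2] show "norm ((S m x)\<^sup>2) \<le> (real (m - n) * B)\<^sup>2" by simp
      qed
    qed
    have "{x \<in> space M. \<exists>k\<in>{n..m}. c \<le> \<bar>\<Sum>t=n..<k. \<xi> t x\<bar>} \<subseteq> {x \<in> space M. c\<^sup>2 \<le> (S m x)\<^sup>2}"
    proof safe
      fix x k assume "k \<in> {n..m}" "c \<le> \<bar>\<Sum>t=n..<k. \<xi> t x\<bar>"
      then have "c \<le> \<bar>S m x\<bar>"
        using stop[OF True, of x] by (force simp: N_def split: if_splits)
      from power_mono[OF this, of 2] show "c\<^sup>2 \<le> (S m x)\<^sup>2" using \<open>c > 0\<close> by simp
    qed
    then have "prob {x \<in> space M. \<exists>k\<in>{n..m}. c \<le> \<bar>\<Sum>t=n..<k. \<xi> t x\<bar>} \<le> prob {x \<in> space M. c\<^sup>2 \<le> (S m x)\<^sup>2}"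
      using S_M by (intro finite_measure_mono) auto
    also have "\<dots> \<le> expectation (\<lambda>x. (S m x)\<^sup>2) / c\<^sup>2"
      using \<open>c > 0\<close> by (intro integral_Markov_inequality_measure[OF int, of "space M"]) auto
    also have "\<dots> \<le> (\<Sum>t=n..<m. expectation (\<lambda>x. (\<xi> t x)\<^sup>2)) / c\<^sup>2"
      unfolding S_def
      by (intro divide_right_mono martingale_differences_stopped_second_moment[where G=G, OF sub mono adapted bounded mart \<theta>])
        (auto simp: \<theta>_def)
    finally show ?thesis .
  qed
qed

text \<open>The maximal inequality bounds the probability that the sums starting at \<open>n\<close> ever reach \<open>c\<close> by a multiple
  of the tail of the series of second moments. Hence the partial sums are almost surely Cauchy.\<close>

lemma martingale_differences_summable:
  assumes sub: "\<And>t. subalgebra M (G t)" and mono: "\<And>s t. s \<le> t \<Longrightarrow> sets (G s) \<subseteq> sets (G t)"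
    and adapted: "\<And>t. \<xi> t \<in> borel_measurable (G (Suc t))"
    and bounded: "\<And>t x. x \<in> space M \<Longrightarrow> \<bar>\<xi> t x\<bar> \<le> B"
    and mart: "\<And>t. AE x in M. real_cond_exp M (G t) (\<xi> t) x = 0"
    and second_moments: "summable (\<lambda>t. expectation (\<lambda>x. (\<xi> t x)\<^sup>2))"
  shows "AE x in M. summable (\<lambda>t. \<xi> t x)"
proof -
  define e where "e t = expectation (\<lambda>x. (\<xi> t x)\<^sup>2)" for t
  define r where "r n = suminf e - sum e {..<n}" for n
  have e: "summable e" "\<And>t. e t \<ge> 0" using second_moments unfolding e_def by auto
  have "(\<lambda>n. suminf e - sum e {..<n}) \<longlonglongrightarrow> suminf e - suminf e"
    by (intro tendsto_diff tendsto_const summable_LIMSEQ e)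
  then have r: "r \<longlonglongrightarrow> 0" by (simp add: r_def[abs_def])
  have \<xi>_M: "\<xi> t \<in> borel_measurable M" for t
    using measurable_from_subalg[OF sub adapted] .
  define E where "E c n = {x \<in> space M. \<exists>k\<ge>n. c \<le> \<bar>\<Sum>t=n..<k. \<xi> t x\<bar>}" for c n
  have E_sets: "E c n \<in> sets M" for c n
    unfolding E_def using \<xi>_M by measurable
  have prob_E: "prob (E c n) \<le> r n / c\<^sup>2" if "c > 0" for c n
  proof -
    define D where "D m = {x \<in> space M. \<exists>k\<in>{n..m}. c \<le> \<bar>\<Sum>t=n..<k. \<xi> t x\<bar>}" for m
    have "(\<lambda>m. prob (D m)) \<longlonglongrightarrow> prob (\<Union>m. D m)"
    proof (rule finite_Lim_measure_incseq)
      show "range D \<subseteq> events" unfolding D_def using \<xi>_M by auto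
      show "incseq D" unfolding D_def incseq_def by fastforce
    qed
    moreover have "(\<Union>m. D m) = E c n"
    proof (intro equalityI subsetI)
      fix x assume "x \<in> E c n"
      then obtain k where "x \<in> space M" "n \<le> k" "c \<le> \<bar>\<Sum>t=n..<k. \<xi> t x\<bar>" by (auto simp: E_def)
      then have "x \<in> D k" by (auto simp: D_def)
      then show "x \<in> (\<Union>m. D m)" by blast
    qed (auto simp: D_def E_def)
    moreover have "prob (D m) \<le> r n / c\<^sup>2" for m
    proof -
      have "prob (D m) \<le> (\<Sum>t=n..<m. e t) / c\<^sup>2"
        unfolding D_def e_def
        by (rule martingale_differences_maximal_inequality[where G=G, OF sub mono adapted bounded mart that])
      also have "(\<Sum>t=n..<m. e t) \<le> r n"
      proof (cases "n \<le> m")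
        case True
        have "sum e {..<n} + (\<Sum>t=n..<m. e t) = sum e {..<m}"
          using True by (simp add: lessThan_atLeast0 sum.atLeastLessThan_concat)
        also have "\<dots> \<le> suminf e" using e by (intro sum_le_suminf) auto
        finally show ?thesis by (simp add: r_def)
      next
        case False
        then show ?thesis using e sum_le_suminf[OF e(1), of "{..<n}"] by (simp add: r_def)
      qed
      finally show ?thesis by (simp add: divide_right_mono)
    qed
    ultimately show ?thesis by (metis LIMSEQ_le_const2)
  qed
  have "AE x in M. \<exists>n. x \<notin> E c n" if "c > 0" for c
  proof -
    have "prob (\<Inter>n. E c n) \<le> r n / c\<^sup>2" for n
      using finite_measure_mono[of "\<Inter>n. E c n" "E c n"] E_sets prob_E[OF that, of n] by fastforce
    moreover have "(\<lambda>n. r n / c\<^sup>2) \<longlonglongrightarrow> 0" using tendsto_divide[OF r tendsto_const, of "c\<^sup>2"] that by simp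
    ultimately have "prob (\<Inter>n. E c n) \<le> 0" by (metis LIMSEQ_le_const)
    then have "prob (\<Inter>n. E c n) = 0" using measure_nonneg[of M "\<Inter>n. E c n"] by linarith
    moreover have "(\<Inter>n. E c n) \<in> sets M" using E_sets by auto
    ultimately have "(\<Inter>n. E c n) \<in> null_sets M"
      by (simp add: null_sets_def emeasure_eq_measure)
    then have "AE x in M. x \<notin> (\<Inter>n. E c n)" by (rule AE_not_in)
    then show ?thesis by simp
  qed
  then have "AE x in M. \<forall>j. \<exists>n. x \<notin> E (inverse (real (Suc j))) n"
    unfolding AE_all_countable by simp
  then show ?thesis
  proof (rule AE_mp, intro AE_I2 impI)
    fix x assume x: "x \<in> space M" "\<forall>j. \<exists>n. x \<notin> E (inverse (real (Suc j))) n"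
    show "summable (\<lambda>t. \<xi> t x)"
      unfolding summable_Cauchy
    proof (intro allI impI)
      fix \<epsilon> :: real assume "\<epsilon> > 0"
      then obtain j where j: "inverse (real (Suc j)) < \<epsilon> / 2" using reals_Archimedean[of "\<epsilon> / 2"] by auto
      obtain n where "x \<notin> E (inverse (real (Suc j))) n" using x by blast
      then have n: "\<bar>\<Sum>t=n..<k. \<xi> t x\<bar> < \<epsilon> / 2" if "n \<le> k" for k
        using x(1) that j by (fastforce simp: E_def)
      show "\<exists>N. \<forall>m\<ge>N. \<forall>k. norm (\<Sum>t=m..<k. \<xi> t x) < \<epsilon>"
      proof (intro exI allI impI)
        fix m k assume m: "n \<le> m"
        show "norm (\<Sum>t=m..<k. \<xi> t x) < \<epsilon>"
        proof (cases "m \<le> k")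
          case True
          have "(\<Sum>t=n..<m. \<xi> t x) + (\<Sum>t=m..<k. \<xi> t x) = (\<Sum>t=n..<k. \<xi> t x)"
            using m True by (rule sum.atLeastLessThan_concat)
          then show ?thesis using n[of m] n[of k] m True by simp
        next
          case False
          then show ?thesis using \<open>\<epsilon> > 0\<close> by simp
        qed
      qed
    qed
  qed
qed

section \<open>Fresh randomness\<close>

text \<open>Independence makes the joint law of the identity and \<open>Y\<close> on \<open>G \<Otimes>\<^sub>M N\<close> a product measure, and Fubini's
  theorem integrates the fresh variable first.\<close>

lemma real_cond_exp_independent_centred:
  fixes f :: "'a \<times> 'b \<Rightarrow> real"
  assumes sub: "subalgebra M G" and Y: "Y \<in> M \<rightarrow>\<^sub>M N" and dist: "distr M N Y = N"
    and indep: "\<And>A B. A \<in> sets G \<Longrightarrow> B \<in> sets N \<Longrightarrow>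
      prob (A \<inter> (Y -` B \<inter> space M)) = prob A * prob (Y -` B \<inter> space M)"
    and f: "f \<in> borel_measurable (G \<Otimes>\<^sub>M N)"
      "\<And>x y. x \<in> space M \<Longrightarrow> y \<in> space N \<Longrightarrow> \<bar>f (x, y)\<bar> \<le> B"
    and centred: "\<And>x. x \<in> space M \<Longrightarrow> (\<integral>y. f (x, y) \<partial>N) = 0"
  shows "AE x in M. real_cond_exp M G (\<lambda>x. f (x, Y x)) x = 0"
proof -
  interpret S: finite_measure_subalgebra M G
    by unfold_locales (rule sub)
  have rv: "(\<lambda>x. x) \<in> M \<rightarrow>\<^sub>M G" "Y \<in> M \<rightarrow>\<^sub>M N"
    using measurable_from_subalg[OF sub measurable_ident] Y by (simp_all add: id_def)
  have pair: "(\<lambda>x. (x, Y x)) \<in> M \<rightarrow>\<^sub>M G \<Otimes>\<^sub>M N"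
    using rv by (rule measurable_Pair)
  have sp: "space G = space M" using sub by (simp add: subalgebra_def)
  interpret A: prob_space "distr M G (\<lambda>x. x)" by (rule prob_space_distr[OF rv(1)])
  interpret B: prob_space N using prob_space_distr[OF rv(2)] by (simp add: dist)
  interpret AB: pair_prob_space "distr M G (\<lambda>x. x)" N ..
  have law: "distr M G (\<lambda>x. x) \<Otimes>\<^sub>M N = distr M (G \<Otimes>\<^sub>M N) (\<lambda>x. (x, Y x))"
  proof (rule pair_measure_eqI)
    fix A B assume AB: "A \<in> sets (distr M G (\<lambda>x. x))" "B \<in> sets N"
    then have AM: "A \<in> sets M" "A \<subseteq> space M"
      using sub sets.sets_into_space[of A G] sp by (auto simp: subalgebra_def)
    have YB: "Y -` B \<inter> space M \<in> sets M" using rv(2) AB(2) by (rule measurable_sets)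
    have "emeasure (distr M (G \<Otimes>\<^sub>M N) (\<lambda>x. (x, Y x))) (A \<times> B) = emeasure M (A \<inter> (Y -` B \<inter> space M))"
      using AB AM by (subst emeasure_distr[OF pair]) (auto intro!: arg_cong[where f="emeasure M"])
    also have "\<dots> = emeasure M A * emeasure M (Y -` B \<inter> space M)"
      using indep[of A B] AB by (simp add: emeasure_eq_measure ennreal_mult)
    also have "emeasure M A = emeasure (distr M G (\<lambda>x. x)) A"
      using AB AM by (subst emeasure_distr[OF rv(1)]) (auto simp: Int_absorb2)
    also have "emeasure M (Y -` B \<inter> space M) = emeasure N B"
      using AB emeasure_distr[OF rv(2), of B] by (simp add: dist)
    finally show "emeasure (distr M G (\<lambda>x. x)) A * emeasure N B =
        emeasure (distr M (G \<Otimes>\<^sub>M N) (\<lambda>x. (x, Y x))) (A \<times> B)" by simp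
  qed (simp_all add: A.sigma_finite_measure_axioms B.sigma_finite_measure_axioms cong: sets_pair_measure_cong)
  have fY: "(\<lambda>x. f (x, Y x)) \<in> borel_measurable M"
    using measurable_compose[OF pair f(1)] by simp
  have Y: "Y x \<in> space N" if "x \<in> space M" for x
    using measurable_space[OF rv(2) that] .
  show ?thesis
  proof (rule S.real_cond_exp_charact)
    show "integrable M (\<lambda>x. f (x, Y x))"
      using fY f(2) Y by (intro integrable_const_bound[of _ B]) auto
    fix A assume A: "A \<in> sets G"
    have ind: "(\<lambda>z. indicator A (fst z) * f z) \<in> borel_measurable (G \<Otimes>\<^sub>M N)"
      using A f(1) by measurable
    have sets: "sets (distr M G (\<lambda>x. x) \<Otimes>\<^sub>M N) = sets (G \<Otimes>\<^sub>M N)"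
      by (intro sets_pair_measure_cong) auto
    have "(\<integral>x\<in>A. f (x, Y x) \<partial>M) = (\<integral>x. indicator A (fst (x, Y x)) * f (x, Y x) \<partial>M)"
      by (simp add: set_lebesgue_integral_def)
    also have "\<dots> = (\<integral>z. indicator A (fst z) * f z \<partial>distr M (G \<Otimes>\<^sub>M N) (\<lambda>x. (x, Y x)))"
      by (rule integral_distr[symmetric, OF pair ind])
    also have "\<dots> = (\<integral>z. indicator A (fst z) * f z \<partial>(distr M G (\<lambda>x. x) \<Otimes>\<^sub>M N))"
      by (simp add: law)
    also have "\<dots> = (\<integral>x. \<integral>y. indicator A (fst (x, y)) * f (x, y) \<partial>N \<partial>distr M G (\<lambda>x. x))"
    proof (rule AB.integral_fst'[symmetric])
      show "integrable (distr M G (\<lambda>x. x) \<Otimes>\<^sub>M N) (\<lambda>z. indicator A (fst z) * f z)"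
      proof (rule AB.P.integrable_const_bound[of _ "max B 0"])
        show "(\<lambda>z. indicator A (fst z) * f z) \<in> borel_measurable (distr M G (\<lambda>x. x) \<Otimes>\<^sub>M N)"
          using ind by (simp add: measurable_cong_sets[OF sets refl])
        show "AE z in distr M G (\<lambda>x. x) \<Otimes>\<^sub>M N. norm (indicator A (fst z) * f z) \<le> max B 0"
          using f(2) sp by (intro AE_I2) (auto simp: space_pair_measure indicator_def intro!: max.coboundedI1)
      qed
    qed
    also have "\<dots> = (\<integral>x. 0 \<partial>distr M G (\<lambda>x. x))"
      using centred sp by (intro Bochner_Integration.integral_cong) auto
    finally show "(\<integral>x\<in>A. f (x, Y x) \<partial>M) = (\<integral>x\<in>A. 0 \<partial>M)"
      by (simp add: set_lebesgue_integral_def)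
  qed auto
qed

text \<open>The sigma-algebra generated by the first \<open>t\<close> variables, as the initial one for their joint map into the
  product space.\<close>

definition past :: "(nat \<Rightarrow> 'b measure) \<Rightarrow> (nat \<Rightarrow> 'a \<Rightarrow> 'b) \<Rightarrow> nat \<Rightarrow> 'a measure" where
  "past N X t = vimage_algebra (space M) (\<lambda>x. restrict (\<lambda>k. X k x) {..<t}) (PiM {..<t} N)"

context
  fixes N :: "nat \<Rightarrow> 'b measure" and X :: "nat \<Rightarrow> 'a \<Rightarrow> 'b"
  assumes X: "indep_vars N X UNIV"
begin

lemma past_measurable_restrict:
  "(\<lambda>x. restrict (\<lambda>k. X k x) {..<t}) \<in> M \<rightarrow>\<^sub>M PiM {..<t} N"
  "(\<lambda>x. restrict (\<lambda>k. X k x) {..<t}) \<in> past N X t \<rightarrow>\<^sub>M PiM {..<t} N"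
proof -
  show *: "(\<lambda>x. restrict (\<lambda>k. X k x) {..<t}) \<in> M \<rightarrow>\<^sub>M PiM {..<t} N"
    using X by (intro measurable_restrict) (auto simp: indep_vars_def)
  show "(\<lambda>x. restrict (\<lambda>k. X k x) {..<t}) \<in> past N X t \<rightarrow>\<^sub>M PiM {..<t} N"
    unfolding past_def using measurable_space[OF *] by (intro measurable_vimage_algebra1) auto
qed

lemma space_past [simp]: "space (past N X t) = space M"
  by (simp add: past_def)

lemma subalgebra_past: "subalgebra M (past N X t)"
  unfolding subalgebra_def space_past
  unfolding past_def using sets_image_in_sets[OF refl past_measurable_restrict(1)] by blast

lemma measurable_past: "k < t \<Longrightarrow> X k \<in> past N X t \<rightarrow>\<^sub>M N k"
  using measurable_compose[OF past_measurable_restrict(2) measurable_component_singleton[of k "{..<t}" N]]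
  by simp

lemma past_mono: "s \<le> t \<Longrightarrow> sets (past N X s) \<subseteq> sets (past N X t)"
  unfolding past_def[of N X s]
  by (intro sets_image_in_sets measurable_restrict measurable_past) auto

lemma past_independent:
  assumes A: "A \<in> sets (past N X t)" and B: "B \<in> sets (N t)"
  shows "prob (A \<inter> (X t -` B \<inter> space M)) = prob A * prob (X t -` B \<inter> space M)"
proof -
  let ?P = "\<lambda>x. restrict (\<lambda>k. X k x) {..<t}" and ?X = "\<lambda>x. restrict (\<lambda>k. X k x) {t}"
  have "?P \<in> space M \<rightarrow> space (PiM {..<t} N)"
    using measurable_space[OF past_measurable_restrict(1)] by auto
  then obtain A' where A': "A' \<in> sets (PiM {..<t} N)" "A = ?P -` A' \<inter> space M"
    using A by (auto simp: past_def sets_vimage_algebra2)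
  define B' where "B' = (\<lambda>f. f t) -` B \<inter> space (PiM {t} N)"
  have B': "B' \<in> sets (PiM {t} N)"
    unfolding B'_def by (rule measurable_sets[OF measurable_component_singleton[of t "{t}" N] B]) simp
  have "X t \<in> M \<rightarrow>\<^sub>M N t" using X by (auto simp: indep_vars_def)
  then have XB: "?X -` B' \<inter> space M = X t -` B \<inter> space M"
    by (auto simp: B'_def space_PiM PiE_def extensional_def dest: measurable_space)
  have "indep_var (PiM {..<t} N) ?P (PiM {t} N) ?X"
    by (rule indep_var_restrict[OF X]) auto
  from indep_varD[OF this A'(1) B']
  have "prob ((\<lambda>x. (?P x, ?X x)) -` (A' \<times> B') \<inter> space M) = prob A * prob (X t -` B \<inter> space M)"
    by (simp only: A'(2) XB)
  moreover have "(\<lambda>x. (?P x, ?X x)) -` (A' \<times> B') \<inter> space M = A \<inter> (X t -` B \<inter> space M)"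
    unfolding A'(2) XB[symmetric] by auto
  ultimately show ?thesis by simp
qed

end

end

section \<open>Numerical series\<close>

text \<open>The difference of \<open>u\<close> and the partial sums of \<open>c\<close> decreases and is bounded below.\<close>

lemma quasi_monotone_convergent:
  fixes u c :: "nat \<Rightarrow> real"
  assumes "\<And>t. u (Suc t) \<le> u t + c t" "\<And>t. 0 \<le> u t" "summable c" "\<And>t. 0 \<le> c t"
  shows "convergent u"
proof -
  let ?v = "\<lambda>n. u n - sum c {..<n}"
  have "decseq ?v"
    using assms(1) by (intro decseq_SucI) (simp add: algebra_simps)
  moreover have "- suminf c \<le> ?v n" for n
    using sum_le_suminf[OF assms(3), of "{..<n}"] assms(2)[of n] assms(4) by auto
  ultimately obtain L where "?v \<longlonglongrightarrow> L"
    using decseq_convergent[of ?v "- suminf c"] by metis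
  then have "(\<lambda>n. ?v n + sum c {..<n}) \<longlonglongrightarrow> L + suminf c"
    using summable_LIMSEQ[OF assms(3)] by (rule tendsto_add)
  then show ?thesis by (auto simp: convergent_def)
qed

text \<open>Comparison with the integral of \<open>y powr -q\<close> over the intervals between consecutive denominators. The
  summand has the left end point in the denominator where the comparison needs the right one; as the
  increments are at most \<open>B\<close>, the two differ by a factor of at most \<open>1 + B / \<beta>\<close>.\<close>

lemma sum_increments_over_powr_le:
  fixes a :: "nat \<Rightarrow> real"
  assumes a: "\<And>t. 0 \<le> a t" "\<And>t. a t \<le> B" and "\<beta> > 0" "q > 1"
  shows "(\<Sum>t<n. a t / (\<beta> + (\<Sum>k<t. a k)) powr q) \<le> (1 + B / \<beta>) powr q / (q - 1) * \<beta> powr (1 - q)"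
proof -
  define y where "y t = \<beta> + (\<Sum>k<t. a k)" for t
  have y: "\<beta> \<le> y t" "y (Suc t) = y t + a t" for t
    using a by (auto simp: y_def sum_nonneg)
  have B: "B \<ge> 0" using a[of 0] by linarith
  define D where "D = (1 + B / \<beta>) powr q / (q - 1)"
  have D: "D \<ge> 0" using assms by (simp add: D_def)
  have step: "a t / y t powr q \<le> D * (y t powr (1 - q) - y (Suc t) powr (1 - q))" for t
  proof (cases "a t = 0")
    case True
    then show ?thesis using y(2)[of t] by simp
  next
    case False
    then have at: "a t > 0" using a(1)[of t] by simp
    have yt: "y t > 0" using y(1)[of t] assms by linarith
    have lt: "y t < y (Suc t)" using at y(2) by simp
    have deriv: "((\<lambda>z. z powr (1 - q)) has_real_derivative (1 - q) * z powr (- q)) (at z)"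
      if "y t \<le> z" for z
      using that yt by (auto intro!: derivative_eq_intros)
    obtain z where z: "y t < z" "z < y (Suc t)"
      "y (Suc t) powr (1 - q) - y t powr (1 - q) = (y (Suc t) - y t) * ((1 - q) * z powr (- q))"
      using MVT2[OF lt, of "\<lambda>z. z powr (1 - q)" "\<lambda>z. (1 - q) * z powr (- q)"] deriv by blast
    have "y (Suc t) \<le> (1 + B / \<beta>) * y t"
    proof -
      have "a t \<le> B / \<beta> * \<beta>" using a(2)[of t] assms by simp
      also have "\<dots> \<le> B / \<beta> * y t" using y(1) B assms by (intro mult_left_mono) auto
      finally show ?thesis using y(2)[of t] by (simp add: distrib_right)
    qed
    then have "z powr q \<le> ((1 + B / \<beta>) * y t) powr q"
      using z yt assms by (intro powr_mono2) auto
    also have "\<dots> = (1 + B / \<beta>) powr q * y t powr q"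
      by (rule powr_mult)
    finally have "1 / y t powr q \<le> (1 + B / \<beta>) powr q * z powr (- q)"
      using z yt by (simp add: powr_minus field_simps)
    then have "a t * (1 / y t powr q) \<le> a t * ((1 + B / \<beta>) powr q * z powr (- q))"
      using at by (intro mult_left_mono) auto
    also have "\<dots> = D * (a t * ((q - 1) * z powr (- q)))"
      using assms by (simp add: D_def)
    also have "a t * ((q - 1) * z powr (- q)) = y t powr (1 - q) - y (Suc t) powr (1 - q)"
      using z(3) y(2)[of t] by (simp add: algebra_simps)
    finally show ?thesis by simp
  qed
  have "(\<Sum>t<n. a t / y t powr q) \<le> (\<Sum>t<n. D * (y t powr (1 - q) - y (Suc t) powr (1 - q)))"
    by (intro sum_mono step)
  also have "\<dots> = D * (y 0 powr (1 - q) - y n powr (1 - q))"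
    by (simp only: sum_distrib_left[symmetric] sum_lessThan_telescope'[of "\<lambda>t. y t powr (1 - q)"])
  also have "\<dots> \<le> D * \<beta> powr (1 - q)"
    using D by (intro mult_left_mono) (auto simp: y_def)
  finally show ?thesis by (simp add: y_def D_def)
qed

text \<open>As \<open>q \<le> 1\<close>, the terms dominate a multiple of the harmonic series.\<close>

lemma not_summable_inverse_affine_powr:
  fixes \<alpha> \<beta> B q :: real
  assumes "\<alpha> > 0" "\<beta> > 0" "B \<ge> 0" "0 \<le> q" "q \<le> 1"
  shows "\<not> summable (\<lambda>t. \<alpha> / (\<beta> + real t * B) powr q)"
proof
  assume s: "summable (\<lambda>t. \<alpha> / (\<beta> + real t * B) powr q)"
  define E where "E = 1 + \<beta> + B"
  have E: "E > 0" using assms by (simp add: E_def)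
  have le: "\<alpha> / E * inverse (real (Suc t)) \<le> \<alpha> / (\<beta> + real t * B) powr q" for t
  proof -
    have p: "\<beta> + real t * B > 0" using assms by (simp add: add_pos_nonneg)
    have "(\<beta> + real t * B) powr q \<le> (1 + \<beta> + real t * B) powr q"
      using assms p by (intro powr_mono2) auto
    also have "\<dots> \<le> (1 + \<beta> + real t * B) powr 1"
      using assms p by (intro powr_mono) auto
    also have "\<dots> = 1 + \<beta> + real t * B" using p by simp
    also have "\<dots> \<le> E * real (Suc t)"
    proof -
      have "0 \<le> (1 + \<beta>) * real t + B" using assms by simp
      then show ?thesis by (simp add: E_def algebra_simps)
    qed
    finally have "(\<beta> + real t * B) powr q \<le> E * real (Suc t)" .
    then have "\<alpha> / (E * real (Suc t)) \<le> \<alpha> / (\<beta> + real t * B) powr q"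
      using assms p by (intro divide_left_mono mult_pos_pos) (auto simp: E)
    then show ?thesis by (simp add: field_simps)
  qed
  have "summable (\<lambda>t. \<alpha> / E * inverse (real (Suc t)))"
    using assms E by (intro summable_comparison_test'[OF s, of 0]) (use le in auto)
  then have "summable (\<lambda>t. inverse (real (Suc t)))"
    using assms E by (simp add: summable_cmult_iff)
  then show False
    using not_summable_harmonic[where 'a=real] summable_Suc_iff[of "\<lambda>t. inverse (real t)"]
    by (simp add: inverse_eq_divide)
qed

text \<open>In one step \<open>b\<^sup>3\<close> increases by at most \<open>3 b\<^sup>2 d + 3 b d\<^sup>2 + d\<^sup>3\<close>, which is summable: the first term because
  \<open>d\<close> is at most a multiple of the weight \<open>w\<close>, the others because \<open>b\<close> and \<open>d\<close> are bounded. Hence \<open>b\<close>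
  converges, and its limit is zero since otherwise \<open>w\<close> would be summable.\<close>

lemma tendsto_zero_of_weighted_squares:
  fixes b d w :: "nat \<Rightarrow> real"
  assumes b: "\<And>t. 0 \<le> b t" "\<And>t. b t \<le> B"
    and step: "\<And>t. b (Suc t) \<le> b t + d t" and d: "\<And>t. 0 \<le> d t" "\<And>t. d t \<le> E * w t"
    and w: "\<And>t. 0 \<le> w t" "\<And>t. w t \<le> 1"
    and sums: "summable (\<lambda>t. w t * (b t)\<^sup>2)" "summable (\<lambda>t. (d t)\<^sup>2)" "\<not> summable w"
  shows "b \<longlonglongrightarrow> 0"
proof -
  let ?c = "\<lambda>t. 3 * \<bar>E\<bar> * (w t * (b t)\<^sup>2) + (3 * B + \<bar>E\<bar>) * (d t)\<^sup>2"
  have B: "B \<ge> 0" using b[of 0] by linarith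
  have "convergent (\<lambda>t. (b t)^3)"
  proof (rule quasi_monotone_convergent)
    show "summable ?c" using sums by (intro summable_add summable_mult)
    show "0 \<le> ?c t" for t using w B by simp
    show "0 \<le> (b t)^3" for t using b by simp
    show "(b (Suc t))^3 \<le> (b t)^3 + ?c t" for t
    proof -
      have dE: "d t \<le> \<bar>E\<bar> * w t" using d(2)[of t] w(1)[of t]
        by (meson abs_ge_self mult_right_mono order_trans)
      then have dE': "d t \<le> \<bar>E\<bar>" using w(2)[of t] mult_left_mono[OF w(2)[of t], of "\<bar>E\<bar>"] by simp
      have "(b (Suc t))^3 \<le> (b t + d t)^3" using step b by (intro power_mono) auto
      also have "\<dots> = (b t)^3 + 3 * (d t * (b t)\<^sup>2) + 3 * (b t * (d t)\<^sup>2) + d t * (d t)\<^sup>2"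
        by (simp add: power2_eq_square power3_eq_cube algebra_simps)
      also have "\<dots> \<le> (b t)^3 + 3 * (\<bar>E\<bar> * w t * (b t)\<^sup>2) + 3 * (B * (d t)\<^sup>2) + \<bar>E\<bar> * (d t)\<^sup>2"
        using dE dE' b(2) by (intro add_mono mult_left_mono mult_right_mono) auto
      finally show ?thesis by (simp add: algebra_simps)
    qed
  qed
  then obtain l where l: "(\<lambda>t. (b t)^3) \<longlonglongrightarrow> l" by (auto simp: convergent_def)
  have "(\<lambda>t. root 3 ((b t)^3)) \<longlonglongrightarrow> root 3 l" using l by (rule tendsto_real_root)
  then have m: "b \<longlonglongrightarrow> root 3 l" using b by (simp add: real_root_power_cancel)
  have "root 3 l = 0"
  proof (rule ccontr)
    assume n: "root 3 l \<noteq> 0"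
    moreover have "root 3 l \<ge> 0" using LIMSEQ_le_const[OF m, of 0] b by blast
    ultimately have p: "root 3 l > 0" by simp
    then have "eventually (\<lambda>t. root 3 l / 2 < b t) sequentially"
      by (intro order_tendstoD(1)[OF m]) simp
    then have "eventually (\<lambda>t. norm (w t) \<le> (w t * (b t)\<^sup>2) * (4 / (root 3 l)\<^sup>2)) sequentially"
    proof eventually_elim
      case (elim t)
      then have "(root 3 l / 2)\<^sup>2 \<le> (b t)\<^sup>2" using p by (intro power_mono) auto
      then have "w t * (root 3 l / 2)\<^sup>2 \<le> w t * (b t)\<^sup>2" using w by (intro mult_left_mono) auto
      then show ?case using p w(1)[of t] by (simp add: field_simps power2_eq_square)
    qed
    then have "summable w"
      by (rule summable_comparison_test_ev) (intro summable_mult2 sums)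
    then show False using sums by simp
  qed
  then show ?thesis using m by simp
qed

section \<open>Stochastic gradient descent with adaptive step sizes\<close>

locale adaptive_gradient_descent = C1_function_with_retraction \<A> g F R + P: prob_space P
  for \<A> :: "('m::{t2_space, second_countable_topology}, 'e::euclidean_space) chart set"
    and g :: "'m \<Rightarrow> 'e \<Rightarrow> 'e \<Rightarrow> real" and F :: "'m \<Rightarrow> real" and R :: "'m \<times> 'e \<Rightarrow> 'm"
    and P :: "'p measure" +
  fixes K :: "'m set"
    and A :: real
    and M :: "nat \<Rightarrow> 'w measure"
    and H :: "nat \<Rightarrow> 'm \<times> 'w \<Rightarrow> 'm \<times> 'e"
    and \<omega> :: "nat \<Rightarrow> 'p \<Rightarrow> 'w"
    and x\<^sub>0 :: 'm
    and \<alpha> \<beta> \<epsilon> :: real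
    and x :: "nat \<Rightarrow> 'p \<Rightarrow> 'm"
    and \<eta> :: "nat \<Rightarrow> 'p \<Rightarrow> real"
  assumes K: "compact K"
    and A: "A > 0" "R_Lipschitz \<A> g R (rgrad \<A> g F) K A"
    and M: "\<And>t. prob_space (M t)"
    and field: "\<And>t w. w \<in> space (M t) \<Longrightarrow> vector_field (\<lambda>y. H t (y, w))"
    and finite_or_measurable:
      "(\<forall>t. finite (space (M t)) \<and> sets (M t) = Pow (space (M t))) \<or>
       (\<forall>t. H t \<in> measurable (borel \<Otimes>\<^sub>M M t) (atlas_borel (tangent_atlas \<A>)))"
    and unbiased: "\<And>t y. has_bochner_integral (M t) (\<lambda>w. snd (H t (y, w))) (rgrad \<A> g F y)"
    and bounded: "\<And>t y w. y \<in> K \<Longrightarrow> w \<in> space (M t) \<Longrightarrow> rnorm g y (snd (H t (y, w))) \<le> A"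
    and indep: "P.indep_vars M \<omega> UNIV"
    and distribution: "\<And>t. distr P (M t) (\<omega> t) = M t"
    and parameters: "\<alpha> > 0" "\<beta> > 0" "0 < \<epsilon>" "\<epsilon> \<le> 1/2" "\<alpha> \<le> \<beta> powr (1/2 + \<epsilon>)"
    and start: "\<And>p. p \<in> space P \<Longrightarrow> x 0 p = x\<^sub>0"
    and step: "\<And>t p. p \<in> space P \<Longrightarrow>
      x (Suc t) p = R (x t p, - (\<eta> t p *\<^sub>R snd (H t (x t p, \<omega> t p))))"
    and rate: "\<And>t p. p \<in> space P \<Longrightarrow>
      \<eta> t p = \<alpha> / (\<beta> + (\<Sum>k<t. (rnorm g (x k p) (snd (H k (x k p, \<omega> k p))))\<^sup>2)) powr (1/2 + \<epsilon>)"
    and stays: "\<And>t p. p \<in> space P \<Longrightarrow> x t p \<in> K"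
begin

abbreviation h :: "nat \<Rightarrow> 'p \<Rightarrow> 'e" where
  "h t p \<equiv> snd (H t (x t p, \<omega> t p))"

abbreviation a :: "nat \<Rightarrow> 'p \<Rightarrow> real" where
  "a t p \<equiv> (rnorm g (x t p) (h t p))\<^sup>2"

abbreviation b :: "nat \<Rightarrow> 'p \<Rightarrow> real" where
  "b t p \<equiv> rnorm g (x t p) (grad (x t p))"

abbreviation \<F> :: "nat \<Rightarrow> 'p measure" where
  "\<F> \<equiv> P.past M \<omega>"

subsection \<open>Bounds that hold on every path\<close>

lemma omega_measurable: "\<omega> t \<in> P \<rightarrow>\<^sub>M M t"
  using indep by (auto simp: P.indep_vars_def)

lemma omega_space: "p \<in> space P \<Longrightarrow> \<omega> t p \<in> space (M t)"
  using measurable_space[OF omega_measurable] .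

lemma integral_dF: "has_bochner_integral (M t) (\<lambda>w. mdiff \<A> std_atlas F y (snd (H t (y, w)))) ((rnorm g y (grad y))\<^sup>2)"
proof -
  have "bounded_linear (mdiff \<A> std_atlas F y)"
    using mdiff_F_linear linear_conv_bounded_linear by blast
  from has_bochner_integral_bounded_linear[OF this unbiased, of t y] show ?thesis
    by (simp add: rnorm_square g_grad)
qed

lemma abs_mdiff_le: "\<bar>mdiff \<A> std_atlas F y v\<bar> \<le> rnorm g y (grad y) * rnorm g y v"
  using g_Cauchy_Schwarz[of y "grad y" v] by (simp add: g_grad)

text \<open>The gradient is the average of samples of length at most \<open>A\<close>.\<close>

lemma rnorm_grad_le:
  assumes y: "y \<in> K"
  shows "rnorm g y (grad y) \<le> A"
proof -
  interpret M0: prob_space "M 0" by (rule M)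
  let ?n = "rnorm g y (grad y)"
  have n: "?n \<ge> 0" by (rule rnorm_nonneg)
  have "?n\<^sup>2 = (\<integral>w. mdiff \<A> std_atlas F y (snd (H 0 (y, w))) \<partial>M 0)"
    using has_bochner_integral_integral_eq[OF integral_dF] by simp
  also have "\<dots> \<le> (\<integral>w. ?n * A \<partial>M 0)"
  proof (rule integral_mono)
    show "integrable (M 0) (\<lambda>w. mdiff \<A> std_atlas F y (snd (H 0 (y, w))))"
      using integral_dF by (rule integrable.intros)
    show "mdiff \<A> std_atlas F y (snd (H 0 (y, w))) \<le> ?n * A" if "w \<in> space (M 0)" for w
      using abs_mdiff_le[of y "snd (H 0 (y, w))"] mult_left_mono[OF bounded[OF y that] n] by linarith
  qed simp
  also have "\<dots> = ?n * A" by (simp add: M0.prob_space)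
  finally have "?n * ?n \<le> ?n * A" by (simp add: power2_eq_square)
  then show ?thesis using n A by (cases "?n = 0") auto
qed

context
  fixes p assumes p: "p \<in> space P"
begin

lemma b_bounds: "0 \<le> b t p" "b t p \<le> A"
  using rnorm_nonneg rnorm_grad_le[OF stays[OF p]] by auto

lemma h_bounds: "0 \<le> rnorm g (x t p) (h t p)" "rnorm g (x t p) (h t p) \<le> A" "a t p \<le> A\<^sup>2"
proof -
  show "0 \<le> rnorm g (x t p) (h t p)" "rnorm g (x t p) (h t p) \<le> A"
    using rnorm_nonneg bounded[OF stays[OF p] omega_space[OF p]] by auto
  then show "a t p \<le> A\<^sup>2" by (intro power_mono)
qed

text \<open>The condition \<open>\<alpha> \<le> \<beta> powr (1/2 + \<epsilon>)\<close> keeps the step sizes at most 1, so that every step stays within the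
  radius \<open>A\<close> of the Lipschitz condition.\<close>

lemma eta_bounds: "0 < \<eta> t p" "\<eta> t p \<le> 1"
proof -
  let ?S = "\<beta> + (\<Sum>k<t. a k p)"
  have S: "\<beta> \<le> ?S" by (simp add: sum_nonneg)
  then have "\<beta> powr (1/2 + \<epsilon>) \<le> ?S powr (1/2 + \<epsilon>)"
    using parameters by (intro powr_mono2) auto
  then have "\<alpha> \<le> ?S powr (1/2 + \<epsilon>)" using parameters by linarith
  moreover have "0 < ?S powr (1/2 + \<epsilon>)" using S parameters by auto
  ultimately show "0 < \<eta> t p" "\<eta> t p \<le> 1"
    using parameters by (simp_all add: rate[OF p] field_simps)
qed

lemma step_length: "rnorm g (x t p) (- (\<eta> t p *\<^sub>R h t p)) = \<eta> t p * rnorm g (x t p) (h t p)"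
    "\<eta> t p * rnorm g (x t p) (h t p) \<le> A"
proof -
  show "rnorm g (x t p) (- (\<eta> t p *\<^sub>R h t p)) = \<eta> t p * rnorm g (x t p) (h t p)"
    using eta_bounds[of t] by (simp add: rnorm_minus rnorm_scaleR)
  have "\<eta> t p * rnorm g (x t p) (h t p) \<le> 1 * A"
    using eta_bounds[of t] h_bounds[of t] by (intro mult_mono) auto
  then show "\<eta> t p * rnorm g (x t p) (h t p) \<le> A" by simp
qed

lemma sum_square_steps_le:
  "(\<Sum>t<n. (\<eta> t p)\<^sup>2 * a t p) \<le> \<alpha>\<^sup>2 * ((1 + A\<^sup>2 / \<beta>) powr (1 + 2 * \<epsilon>) / (2 * \<epsilon>) * \<beta> powr (- (2 * \<epsilon>)))"
proof -
  have eq: "(\<eta> t p)\<^sup>2 * a t p = \<alpha>\<^sup>2 * (a t p / (\<beta> + (\<Sum>k<t. a k p)) powr (1 + 2 * \<epsilon>))" for t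
  proof -
    have "((\<beta> + (\<Sum>k<t. a k p)) powr (1/2 + \<epsilon>))\<^sup>2 = (\<beta> + (\<Sum>k<t. a k p)) powr (1 + 2 * \<epsilon>)"
      by (simp add: power2_eq_square powr_add[symmetric])
    then show ?thesis by (simp add: rate[OF p] power_divide)
  qed
  have "(\<Sum>t<n. a t p / (\<beta> + (\<Sum>k<t. a k p)) powr (1 + 2 * \<epsilon>)) \<le>
      (1 + A\<^sup>2 / \<beta>) powr (1 + 2 * \<epsilon>) / (1 + 2 * \<epsilon> - 1) * \<beta> powr (1 - (1 + 2 * \<epsilon>))"
    using parameters h_bounds by (intro sum_increments_over_powr_le) auto
  then show ?thesis
    unfolding eq sum_distrib_left[symmetric] by (intro mult_left_mono) auto
qed

lemma summable_square_steps: "summable (\<lambda>t. (\<eta> t p)\<^sup>2 * a t p)"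
  using sum_square_steps_le by (intro summableI_nonneg_bounded) auto

text \<open>The accumulated squared lengths grow at most linearly in \<open>t\<close>, and the exponent is at most 1.\<close>

lemma not_summable_eta: "\<not> summable (\<lambda>t. \<eta> t p)"
proof
  assume s: "summable (\<lambda>t. \<eta> t p)"
  have "summable (\<lambda>t. \<alpha> / (\<beta> + real t * A\<^sup>2) powr (1/2 + \<epsilon>))"
  proof (rule summable_comparison_test'[OF s, of 0])
    fix t
    have "(\<Sum>k<t. a k p) \<le> (\<Sum>k<t. A\<^sup>2)" using h_bounds by (intro sum_mono) auto
    then have "(\<beta> + (\<Sum>k<t. a k p)) powr (1/2 + \<epsilon>) \<le> (\<beta> + real t * A\<^sup>2) powr (1/2 + \<epsilon>)"
      using parameters by (intro powr_mono2) (auto simp: sum_nonneg)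
    moreover have "0 < (\<beta> + (\<Sum>k<t. a k p)) powr (1/2 + \<epsilon>)"
      using parameters sum_nonneg[of "{..<t}" "\<lambda>k. a k p"] by auto
    ultimately show "norm (\<alpha> / (\<beta> + real t * A\<^sup>2) powr (1/2 + \<epsilon>)) \<le> \<eta> t p"
      using parameters by (simp add: rate[OF p] frac_le)
  qed
  then show False
    using not_summable_inverse_affine_powr[of \<alpha> \<beta> "A\<^sup>2" "1/2 + \<epsilon>"] parameters by simp
qed

end

subsection \<open>Measurability\<close>

lemma eta_measurableI:
  assumes "(\<lambda>p. \<Sum>k<t. a k p) \<in> borel_measurable (\<F> t)"
  shows "\<eta> t \<in> borel_measurable (\<F> t)"
proof -
  have "(\<lambda>p. \<alpha> / (\<beta> + (\<Sum>k<t. a k p)) powr (1/2 + \<epsilon>)) \<in> borel_measurable (\<F> t)"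
    using assms by measurable
  then show ?thesis
    by (rule measurable_cong[THEN iffD1, rotated]) (simp add: rate P.space_past[OF indep])
qed

lemma past_Suc_ident: "(\<lambda>p. p) \<in> \<F> (Suc t) \<rightarrow>\<^sub>M \<F> t"
  using P.past_mono[OF indep, of t "Suc t"] by (auto intro!: measurableI simp: P.space_past[OF indep])

text \<open>With finite sample spaces every \<open>x t\<close> takes finitely many values, on events determined by the past, and
  simple functions may be composed with arbitrary functions such as \<open>H\<close>.\<close>

lemma process_measurable_finite:
  assumes fin: "\<And>t. finite (space (M t)) \<and> sets (M t) = Pow (space (M t))"
  shows "simple_function (\<F> t) (x t)" "simple_function (\<F> t) (\<lambda>p. \<Sum>k<t. a k p)"
proof -
  have id: "simple_function (M t) (\<lambda>w. w)" for t
    using fin[of t] by (auto simp: simple_function_def)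
  have \<omega>: "simple_function (\<F> (Suc t)) (\<omega> t)" for t
    by (rule simple_function_comp[OF P.measurable_past[OF indep] id]) simp
  have up: "simple_function (\<F> (Suc t)) f" if "simple_function (\<F> t) f" for t and f :: "'p \<Rightarrow> 'z"
    by (rule simple_function_comp[OF past_Suc_ident that])
  have "simple_function (\<F> t) (x t) \<and> simple_function (\<F> t) (\<lambda>p. \<Sum>k<t. a k p)"
  proof (induction t)
    case 0
    have "simple_function (\<F> 0) (x 0) \<longleftrightarrow> simple_function (\<F> 0) (\<lambda>p. x\<^sub>0)"
      by (rule simple_function_cong) (simp add: start P.space_past[OF indep])
    then show ?case by simp
  next
    case (Suc t)
    let ?S = "\<lambda>p. \<Sum>k<t. a k p"
    have z: "simple_function (\<F> (Suc t)) (\<lambda>p. (x t p, ?S p, \<omega> t p))"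
      by (rule simple_function_Pair[OF up[OF conjunct1[OF Suc]] simple_function_Pair[OF up[OF conjunct2[OF Suc]] \<omega>]])
    have "simple_function (\<F> (Suc t)) (\<lambda>p. (\<lambda>(y, s, w).
        R (y, - ((\<alpha> / (\<beta> + s) powr (1/2 + \<epsilon>)) *\<^sub>R snd (H t (y, w))))) (x t p, ?S p, \<omega> t p))"
      by (rule simple_function_compose1[OF z])
    then have "simple_function (\<F> (Suc t)) (x (Suc t))"
      by (rule simple_function_cong[THEN iffD1, rotated]) (simp add: step rate P.space_past[OF indep])
    moreover have "simple_function (\<F> (Suc t)) (\<lambda>p. (\<lambda>(y, s, w).
        s + (rnorm g y (snd (H t (y, w))))\<^sup>2) (x t p, ?S p, \<omega> t p))"
      by (rule simple_function_compose1[OF z])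
    ultimately show ?case by simp
  qed
  then show "simple_function (\<F> t) (x t)" "simple_function (\<F> t) (\<lambda>p. \<Sum>k<t. a k p)" by auto
qed

lemma process_measurable_borel:
  assumes H: "\<And>t. H t \<in> measurable (borel \<Otimes>\<^sub>M M t) (atlas_borel (tangent_atlas \<A>))"
  shows "x t \<in> \<F> t \<rightarrow>\<^sub>M borel" "(\<lambda>p. \<Sum>k<t. a k p) \<in> borel_measurable (\<F> t)"
proof -
  have "x t \<in> \<F> t \<rightarrow>\<^sub>M borel \<and> (\<lambda>p. \<Sum>k<t. a k p) \<in> borel_measurable (\<F> t)"
  proof (induction t)
    case 0
    have "x 0 \<in> \<F> 0 \<rightarrow>\<^sub>M borel \<longleftrightarrow> (\<lambda>p. x\<^sub>0) \<in> \<F> 0 \<rightarrow>\<^sub>M borel"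
      by (rule measurable_cong) (simp add: start P.space_past[OF indep])
    then show ?case by simp
  next
    case (Suc t)
    have x: "x t \<in> \<F> (Suc t) \<rightarrow>\<^sub>M borel"
      using measurable_compose[OF past_Suc_ident] Suc by auto
    have S: "(\<lambda>p. \<Sum>k<t. a k p) \<in> borel_measurable (\<F> (Suc t))"
      using measurable_compose[OF past_Suc_ident] Suc by auto
    have \<eta>: "\<eta> t \<in> borel_measurable (\<F> (Suc t))"
      using measurable_compose[OF past_Suc_ident eta_measurableI] Suc by auto
    have Hx: "(\<lambda>p. H t (x t p, \<omega> t p)) \<in> \<F> (Suc t) \<rightarrow>\<^sub>M atlas_borel (tangent_atlas \<A>)"
      by (rule measurable_compose[OF measurable_Pair[OF x P.measurable_past[OF indep]] H]) simp
    have fst: "fst (H t (x t p, \<omega> t p)) = x t p" if "p \<in> space P" for p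
      using field[OF omega_space[OF that]] by (simp add: vector_field_def)
    have "(\<lambda>p. (rnorm g (fst (H t (x t p, \<omega> t p))) (h t p))\<^sup>2) \<in> borel_measurable (\<F> (Suc t))"
      by (rule measurable_rnorm_square[OF Hx])
    then have a: "a t \<in> borel_measurable (\<F> (Suc t))"
      by (rule measurable_cong[THEN iffD1, rotated]) (simp add: fst P.space_past[OF indep])
    have "(\<lambda>p. - \<eta> t p) \<in> borel_measurable (\<F> (Suc t))" using \<eta> by simp
    from measurable_retraction_step[OF Hx this]
    have "x (Suc t) \<in> \<F> (Suc t) \<rightarrow>\<^sub>M borel"
      by (rule measurable_cong[THEN iffD1, rotated]) (simp add: fst step P.space_past[OF indep])
    moreover have "(\<lambda>p. (\<Sum>k<t. a k p) + a t p) \<in> borel_measurable (\<F> (Suc t))"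
      using S a by (rule borel_measurable_add)
    ultimately show ?case by simp
  qed
  then show "x t \<in> \<F> t \<rightarrow>\<^sub>M borel" "(\<lambda>p. \<Sum>k<t. a k p) \<in> borel_measurable (\<F> t)" by auto
qed

lemma eta_measurable: "\<eta> t \<in> borel_measurable (\<F> t)"
  using finite_or_measurable
proof
  assume "\<forall>t. finite (space (M t)) \<and> sets (M t) = Pow (space (M t))"
  then show ?thesis
    using process_measurable_finite(2) by (intro eta_measurableI borel_measurable_simple_function) auto
next
  assume "\<forall>t. H t \<in> measurable (borel \<Otimes>\<^sub>M M t) (atlas_borel (tangent_atlas \<A>))"
  then show ?thesis
    using process_measurable_borel(2) by (intro eta_measurableI) auto
qed

lemma dF_measurable:
  "(\<lambda>z. mdiff \<A> std_atlas F (x t (fst z)) (snd (H t (x t (fst z), snd z)))) \<in> borel_measurable (\<F> t \<Otimes>\<^sub>M M t)"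
  using finite_or_measurable
proof
  assume fin: "\<forall>t. finite (space (M t)) \<and> sets (M t) = Pow (space (M t))"
  have "simple_function (\<F> t \<Otimes>\<^sub>M M t) (\<lambda>z. x t (fst z))"
    using fin process_measurable_finite(1) by (intro simple_function_comp[OF measurable_fst]) auto
  moreover have "simple_function (\<F> t \<Otimes>\<^sub>M M t) snd"
  proof -
    have "simple_function (M t) (\<lambda>w. w)"
      using fin by (auto simp: simple_function_def)
    then show ?thesis by (rule simple_function_comp[OF measurable_snd])
  qed
  ultimately have "simple_function (\<F> t \<Otimes>\<^sub>M M t)
      (\<lambda>z. (\<lambda>y w. mdiff \<A> std_atlas F y (snd (H t (y, w)))) (x t (fst z)) (snd z))"
    by (rule simple_function_compose2)
  then show ?thesis by (rule borel_measurable_simple_function)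
next
  assume H: "\<forall>t. H t \<in> measurable (borel \<Otimes>\<^sub>M M t) (atlas_borel (tangent_atlas \<A>))"
  have "x t \<in> \<F> t \<rightarrow>\<^sub>M borel" using H process_measurable_borel(1) by auto
  then have "(\<lambda>z. (x t (fst z), snd z)) \<in> \<F> t \<Otimes>\<^sub>M M t \<rightarrow>\<^sub>M borel \<Otimes>\<^sub>M M t"
    by (intro measurable_Pair measurable_compose[OF measurable_fst] measurable_snd)
  then have "(\<lambda>z. H t (x t (fst z), snd z)) \<in> \<F> t \<Otimes>\<^sub>M M t \<rightarrow>\<^sub>M atlas_borel (tangent_atlas \<A>)"
    using H measurable_compose by blast
  from measurable_mdiff[OF this] show ?thesis
  proof (rule measurable_cong[THEN iffD1, rotated])
    fix z assume "z \<in> space (\<F> t \<Otimes>\<^sub>M M t)"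
    then have "snd z \<in> space (M t)" by (auto simp: space_pair_measure)
    then show "mdiff \<A> std_atlas F (fst (H t (x t (fst z), snd z))) (snd (H t (x t (fst z), snd z))) =
        mdiff \<A> std_atlas F (x t (fst z)) (snd (H t (x t (fst z), snd z)))"
      using field by (simp add: vector_field_def)
  qed
qed

text \<open>The squared gradient norm is the average of \<open>dF\<close> over the fresh sample, so its measurability
  follows by Fubini.\<close>

lemma b_square_measurable: "(\<lambda>p. (b t p)\<^sup>2) \<in> borel_measurable (\<F> t)"
proof -
  interpret Mt: prob_space "M t" by (rule M)
  have "(\<lambda>(p, w). mdiff \<A> std_atlas F (x t p) (snd (H t (x t p, w)))) \<in> borel_measurable (\<F> t \<Otimes>\<^sub>M M t)"
    using dF_measurable[of t] by (simp add: case_prod_beta')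
  then have "(\<lambda>p. \<integral>w. mdiff \<A> std_atlas F (x t p) (snd (H t (x t p, w))) \<partial>M t) \<in> borel_measurable (\<F> t)"
    by (rule Mt.borel_measurable_lebesgue_integral)
  then show ?thesis
    by (simp add: has_bochner_integral_integral_eq[OF integral_dF])
qed

subsection \<open>The noise is a convergent martingale\<close>

text \<open>The fresh sample \<open>w\<close> is kept apart from the path \<open>p\<close>, which enters through its past only, so that the
  noise can be averaged over \<open>w\<close>.\<close>

definition noise :: "nat \<Rightarrow> 'p \<times> 'w \<Rightarrow> real" where
  "noise t z = \<eta> t (fst z) * ((b t (fst z))\<^sup>2 - mdiff \<A> std_atlas F (x t (fst z)) (snd (H t (x t (fst z), snd z))))"

abbreviation \<xi> :: "nat \<Rightarrow> 'p \<Rightarrow> real" where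
  "\<xi> t p \<equiv> noise t (p, \<omega> t p)"

lemma noise_measurable: "noise t \<in> borel_measurable (\<F> t \<Otimes>\<^sub>M M t)"
  unfolding noise_def[abs_def]
  by (intro borel_measurable_times borel_measurable_diff dF_measurable
      measurable_compose[OF measurable_fst eta_measurable] measurable_compose[OF measurable_fst b_square_measurable])

lemma dF_bound:
  assumes "p \<in> space P" "w \<in> space (M t)"
  shows "\<bar>mdiff \<A> std_atlas F (x t p) (snd (H t (x t p, w)))\<bar> \<le> A * rnorm g (x t p) (snd (H t (x t p, w)))"
    "\<bar>mdiff \<A> std_atlas F (x t p) (snd (H t (x t p, w)))\<bar> \<le> A\<^sup>2"
proof -
  have "\<bar>mdiff \<A> std_atlas F (x t p) (snd (H t (x t p, w)))\<bar> \<le> b t p * rnorm g (x t p) (snd (H t (x t p, w)))"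
    by (rule abs_mdiff_le)
  also have "\<dots> \<le> A * rnorm g (x t p) (snd (H t (x t p, w)))"
    using b_bounds[OF assms(1)] rnorm_nonneg by (intro mult_right_mono)
  finally show 1: "\<bar>mdiff \<A> std_atlas F (x t p) (snd (H t (x t p, w)))\<bar> \<le> A * rnorm g (x t p) (snd (H t (x t p, w)))" .
  also have "\<dots> \<le> A * A"
    using bounded[OF stays[OF assms(1)] assms(2)] A(1) by (intro mult_left_mono) auto
  finally show "\<bar>mdiff \<A> std_atlas F (x t p) (snd (H t (x t p, w)))\<bar> \<le> A\<^sup>2"
    by (simp add: power2_eq_square)
qed

lemma noise_bound:
  assumes "p \<in> space P" "w \<in> space (M t)"
  shows "\<bar>noise t (p, w)\<bar> \<le> 2 * A\<^sup>2"
proof -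
  have "(b t p)\<^sup>2 \<le> A\<^sup>2" using b_bounds[OF assms(1)] by (intro power_mono)
  then have "\<bar>(b t p)\<^sup>2 - mdiff \<A> std_atlas F (x t p) (snd (H t (x t p, w)))\<bar> \<le> 2 * A\<^sup>2"
    using dF_bound(2)[OF assms] zero_le_power2[of "b t p"] by linarith
  then have "\<eta> t p * \<bar>(b t p)\<^sup>2 - mdiff \<A> std_atlas F (x t p) (snd (H t (x t p, w)))\<bar> \<le> 1 * (2 * A\<^sup>2)"
    using eta_bounds[OF assms(1), of t] by (intro mult_mono) auto
  then show ?thesis
    using eta_bounds[OF assms(1), of t] by (simp add: noise_def abs_mult)
qed

lemma xi_adapted: "\<xi> t \<in> borel_measurable (\<F> (Suc t))"
  by (rule measurable_compose[OF measurable_Pair[OF past_Suc_ident P.measurable_past[OF indep]] noise_measurable]) simp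

lemma xi_centred: "AE p in P. real_cond_exp P (\<F> t) (\<xi> t) p = 0"
proof (rule P.real_cond_exp_independent_centred[where f="noise t"])
  show "subalgebra P (\<F> t)" by (rule P.subalgebra_past[OF indep])
  show "\<omega> t \<in> P \<rightarrow>\<^sub>M M t" by (rule omega_measurable)
  show "distr P (M t) (\<omega> t) = M t" by (rule distribution)
  show "noise t \<in> borel_measurable (\<F> t \<Otimes>\<^sub>M M t)" by (rule noise_measurable)
  show "\<bar>noise t (p, w)\<bar> \<le> 2 * A\<^sup>2" if "p \<in> space P" "w \<in> space (M t)" for p w
    using that by (rule noise_bound)
  show "P.prob (U \<inter> (\<omega> t -` B \<inter> space P)) = P.prob U * P.prob (\<omega> t -` B \<inter> space P)"
    if "U \<in> sets (\<F> t)" "B \<in> sets (M t)" for U B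
    using that by (rule P.past_independent[OF indep])
  show "(\<integral>w. noise t (p, w) \<partial>M t) = 0" for p
  proof -
    interpret Mt: prob_space "M t" by (rule M)
    have "(\<integral>w. (b t p)\<^sup>2 - mdiff \<A> std_atlas F (x t p) (snd (H t (x t p, w))) \<partial>M t) = 0"
      using integral_dF[of t "x t p"]
      by (subst Bochner_Integration.integral_diff)
        (auto simp: has_bochner_integral_iff Mt.prob_space)
    then show ?thesis by (simp add: noise_def)
  qed
qed

text \<open>Centring does not increase the second moment, so that of the noise is at most that of \<open>\<eta> dF(h)\<close>, which
  the square summability of the steps controls.\<close>

lemma xi_second_moments: "summable (\<lambda>t. P.expectation (\<lambda>p. (\<xi> t p)\<^sup>2))"
proof -
  define \<psi> where "\<psi> t p = \<eta> t p * mdiff \<A> std_atlas F (x t p) (h t p)" for t p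
  define \<phi> where "\<phi> t p = \<eta> t p * (b t p)\<^sup>2" for t p
  have fromF: "f \<in> borel_measurable P" if "f \<in> borel_measurable (\<F> t)" for f :: "'p \<Rightarrow> real" and t
    using measurable_from_subalg[OF P.subalgebra_past[OF indep] that] .
  have \<phi>_F: "\<phi> t \<in> borel_measurable (\<F> t)" for t
    unfolding \<phi>_def[abs_def] by (intro borel_measurable_times eta_measurable b_square_measurable)
  have \<xi>: "\<xi> t p = \<phi> t p - \<psi> t p" for t p
    by (simp add: noise_def \<phi>_def \<psi>_def algebra_simps)
  have \<xi>_M: "\<xi> t \<in> borel_measurable P" for t by (rule fromF[OF xi_adapted])
  have \<psi>_M: "\<psi> t \<in> borel_measurable P" for t
  proof -
    have "(\<lambda>p. \<phi> t p - \<xi> t p) \<in> borel_measurable P"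
      using fromF[OF \<phi>_F] \<xi>_M by (rule borel_measurable_diff)
    then show ?thesis by (simp add: \<xi>)
  qed
  have \<phi>_bound: "\<bar>\<phi> t p\<bar> \<le> A\<^sup>2" if "p \<in> space P" for t p
  proof -
    have "\<eta> t p * (b t p)\<^sup>2 \<le> 1 * A\<^sup>2"
      using eta_bounds[OF that, of t] b_bounds[OF that, of t] by (intro mult_mono power_mono) auto
    then show ?thesis using eta_bounds[OF that, of t] by (simp add: \<phi>_def abs_mult)
  qed
  have \<xi>_bound: "\<bar>\<xi> t p\<bar> \<le> 2 * A\<^sup>2" if "p \<in> space P" for t p
    using noise_bound[OF that omega_space[OF that]] .
  have \<psi>_bound: "(\<psi> t p)\<^sup>2 \<le> A\<^sup>2 * ((\<eta> t p)\<^sup>2 * a t p)" "\<bar>\<psi> t p\<bar> \<le> 3 * A\<^sup>2" if "p \<in> space P" for t p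
  proof -
    have "(mdiff \<A> std_atlas F (x t p) (h t p))\<^sup>2 \<le> (A * rnorm g (x t p) (h t p))\<^sup>2"
      using dF_bound(1)[OF that omega_space[OF that]] power_mono[of "\<bar>_\<bar>" _ 2] by fastforce
    then have "(\<eta> t p)\<^sup>2 * (mdiff \<A> std_atlas F (x t p) (h t p))\<^sup>2 \<le> (\<eta> t p)\<^sup>2 * (A * rnorm g (x t p) (h t p))\<^sup>2"
      by (intro mult_left_mono) auto
    then show "(\<psi> t p)\<^sup>2 \<le> A\<^sup>2 * ((\<eta> t p)\<^sup>2 * a t p)"
      by (simp add: \<psi>_def power_mult_distrib mult.left_commute)
    show "\<bar>\<psi> t p\<bar> \<le> 3 * A\<^sup>2"
      using \<phi>_bound[OF that, of t] \<xi>_bound[OF that, of t] by (simp add: \<xi>)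
  qed
  have int: "integrable P f" if "f \<in> borel_measurable P" "\<And>p. p \<in> space P \<Longrightarrow> \<bar>f p\<bar> \<le> C" for f and C :: real
    using that by (intro P.integrable_const_bound[of _ C]) auto
  have i\<psi>: "integrable P (\<lambda>p. (\<psi> t p)\<^sup>2)" for t
    using \<psi>_M power_mono[OF \<psi>_bound(2) abs_ge_zero, of _ t 2] by (intro int[of _ "(3 * A\<^sup>2)\<^sup>2"]) auto
  have i\<xi>: "integrable P (\<lambda>p. (\<xi> t p)\<^sup>2)" for t
    using \<xi>_M power_mono[OF \<xi>_bound abs_ge_zero, of _ t 2] by (intro int[of _ "(2 * A\<^sup>2)\<^sup>2"]) auto
  have i\<phi>: "integrable P (\<lambda>p. (\<phi> t p)\<^sup>2)" for t
    using fromF[OF \<phi>_F] power_mono[OF \<phi>_bound abs_ge_zero, of _ t 2] by (intro int[of _ "(A\<^sup>2)\<^sup>2"]) auto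
  have i\<phi>\<xi>: "integrable P (\<lambda>p. \<phi> t p * \<xi> t p)" for t
  proof (rule int)
    show "(\<lambda>p. \<phi> t p * \<xi> t p) \<in> borel_measurable P"
      using fromF[OF \<phi>_F] \<xi>_M by (rule borel_measurable_times)
    show "\<bar>\<phi> t p * \<xi> t p\<bar> \<le> A\<^sup>2 * (2 * A\<^sup>2)" if "p \<in> space P" for p
      using mult_mono'[OF \<phi>_bound[OF that, of t] \<xi>_bound[OF that, of t]] by (simp add: abs_mult)
  qed
  have le: "P.expectation (\<lambda>p. (\<xi> t p)\<^sup>2) \<le> P.expectation (\<lambda>p. (\<psi> t p)\<^sup>2)" for t
  proof -
    have "(\<psi> t p)\<^sup>2 = (\<phi> t p)\<^sup>2 - 2 * (\<phi> t p * \<xi> t p) + (\<xi> t p)\<^sup>2" for p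
      by (simp add: \<xi> power2_eq_square algebra_simps)
    then have "P.expectation (\<lambda>p. (\<psi> t p)\<^sup>2) =
        P.expectation (\<lambda>p. (\<phi> t p)\<^sup>2) - 2 * P.expectation (\<lambda>p. \<phi> t p * \<xi> t p) + P.expectation (\<lambda>p. (\<xi> t p)\<^sup>2)"
      using i\<phi> i\<phi>\<xi> i\<xi> by simp
    moreover have "P.expectation (\<lambda>p. \<phi> t p * \<xi> t p) = 0"
      by (rule P.integral_predictable_mult_martingale_difference[OF P.subalgebra_past[OF indep] xi_centred \<xi>_M \<xi>_bound \<phi>_F \<phi>_bound])
    moreover have "0 \<le> P.expectation (\<lambda>p. (\<phi> t p)\<^sup>2)" by simp
    ultimately show ?thesis by simp
  qed
  let ?C = "A\<^sup>2 * (\<alpha>\<^sup>2 * ((1 + A\<^sup>2 / \<beta>) powr (1 + 2 * \<epsilon>) / (2 * \<epsilon>) * \<beta> powr (- (2 * \<epsilon>))))"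
  have "(\<Sum>t<n. P.expectation (\<lambda>p. (\<psi> t p)\<^sup>2)) \<le> ?C" for n
  proof -
    have "(\<Sum>t<n. P.expectation (\<lambda>p. (\<psi> t p)\<^sup>2)) = P.expectation (\<lambda>p. \<Sum>t<n. (\<psi> t p)\<^sup>2)"
      using i\<psi> by simp
    also have "\<dots> \<le> P.expectation (\<lambda>p. ?C)"
    proof (rule integral_mono)
      show "integrable P (\<lambda>p. \<Sum>t<n. (\<psi> t p)\<^sup>2)" using i\<psi> by simp
      show "(\<Sum>t<n. (\<psi> t p)\<^sup>2) \<le> ?C" if "p \<in> space P" for p
      proof -
        have "(\<Sum>t<n. (\<psi> t p)\<^sup>2) \<le> (\<Sum>t<n. A\<^sup>2 * ((\<eta> t p)\<^sup>2 * a t p))"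
          using \<psi>_bound(1)[OF that] by (rule sum_mono)
        also have "\<dots> \<le> ?C"
          unfolding sum_distrib_left[symmetric]
          using sum_square_steps_le[OF that] by (rule mult_left_mono) simp
        finally show ?thesis .
      qed
    qed simp
    finally show ?thesis by (simp add: P.prob_space)
  qed
  then have "summable (\<lambda>t. P.expectation (\<lambda>p. (\<psi> t p)\<^sup>2))"
    by (intro summableI_nonneg_bounded) auto
  then show ?thesis
    by (rule summable_comparison_test'[of _ 0]) (use le in auto)
qed

lemma xi_summable: "AE p in P. summable (\<lambda>t. \<xi> t p)"
  by (rule P.martingale_differences_summable[where G="\<F>" and B="2 * A\<^sup>2"])
    (use P.subalgebra_past[OF indep] P.past_mono[OF indep] xi_adapted noise_bound omega_space xi_centred
      xi_second_moments in auto)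

subsection \<open>Convergence on a path with convergent noise\<close>

text \<open>With \<open>\<rho>\<close> for the error of the linear approximation of \<open>F\<close> along a step,
  \<open>F (x (Suc t)) = F (x t) - \<eta> b\<^sup>2 + \<xi> + \<rho>\<close>. Both errors are summable and \<open>F\<close> is bounded on \<open>K\<close>, hence the
  nonnegative terms \<open>\<eta> b\<^sup>2\<close> are summable and \<open>F (x t)\<close> converges. The gradient grows by at most a multiple of
  the step length, so \<open>tendsto_zero_of_weighted_squares\<close> applies with the weights \<open>\<eta>\<close>.\<close>

lemma path_convergence:
  assumes p: "p \<in> space P" and noise: "summable (\<lambda>t. \<xi> t p)"
  shows "convergent (\<lambda>t. F (x t p))" "(\<lambda>t. b t p) \<longlonglongrightarrow> 0"
proof -
  obtain C where C: "C > 0" "\<And>y u. y \<in> K \<Longrightarrow> rnorm g y u \<le> A \<Longrightarrow>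
      rnorm g y (radjoint g y (R (y, u)) (dretr \<A> R y u) (grad (R (y, u))) - grad y) \<le> C * rnorm g y u"
    using A(2) unfolding R_Lipschitz_def by blast
  define \<rho> where "\<rho> t = F (x (Suc t) p) - F (x t p) + \<eta> t p * mdiff \<A> std_atlas F (x t p) (h t p)" for t
  have \<rho>: "\<bar>\<rho> t\<bar> \<le> C * ((\<eta> t p)\<^sup>2 * a t p)" for t
  proof -
    let ?u = "- (\<eta> t p *\<^sub>R h t p)"
    have "\<bar>F (R (x t p, ?u)) - F (x t p) - g (x t p) (grad (x t p)) ?u\<bar> \<le> C * (rnorm g (x t p) ?u)\<^sup>2"
      using C(2)[OF stays[OF p]] C(1) step_length[OF p] by (intro retraction_descent) auto
    moreover have "g (x t p) (grad (x t p)) ?u = - (\<eta> t p * mdiff \<A> std_atlas F (x t p) (h t p))"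
      using g_grad by (simp add: g_bilinear_simps)
    ultimately show ?thesis
      unfolding step_length(1)[OF p] by (simp add: \<rho>_def step[OF p] power_mult_distrib)
  qed
  have \<rho>_summable: "summable \<rho>"
    by (rule summable_comparison_test'[OF summable_mult[OF summable_square_steps[OF p], of C], of 0])
      (use \<rho> in auto)
  have telescope: "(\<Sum>t<n. \<eta> t p * (b t p)\<^sup>2) = F (x 0 p) - F (x n p) + (\<Sum>t<n. \<xi> t p) + (\<Sum>t<n. \<rho> t)" for n
    by (induction n) (simp_all add: noise_def \<rho>_def algebra_simps)
  have "bounded (F ` K)"
    using compact_continuous_image[OF continuous_on_subset[OF F_continuous] K] compact_imp_bounded by auto
  then obtain B where B: "\<And>y. y \<in> K \<Longrightarrow> \<bar>F y\<bar> \<le> B"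
    by (auto simp: bounded_iff)
  have partial_sums: "\<exists>B. \<forall>n. \<bar>sum f {..<n}\<bar> \<le> B" if "summable f" for f :: "nat \<Rightarrow> real"
    using that convergent_imp_Bseq[of "\<lambda>n. sum f {..<n}"]
    by (auto simp: summable_iff_convergent Bseq_def)
  obtain B1 where B1: "\<And>n. \<bar>\<Sum>t<n. \<xi> t p\<bar> \<le> B1"
    using partial_sums[OF noise] by blast
  obtain B2 where B2: "\<And>n. \<bar>\<Sum>t<n. \<rho> t\<bar> \<le> B2"
    using partial_sums[OF \<rho>_summable] by blast
  have weighted: "summable (\<lambda>t. \<eta> t p * (b t p)\<^sup>2)"
  proof (rule summableI_nonneg_bounded)
    show "0 \<le> \<eta> t p * (b t p)\<^sup>2" for t using eta_bounds[OF p, of t] by simp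
    show "(\<Sum>t<n. \<eta> t p * (b t p)\<^sup>2) \<le> B + B + B1 + B2" for n
      using B[OF stays[OF p, of 0]] B[OF stays[OF p, of n]] B1[of n] B2[of n] unfolding telescope by linarith
  qed
  have "convergent (\<lambda>n. F (x 0 p) + (\<Sum>t<n. \<xi> t p) + (\<Sum>t<n. \<rho> t) - (\<Sum>t<n. \<eta> t p * (b t p)\<^sup>2))"
    using noise \<rho>_summable weighted unfolding summable_iff_convergent
    by (intro convergent_diff convergent_add convergent_const)
  then show "convergent (\<lambda>t. F (x t p))"
    unfolding telescope by simp
  obtain L where L: "L \<ge> 0" "\<And>y u. y \<in> K \<Longrightarrow> rnorm g y u \<le> A \<Longrightarrow> R (y, u) \<in> K \<Longrightarrow>
      rnorm g (R (y, u)) (grad (R (y, u))) \<le> rnorm g y (grad y) + L * rnorm g y u"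
    using gradient_growth[OF K A(2) rnorm_grad_le] by metis
  show "(\<lambda>t. b t p) \<longlonglongrightarrow> 0"
  proof (rule tendsto_zero_of_weighted_squares)
    let ?d = "\<lambda>t. L * (\<eta> t p * rnorm g (x t p) (h t p))"
    show "0 \<le> b t p" "b t p \<le> A" for t by (rule b_bounds[OF p])+
    show "b (Suc t) p \<le> b t p + ?d t" for t
      using L(2)[of "x t p" "- (\<eta> t p *\<^sub>R h t p)"] stays[OF p] step_length[OF p] by (simp add: step[OF p, symmetric])
    show "0 \<le> ?d t" for t using L eta_bounds[OF p, of t] h_bounds[OF p, of t] by simp
    show "?d t \<le> (L * A) * \<eta> t p" for t
      using mult_left_mono[OF h_bounds(2)[OF p, of t], of "L * \<eta> t p"] L eta_bounds[OF p, of t]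
      by (simp add: mult_ac)
    show "0 \<le> \<eta> t p" "\<eta> t p \<le> 1" for t using eta_bounds[OF p, of t] by auto
    show "summable (\<lambda>t. \<eta> t p * (b t p)\<^sup>2)" by (rule weighted)
    show "summable (\<lambda>t. (?d t)\<^sup>2)"
      using summable_mult[OF summable_square_steps[OF p], of "L\<^sup>2"] by (simp add: power_mult_distrib)
    show "\<not> summable (\<lambda>t. \<eta> t p)" by (rule not_summable_eta[OF p])
  qed
qed

theorem almost_sure_convergence:
  "AE p in P. convergent (\<lambda>t. F (x t p)) \<and> (\<lambda>t. b t p) \<longlonglongrightarrow> 0"
  using xi_summable by (rule AE_mp) (auto intro!: AE_I2 path_convergence)

end

theorem theorem2p5:
  fixes \<A> :: "('m::{t2_space, second_countable_topology}, 'e::euclidean_space) chart set"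
    and g :: "'m \<Rightarrow> 'e \<Rightarrow> 'e \<Rightarrow> real"
    and R :: "'m \<times> 'e \<Rightarrow> 'm"
    and F :: "'m \<Rightarrow> real"
    and K :: "'m set"
    and A :: real
    and M :: "nat \<Rightarrow> 'w measure"
    and H :: "nat \<Rightarrow> 'm \<times> 'w \<Rightarrow> 'm \<times> 'e"
    and P :: "'p measure"
    and \<omega> :: "nat \<Rightarrow> 'p \<Rightarrow> 'w"
    and x\<^sub>0 :: 'm
    and \<alpha> \<beta> \<epsilon> :: real
    and x :: "nat \<Rightarrow> 'p \<Rightarrow> 'm"
    and \<eta> :: "nat \<Rightarrow> 'p \<Rightarrow> real"
  assumes manifold: "riemannian_manifold \<A> g" "connected (UNIV :: 'm set)"
    and retraction: "manifold_retraction \<A> R"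
    and F: "Ck_map 1 \<A> std_atlas F"
    and K: "compact K"
    and A: "A > 0" "R_Lipschitz \<A> g R (rgrad \<A> g F) K A"
    and M: "\<And>t. prob_space (M t)"
    and field: "\<And>t w. w \<in> space (M t) \<Longrightarrow> vector_field (\<lambda>y. H t (y, w))"
    and finite_or_measurable:
      "(\<forall>t. finite (space (M t)) \<and> sets (M t) = Pow (space (M t))) \<or>
       (\<forall>t. H t \<in> measurable (borel \<Otimes>\<^sub>M M t) (atlas_borel (tangent_atlas \<A>)))"
    and unbiased: "\<And>t y. has_bochner_integral (M t) (\<lambda>w. snd (H t (y, w))) (rgrad \<A> g F y)"
    and bounded: "\<And>t y w. y \<in> K \<Longrightarrow> w \<in> space (M t) \<Longrightarrow> rnorm g y (snd (H t (y, w))) \<le> A"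
    and P: "prob_space P"
    and indep: "prob_space.indep_vars P M \<omega> UNIV"
    and distribution: "\<And>t. distr P (M t) (\<omega> t) = M t"
    and parameters: "x\<^sub>0 \<in> K" "\<alpha> > 0" "\<beta> > 0" "0 < \<epsilon>" "\<epsilon> \<le> 1/2" "\<alpha> \<le> \<beta> powr (1/2 + \<epsilon>)"
    and start: "\<And>p. p \<in> space P \<Longrightarrow> x 0 p = x\<^sub>0"
    and step: "\<And>t p. p \<in> space P \<Longrightarrow>
      x (Suc t) p = R (x t p, - (\<eta> t p *\<^sub>R snd (H t (x t p, \<omega> t p))))"
    and rate: "\<And>t p. p \<in> space P \<Longrightarrow>
      \<eta> t p = \<alpha> / (\<beta> + (\<Sum>k<t. (rnorm g (x k p) (snd (H k (x k p, \<omega> k p))))\<^sup>2)) powr (1/2 + \<epsilon>)"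
    and stays: "\<And>t p. p \<in> space P \<Longrightarrow> x t p \<in> K"
  shows "(AE p in P. convergent (\<lambda>t. F (x t p))) \<and>
         (AE p in P. (\<lambda>t. rnorm g (x t p) (rgrad \<A> g F (x t p))) \<longlonglongrightarrow> 0)"
proof -
  interpret adaptive_gradient_descent \<A> g F R P K A M H \<omega> x\<^sub>0 \<alpha> \<beta> \<epsilon> x \<eta>
  proof (intro adaptive_gradient_descent.intro C1_function_with_retraction.intro riemannian_retraction.intro
      riemannian.intro smooth_manifold.intro riemannian_axioms.intro retraction.intro retraction_axioms.intro
      C1_function.intro C1_function_axioms.intro adaptive_gradient_descent_axioms.intro)
  qed (use assms in \<open>auto simp: riemannian_manifold_def\<close>)
  show ?thesis
    using almost_sure_convergence by auto
qed

end
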